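(* Let $D=\{(t,x)\in\mathbb{R}^{1+3}: 0\le t<1,\ (x_1-1)^2+x_2^2+x_3^2<(1-t)^2\}$ and $D_t=\{x:(t,x)\in D\}$. There is a constant $C$ such that for every $\varepsilon>0$ there is a smooth solution $\phi=(\phi_1,\phi_2)$ on $D$ of the system $$\Box\phi_2=-(\underline{L}\phi_1)^2,\qquad \Box\phi_1=0$$ such that $$\|\phi(0,\cdot)\|_{H^2(D_0)}+\|\partial_t\phi(0,\cdot)\|_{H^1(D_0)}\le\varepsilon,$$ but for every $0<t<1$ $$\|\phi(t,\cdot)\|_{H^2(D_t)}+\|\partial_t\phi(t,\cdot)\|_{H^1(D_t)}=\infty .$$ Moreover, the data $(\phi(0,\cdot),\partial_t\phi(0,\cdot))$ can be extended from $D_0$ to $\mathbb{R}^3$ so that the extended data satisfy $$\|\phi(0,\cdot)\|_{H^2(\mathbb{R}^3)}+\|\partial_t\phi(0,\cdot)\|_{H^1(\mathbb{R}^3)}\le C\varepsilon .$$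
   Context: Here $x=(x_1,x_2,x_3)\in\mathbb{R}^3$, $\Box=-\partial_t^2+\partial_{x_1}^2+\partial_{x_2}^2+\partial_{x_3}^2$ is the wave operator on $\mathbb{R}^{1+3}$, and $\underline{L}=\partial_t-\partial_{x_1}$. The functions $\phi_1,\phi_2$ are real-valued. *)

theory Defs
  imports "HOL-Analysis.Analysis"
begin

fun Ck_on :: "nat \<Rightarrow> ('a::euclidean_space \<Rightarrow> real) \<Rightarrow> 'a set \<Rightarrow> bool" where
  "Ck_on 0 f U \<longleftrightarrow> continuous_on U f"
| "Ck_on (Suc k) f U \<longleftrightarrow> f differentiable_on U \<and>
     (\<forall>b\<in>Basis. Ck_on k (\<lambda>x. frechet_derivative f (at x) b) U)"

text \<open>On a set that is not open, smoothness means smoothness on some open neighbourhood.  In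
  particular all derivatives below are ordinary two-sided derivatives, also at time 0.\<close>

definition smooth_on :: "'a::euclidean_space set \<Rightarrow> ('a \<Rightarrow> real) \<Rightarrow> bool" where
  "smooth_on S f \<longleftrightarrow> (\<exists>U. open U \<and> S \<subseteq> U \<and> (\<forall>k. Ck_on k f U))"

definition partial :: "3 \<Rightarrow> (real^3 \<Rightarrow> real) \<Rightarrow> real^3 \<Rightarrow> real" where
  "partial i f x = frechet_derivative f (at x) (axis i 1)"

definition multi_partial :: "(3 \<Rightarrow> nat) \<Rightarrow> (real^3 \<Rightarrow> real) \<Rightarrow> real^3 \<Rightarrow> real" where
  "multi_partial \<alpha> f = (partial 1 ^^ \<alpha> 1) ((partial 2 ^^ \<alpha> 2) ((partial 3 ^^ \<alpha> 3) f))"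

definition test_function :: "(real^3) set \<Rightarrow> (real^3 \<Rightarrow> real) \<Rightarrow> bool" where
  "test_function U \<eta> \<longleftrightarrow> smooth_on UNIV \<eta> \<and>
     (\<exists>K. compact K \<and> K \<subseteq> U \<and> (\<forall>x. x \<notin> K \<longrightarrow> \<eta> x = 0))"

definition locally_integrable_on :: "(real^3 \<Rightarrow> 'b::euclidean_space) \<Rightarrow> (real^3) set \<Rightarrow> bool" where
  "locally_integrable_on f U \<longleftrightarrow> (\<forall>K. compact K \<and> K \<subseteq> U \<longrightarrow> integrable (lebesgue_on K) f)"

definition has_weak_partial ::
  "(3 \<Rightarrow> nat) \<Rightarrow> (real^3) set \<Rightarrow> (real^3 \<Rightarrow> 'b::euclidean_space) \<Rightarrow> (real^3 \<Rightarrow> 'b) \<Rightarrow> bool" where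
  "has_weak_partial \<alpha> U f g \<longleftrightarrow>
     locally_integrable_on f U \<and> locally_integrable_on g U \<and>
     (\<forall>\<eta>. test_function U \<eta> \<longrightarrow>
        (\<integral>x. multi_partial \<alpha> \<eta> x *\<^sub>R f x \<partial>lebesgue_on U) =
        (- 1) ^ (\<Sum>i\<in>UNIV. \<alpha> i) *\<^sub>R (\<integral>x. \<eta> x *\<^sub>R g x \<partial>lebesgue_on U))"

definition ennsqrt :: "ennreal \<Rightarrow> ennreal" where
  "ennsqrt a = (if a = \<infinity> then \<infinity> else ennreal (sqrt (enn2real a)))"

text \<open>The norm of \<open>H\<^sup>k(U)\<close> for open \<open>U\<close>, equal to \<open>\<infinity>\<close> outside \<open>H\<^sup>k(U)\<close>.  Weak derivatives are
  unique up to null sets, so the infimum is over at most one value; it is \<open>\<infinity>\<close> if some weak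
  derivative of order at most \<open>k\<close> does not exist.\<close>

definition sobolev_norm ::
  "nat \<Rightarrow> (real^3) set \<Rightarrow> (real^3 \<Rightarrow> 'b::euclidean_space) \<Rightarrow> ennreal" where
  "sobolev_norm k U f =
     Inf {ennsqrt (\<Sum>\<alpha> | (\<Sum>i\<in>UNIV. \<alpha> i) \<le> k.
            \<integral>\<^sup>+x. ennreal ((norm (g \<alpha> x))\<^sup>2) \<partial>lebesgue_on U) | g.
          \<forall>\<alpha>. (\<Sum>i\<in>UNIV. \<alpha> i) \<le> k \<longrightarrow> has_weak_partial \<alpha> U f (g \<alpha>)}"

text \<open>Points of \<open>\<real>\<^bsup>1+3\<^esup>\<close> are pairs \<open>(t, x)\<close>.\<close>

definition dt :: "(real \<times> (real^3) \<Rightarrow> real) \<Rightarrow> real \<times> (real^3) \<Rightarrow> real" where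
  "dt f p = frechet_derivative f (at p) (1, 0)"

definition dx :: "3 \<Rightarrow> (real \<times> (real^3) \<Rightarrow> real) \<Rightarrow> real \<times> (real^3) \<Rightarrow> real" where
  "dx i f p = frechet_derivative f (at p) (0, axis i 1)"

definition wave_op :: "(real \<times> (real^3) \<Rightarrow> real) \<Rightarrow> real \<times> (real^3) \<Rightarrow> real" where
  "wave_op f p = - dt (dt f) p + dx 1 (dx 1 f) p + dx 2 (dx 2 f) p + dx 3 (dx 3 f) p"

definition Lbar :: "(real \<times> (real^3) \<Rightarrow> real) \<Rightarrow> real \<times> (real^3) \<Rightarrow> real" where
  "Lbar f p = dt f p - dx 1 f p"

definition coneD :: "(real \<times> (real^3)) set" where
  "coneD = {(t, x). 0 \<le> t \<and> t < 1 \<and> (x $ 1 - 1)\<^sup>2 + (x $ 2)\<^sup>2 + (x $ 3)\<^sup>2 < (1 - t)\<^sup>2}"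

definition coneD_slice :: "real \<Rightarrow> (real^3) set" where
  "coneD_slice t = {x. (t, x) \<in> coneD}"

end

theory Submission
  imports Defs "HOL-Real_Asymp.Real_Asymp"
begin

text \<open>
  Put \<open>u = x $ 1 - t\<close>, which is positive on the cone, and let \<open>\<phi>1 = \<delta> * f u\<close> and
  \<open>\<phi>2 = \<delta>\<^sup>2 * t * h u\<close> with \<open>h' = - 2 * f'\<^sup>2\<close>; this solves the system.  Every slice of the cone
  is a ball tangent to the plane \<open>u = 0\<close>, and its cross section at height \<open>u\<close> has area of order \<open>u\<close>.  Hence
  a function \<open>k u\<close> is square integrable on a slice iff \<open>u * (k u)\<^sup>2\<close> is integrable near \<open>0\<close>.
  For \<open>f' u\<close> of size \<open>(ln (1 / u)) powr (1/4)\<close> we have \<open>f''\<close> of size \<open>(ln (1 / u)) powr (- 3/4) / u\<close>, which is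
  square integrable, while \<open>h'' = - 4 * f' * f''\<close> is of size \<open>(ln (1 / u)) powr (- 1/2) / u\<close>, which is not.  The data at
  \<open>t = 0\<close> involve only \<open>f\<close>, \<open>f'\<close> and \<open>h\<close>, but for \<open>t > 0\<close> the second derivative of \<open>\<phi>2\<close> contains \<open>t * h''\<close>.

  Outside the ball \<open>half_sq x < x $ 1\<close>, where \<open>half_sq x = \<bar>x\<bar>\<^sup>2 / 2\<close>, the data are extended by replacing \<open>x $ 1\<close> with
  \<open>half_sq x\<close>; the two agree on the boundary sphere, and in three dimensions the resulting isotropic singularity
  at the origin is harmless.
\<close>

section \<open>Functions of class \<open>C\<^sup>k\<close>\<close>

text \<open>The exponent 1/4 is an endpoint of the admissible range. Let
  \<open>y = ln (4 / u)\<close> and let f' have size y^a. Then f'' has size y^(a-1) / u and the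
  derivative of f'^2 has size y^(2a-1) / u. With the weight u of the cross section and dy = - du /
  u, the squares integrate like y^(2a-2) dy and y^(4a-2) dy as y grows. The first converges iff a <
  1/2, the second diverges iff a >= 1/4; at a = 1/4 the divergence is exactly that of the harmonic
  series. The logarithm is multiplied by a factor exp (-1 / y), which leaves the size as u tends to
  0 unchanged and makes everything vanish smoothly from u = 4 on. Hence the extended data have
  bounded support. On the initial ball u < 2, so the cut-off does not reach it. The norm is an
  infimum over all families of weak derivatives. Finiteness therefore requires weak derivatives
  across the gluing sphere and across the singular point, obtained here from the fundamental theorem
  of calculus on lines parallel to the axes. Infinity requires a lower bound that holds for every
  candidate.\<close>

lemma frechet_derivative_cong_open:
  assumes "open U" "x \<in> U" "\<And>y. y \<in> U \<Longrightarrow> f y = g y"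
  shows "frechet_derivative f (at x) = frechet_derivative g (at x)"
proof -
  have "(f has_derivative D) (at x) \<longleftrightarrow> (g has_derivative D) (at x)" for D
    using has_derivative_transform_within_open[OF _ assms(1,2)] assms(3) by metis
  then show ?thesis by (simp add: frechet_derivative_def)
qed

lemma differentiable_on_cong:
  assumes "f differentiable_on U" "\<And>y. y \<in> U \<Longrightarrow> f y = g y"
  shows "g differentiable_on U"
  using assms unfolding differentiable_on_def
  by (metis differentiable_transform_within zero_less_one)

lemma differentiable_on_open_has_derivative:
  assumes "f differentiable_on U" "open U" "x \<in> U"
  shows "(f has_derivative frechet_derivative f (at x)) (at x)"
  using assms by (simp add: differentiable_on_eq_differentiable_at frechet_derivative_works)

lemma Ck_on_cong:
  assumes "open U" "Ck_on k f U" "\<And>y. y \<in> U \<Longrightarrow> f y = g y"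
  shows "Ck_on k g U"
  using assms(2,3)
proof (induction k arbitrary: f g)
  case 0 then show ?case using continuous_on_eq by force
next
  case (Suc k)
  have "Ck_on k (\<lambda>x. frechet_derivative g (at x) b) U" if "b \<in> Basis" for b
  proof (rule Suc.IH)
    show "Ck_on k (\<lambda>x. frechet_derivative f (at x) b) U" using Suc.prems that by simp
  qed (use frechet_derivative_cong_open[OF assms(1)] Suc.prems in metis)
  then show ?case using Suc.prems differentiable_on_cong by fastforce
qed

lemma Ck_on_SucI:
  assumes "open U" "\<And>x. x \<in> U \<Longrightarrow> (f has_derivative D x) (at x)"
    and "\<And>b. b \<in> Basis \<Longrightarrow> Ck_on k (\<lambda>x. D x b) U"
  shows "Ck_on (Suc k) f U"
proof -
  have "f differentiable_on U"
    unfolding differentiable_on_def differentiable_def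
    using assms(2) has_derivative_at_withinI by blast
  moreover have "Ck_on k (\<lambda>x. frechet_derivative f (at x) b) U" if "b \<in> Basis" for b
    by (rule Ck_on_cong[OF assms(1) assms(3)[OF that]])
       (use assms(2) frechet_derivative_at in metis)
  ultimately show ?thesis by simp
qed

lemma Ck_on_mono:
  assumes "Ck_on k f U" "V \<subseteq> U"
  shows "Ck_on k f V"
  using assms(1)
proof (induction k arbitrary: f)
  case 0 then show ?case using assms(2) continuous_on_subset by auto
next
  case (Suc k) then show ?case using assms(2) by (auto intro: differentiable_on_subset)
qed

lemma Ck_on_Suc_imp: "Ck_on (Suc k) f U \<Longrightarrow> Ck_on k f U"
proof (induction k arbitrary: f)
  case 0 then show ?case by (simp add: differentiable_imp_continuous_on)
next
  case (Suc k)
  then show ?case by (metis Ck_on.simps(2))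
qed

lemma Ck_on_union:
  assumes "open U" "open V" "Ck_on k f U" "Ck_on k f V"
  shows "Ck_on k f (U \<union> V)"
  using assms(3,4)
proof (induction k arbitrary: f)
  case 0 then show ?case using assms by (simp add: continuous_on_open_Un)
next
  case (Suc k)
  then show ?case using assms(1,2)
    by (auto simp: differentiable_on_eq_differentiable_at open_Un)
qed

lemma Ck_on_const: "Ck_on k (\<lambda>x. c) U"
  by (induction k arbitrary: c) (simp_all add: frechet_derivative_const)

lemma Ck_on_linear:
  assumes "bounded_linear f"
  shows "Ck_on k f U"
proof (cases k)
  case 0
  then show ?thesis using assms by (simp add: linear_continuous_on)
next
  case (Suc n)
  have "frechet_derivative f (at x) = f" for x
    using assms by (metis bounded_linear_imp_has_derivative frechet_derivative_at)
  then show ?thesis using Suc assms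
    by (simp add: bounded_linear_imp_differentiable_on Ck_on_const)
qed

lemma Ck_on_add:
  assumes "open U" "Ck_on k f U" "Ck_on k g U"
  shows "Ck_on k (\<lambda>x. f x + g x) U"
  using assms(2,3)
proof (induction k arbitrary: f g)
  case 0 then show ?case by (simp add: continuous_on_add)
next
  case (Suc k)
  show ?case
  proof (rule Ck_on_SucI[OF assms(1)])
    show "((\<lambda>x. f x + g x) has_derivative
      (\<lambda>b. frechet_derivative f (at x) b + frechet_derivative g (at x) b)) (at x)"
      if "x \<in> U" for x
      using Suc.prems that assms(1)
      by (auto intro!: has_derivative_add differentiable_on_open_has_derivative)
  qed (use Suc in auto)
qed

lemma Ck_on_mult:
  assumes "open U" "Ck_on k f U" "Ck_on k g U"
  shows "Ck_on k (\<lambda>x. f x * g x) U"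
  using assms(2,3)
proof (induction k arbitrary: f g)
  case 0 then show ?case by (simp add: continuous_on_mult)
next
  case (Suc k)
  note imp = Suc.prems[THEN Ck_on_Suc_imp]
  show ?case
  proof (rule Ck_on_SucI[OF assms(1)])
    show "((\<lambda>x. f x * g x) has_derivative
      (\<lambda>b. f x * frechet_derivative g (at x) b + frechet_derivative f (at x) b * g x)) (at x)"
      if "x \<in> U" for x
      using Suc.prems that assms(1)
      by (auto intro!: has_derivative_mult differentiable_on_open_has_derivative)
  next
    show "Ck_on k (\<lambda>x. f x * frechet_derivative g (at x) b +
        frechet_derivative f (at x) b * g x) U" if "b \<in> Basis" for b
      using Suc that imp by (intro Ck_on_add assms(1) Suc.IH) auto
  qed
qed

text \<open>The chain rule writes each derivative as \<open>\<phi>'\<close> composed with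
  \<open>q\<close>, times a derivative of \<open>q\<close>. With a one-dimensional outer function
  the induction needs to vary only \<open>\<phi>\<close>, and the product rule closes the
  step.\<close>

lemma Ck_on_compose:
  fixes \<phi> :: "real \<Rightarrow> real"
  assumes "open U" "open I" "q ` U \<subseteq> I" "Ck_on k q U" "Ck_on k \<phi> I"
  shows "Ck_on k (\<lambda>x. \<phi> (q x)) U"
  using assms(4,5)
proof (induction k arbitrary: \<phi>)
  case 0 then show ?case
    using continuous_on_compose2[of I \<phi> U q] assms(3) by simp
next
  case (Suc k)
  show ?case
  proof (rule Ck_on_SucI[OF assms(1)])
    show "((\<lambda>x. \<phi> (q x)) has_derivative
      (\<lambda>b. frechet_derivative \<phi> (at (q x)) 1 * frechet_derivative q (at x) b)) (at x)"
      if "x \<in> U" for x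
    proof -
      have d: "(\<phi> has_derivative frechet_derivative \<phi> (at (q x))) (at (q x))"
        using Suc.prems that assms(2,3) by (intro differentiable_on_open_has_derivative) auto
      have lin: "frechet_derivative \<phi> (at (q x)) b = frechet_derivative \<phi> (at (q x)) 1 * b" for b
        using linear_scale[OF has_derivative_linear[OF d], of b 1] by simp
      have "(q has_derivative frechet_derivative q (at x)) (at x)"
        using Suc.prems that assms(1) by (auto intro: differentiable_on_open_has_derivative)
      then have "((\<lambda>x. \<phi> (q x)) has_derivative
          (\<lambda>b. frechet_derivative \<phi> (at (q x)) (frechet_derivative q (at x) b))) (at x)"
        by (rule has_derivative_compose) (rule d)
      then show ?thesis by (subst (asm) lin)
    qed
  next
    show "Ck_on k (\<lambda>x. frechet_derivative \<phi> (at (q x)) 1 * frechet_derivative q (at x) b) U"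
      if "b \<in> Basis" for b
      using Suc.prems Ck_on_Suc_imp[OF Suc.prems(1)] that
      by (intro Ck_on_mult[OF assms(1)] Suc.IH[where \<phi> = "\<lambda>y. frechet_derivative \<phi> (at y) 1"]) auto
  qed
qed

lemma Ck_on_real_SucI:
  fixes f :: "real \<Rightarrow> real"
  assumes "open I" "\<And>x. x \<in> I \<Longrightarrow> (f has_real_derivative f' x) (at x)" "Ck_on k f' I"
  shows "Ck_on (Suc k) f I"
  by (rule Ck_on_SucI[OF assms(1), where D = "\<lambda>x b. f' x * b"])
     (use assms in \<open>auto simp: has_field_derivative_def\<close>)

lemma Ck_on_inverse: "Ck_on k (inverse :: real \<Rightarrow> real) {0<..}"
proof (induction k)
  case 0 show ?case by (auto intro!: continuous_intros)
next
  case (Suc k)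
  show ?case
  proof (rule Ck_on_real_SucI[where f' = "\<lambda>x. (-1) * (inverse x * inverse x)"])
    show "(inverse has_real_derivative -1 * (inverse x * inverse x)) (at x)" if "x \<in> {0<..}" for x :: real
      using that by (auto intro!: derivative_eq_intros)
    next
    show "Ck_on k (\<lambda>x. (-1) * (inverse x * inverse x)) {0<..}" for x :: real
      by (intro Ck_on_mult Suc Ck_on_const) auto
  qed simp
qed

lemma Ck_on_ln: "Ck_on k (ln :: real \<Rightarrow> real) {0<..}"
proof (cases k)
  case 0 then show ?thesis by (auto intro!: continuous_intros)
next
  case (Suc n)
  show ?thesis unfolding Suc
    by (rule Ck_on_real_SucI[OF _ _ Ck_on_inverse])
       (auto intro!: derivative_eq_intros simp: divide_inverse)
qed

section \<open>A flat function\<close>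

text \<open>The exponent is a parameter because differentiation maps the family into linear
  combinations of itself, with exponents \<open>a - 1\<close> and \<open>a - 2\<close>. Smoothness
  of all members is then a single induction. Exponent 0 is the classical exp (-1 / y).\<close>

definition flat_powr :: "real \<Rightarrow> real \<Rightarrow> real" where
  "flat_powr a y = (if y > 0 then y powr a * exp (- 1 / y) else 0)"

lemma flat_powr_tendsto_0: "(flat_powr a \<longlongrightarrow> 0) (at 0)"
proof -
  have "((\<lambda>y. y powr a * exp (- 1 / y)) \<longlongrightarrow> 0) (at_right 0)" by real_asymp
  then have "(flat_powr a \<longlongrightarrow> 0) (at_right 0)"
    by (rule Lim_transform_eventually) (auto simp: flat_powr_def eventually_at_filter)
  moreover have "(flat_powr a \<longlongrightarrow> 0) (at_left 0)"
    by (rule Lim_transform_eventually[OF tendsto_const]) (auto simp: flat_powr_def eventually_at_filter)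
  ultimately show ?thesis using filterlim_split_at by blast
qed

lemma has_derivative_flat_powr:
  "(flat_powr a has_real_derivative (a * flat_powr (a - 1) y + flat_powr (a - 2) y)) (at y)"
proof -
  consider "y < 0" | "y = 0" | "y > 0" by linarith
  then show ?thesis
  proof cases
    case 1
    have "((\<lambda>y. 0) has_real_derivative 0) (at y)" by simp
    then have "(flat_powr a has_real_derivative 0) (at y)"
      by (rule has_field_derivative_transform_within_open[where S = "{..<0}"])
         (use 1 in \<open>auto simp: flat_powr_def\<close>)
    then show ?thesis using 1 by (simp add: flat_powr_def)
  next
    case 2
    \<comment> \<open>The difference quotient at 0 is again a member of the family, so its limit is
      already known.\<close>
    have "(\<lambda>h. (flat_powr a (0 + h) - flat_powr a 0) / h) = flat_powr (a - 1)"
      by (auto simp: flat_powr_def fun_eq_iff powr_diff)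
    then show ?thesis using 2 flat_powr_tendsto_0[of "a - 1"]
      by (simp add: DERIV_def flat_powr_def)
  next
    case 3
    have "((\<lambda>y. y powr a * exp (- 1 / y)) has_real_derivative
       (a * (y powr (a - 1) * exp (- 1 / y)) + y powr (a - 2) * exp (- 1 / y))) (at y)"
      using 3 by (auto intro!: derivative_eq_intros simp: powr_diff field_simps power2_eq_square)
    then have "(flat_powr a has_real_derivative
       (a * (y powr (a - 1) * exp (- 1 / y)) + y powr (a - 2) * exp (- 1 / y))) (at y)"
      by (rule has_field_derivative_transform_within_open[where S = "{0<..}"])
         (use 3 in \<open>auto simp: flat_powr_def\<close>)
    then show ?thesis using 3 by (simp add: flat_powr_def)
  qed
qed

lemma continuous_on_flat_powr: "continuous_on S (flat_powr a)"
  using has_derivative_flat_powr DERIV_isCont continuous_at_imp_continuous_on by blast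

lemma borel_measurable_flat_powr [measurable]: "flat_powr a \<in> borel_measurable borel"
  by (rule borel_measurable_continuous_onI[OF continuous_on_flat_powr])

lemma Ck_on_flat_powr: "Ck_on k (flat_powr a) UNIV"
proof (induction k arbitrary: a)
  case 0 show ?case by (simp add: continuous_on_flat_powr)
next
  case (Suc k)
  show ?case
    by (rule Ck_on_real_SucI[OF _ has_derivative_flat_powr])
       (auto intro!: Ck_on_add Ck_on_mult Ck_on_const Suc)
qed

lemma flat_powr_nonneg: "flat_powr a y \<ge> 0"
  by (simp add: flat_powr_def)

text \<open>The gap for exponent n + 1 has derivative (n + 1) times the gap for n, and it is
  positive at 0.\<close>

lemma power_le_fact_exp: "z \<ge> 0 \<Longrightarrow> z ^ n \<le> fact n * exp z" for z :: real
proof (induction n arbitrary: z)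
  case 0 then show ?case by simp
next
  case (Suc n)
  let ?f = "\<lambda>z::real. fact (Suc n) * exp z - z ^ Suc n"
  have "?f 0 \<le> ?f z"
  proof (rule DERIV_nonneg_imp_nondecreasing[OF Suc.prems])
    fix x :: real assume "0 \<le> x"
    have "(?f has_real_derivative (of_nat (Suc n) * (fact n * exp x - x ^ n))) (at x)"
      by (auto intro!: derivative_eq_intros simp: algebra_simps simp del: power_Suc)
    moreover have "of_nat (Suc n) * (fact n * exp x - x ^ n) \<ge> (0::real)"
      using Suc.IH[OF \<open>0 \<le> x\<close>] by simp
    ultimately show "\<exists>y. DERIV ?f x :> y \<and> 0 \<le> y" by blast
  qed
  moreover have "?f 0 = fact (Suc n)" by simp
  moreover have "(0::real) \<le> fact (Suc n)" by (rule fact_ge_zero)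
  ultimately show ?case by linarith
qed

text \<open>With \<open>z = 1 / y\<close> one has \<open>1 + y = y * (1 + z)\<close>, which reduces
  the claim to exp (-z) being at most a multiple of (1 + z)^a. The exponential beats the negative
  power. The gain is that \<open>(1 + y) powr a\<close> stays bounded near \<open>y = 0\<close> even
  when \<open>a < 0\<close>.\<close>

lemma flat_powr_bound: "\<exists>C>0. \<forall>y>0. flat_powr a y \<le> C * (1 + y) powr a"
proof -
  obtain n :: nat where n: "- a \<le> real n" using real_arch_simple by blast
  have "flat_powr a y \<le> (fact n * exp 1) * (1 + y) powr a" if "y > 0" for y
  proof -
    define z where "z = 1 / y"
    have z: "z > 0" "1 + y = y * (1 + z)" using that by (auto simp: z_def field_simps)
    have "(1 + z) powr (- a) \<le> (1 + z) powr (real n)" using z n by (intro powr_mono) auto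
    also have "\<dots> = (1 + z) ^ n" using z by (simp add: powr_realpow)
    also have "\<dots> \<le> fact n * exp (1 + z)" using z by (intro power_le_fact_exp) auto
    finally have "(1 + z) powr (- a) \<le> fact n * exp 1 * exp z" by (simp add: exp_add)
    then have "(1 + z) powr (- a) * exp (- z) \<le> fact n * exp 1"
      by (simp add: exp_minus field_simps)
    then have "exp (- z) \<le> fact n * exp 1 * (1 + z) powr a"
      using z by (simp add: powr_minus field_simps)
    then have "y powr a * exp (- z) \<le> y powr a * (fact n * exp 1 * (1 + z) powr a)"
      by (intro mult_left_mono) auto
    also have "\<dots> = (fact n * exp 1) * (1 + y) powr a"
      using z that by (simp add: powr_mult)
    finally show ?thesis using that by (simp add: flat_powr_def z_def)
  qed
  moreover have "(fact n * exp 1 :: real) > 0" by simp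
  ultimately show ?thesis by blast
qed

section \<open>Integration of directional derivatives\<close>

lemma lborel_integral_translate:
  fixes f :: "'a::euclidean_space \<Rightarrow> real"
  assumes [measurable]: "f \<in> borel_measurable borel"
  shows "(\<integral>x. f (x + c) \<partial>lborel) = (\<integral>x. f x \<partial>lborel)"
proof -
  have "(\<integral>x. f x \<partial>lborel) = (\<integral>x. f x \<partial>distr lborel borel ((+) c))"
    by (simp add: lborel_distr_plus)
  also have "\<dots> = (\<integral>x. f (c + x) \<partial>lborel)"
    by (rule integral_distr) auto
  finally show ?thesis by (simp add: add.commute)
qed

lemma lborel_integrable_translate:
  fixes f :: "'a::euclidean_space \<Rightarrow> real"
  assumes "integrable lborel f"
  shows "integrable lborel (\<lambda>x. f (x + c))"
proof -
  have "integrable (distr lborel borel ((+) c)) f"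
    using assms by (simp add: lborel_distr_plus)
  then have "integrable lborel (\<lambda>x. f (c + x))"
    by (rule integrable_distr[rotated]) auto
  then show ?thesis by (simp add: add.commute)
qed

text \<open>Averaging \<open>\<Psi>\<close> over the translates by \<open>r *\<^sub>R v\<close>, \<open>0 \<le> r \<le> 1\<close>, does not change its integral,
  and by the fundamental theorem of calculus on lines it turns \<open>\<Psi>\<close> into a difference of two translates
  of \<open>\<psi>\<close>.\<close>

lemma integral_directional_derivative_eq_0:
  fixes \<psi> \<Psi> :: "'a::euclidean_space \<Rightarrow> real"
  assumes \<psi>: "integrable lborel \<psi>" and \<Psi>: "integrable lborel \<Psi>"
    and lines: "AE x in lborel. \<exists>S. finite S \<and> continuous_on {0..1} (\<lambda>r. \<psi> (x + r *\<^sub>R v)) \<and>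
      (\<forall>r\<in>{0<..<1} - S. ((\<lambda>r. \<psi> (x + r *\<^sub>R v)) has_real_derivative \<Psi> (x + r *\<^sub>R v)) (at r))"
  shows "(\<integral>x. \<Psi> x \<partial>lborel) = 0"
proof -
  have [measurable]: "\<psi> \<in> borel_measurable borel" "\<Psi> \<in> borel_measurable borel"
    using \<psi> \<Psi> by (auto dest: borel_measurable_integrable)
  define J where "J = (\<lambda>(r::real) x. indicator {0..1} r * \<Psi> (x + r *\<^sub>R v))"
  have [measurable]: "(\<lambda>(r, x). J r x) \<in> borel_measurable (lborel \<Otimes>\<^sub>M lborel)"
    unfolding J_def by measurable
  have norm_J: "(\<integral>x. norm (J r x) \<partial>lborel) = indicator {0..1} r * (\<integral>x. \<bar>\<Psi> x\<bar> \<partial>lborel)" for r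
    using lborel_integral_translate[of "\<lambda>x. \<bar>\<Psi> x\<bar>" "r *\<^sub>R v"]
    by (simp add: J_def abs_mult)
  have int_J: "(\<integral>x. J r x \<partial>lborel) = indicator {0..1} r * (\<integral>x. \<Psi> x \<partial>lborel)" for r
    using lborel_integral_translate[of \<Psi> "r *\<^sub>R v"] by (simp add: J_def)
  have ind: "integrable lborel (indicator {0..1::real} :: real \<Rightarrow> real)"
    by (auto simp: emeasure_lborel_Icc_eq)
  have J: "integrable (lborel \<Otimes>\<^sub>M lborel) (case_prod J)"
  proof (rule lborel_pair.Fubini_integrable)
    show "integrable lborel (\<lambda>r. \<integral>x. norm (case_prod J (r, x)) \<partial>lborel)"
      using ind by (simp add: norm_J del: real_norm_def)
    show "AE r in lborel. integrable lborel (\<lambda>x. case_prod J (r, x))"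
      by (auto simp: J_def intro!: integrable_mult_right lborel_integrable_translate \<Psi>)
  qed measurable
  have "AE x in lborel. integrable lborel (\<lambda>r. J r x)"
    using lborel_pair.AE_integrable_snd[OF J] by simp
  then have "AE x in lborel. (\<integral>r. J r x \<partial>lborel) = \<psi> (x + v) - \<psi> x"
    using lines
  proof eventually_elim
    case (elim x)
    then obtain S where S: "finite S" "continuous_on {0..1} (\<lambda>r. \<psi> (x + r *\<^sub>R v))"
      "\<And>r. r \<in> {0<..<1} - S \<Longrightarrow>
        ((\<lambda>r. \<psi> (x + r *\<^sub>R v)) has_real_derivative \<Psi> (x + r *\<^sub>R v)) (at r)"
      by blast
    have "((\<lambda>r. \<Psi> (x + r *\<^sub>R v)) has_integral (\<psi> (x + 1 *\<^sub>R v) - \<psi> (x + 0 *\<^sub>R v))) {0..1}"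
      by (rule fundamental_theorem_of_calculus_interior_strong[OF S(1)])
         (use S in \<open>auto simp: has_real_derivative_iff_has_vector_derivative\<close>)
    then have "((\<lambda>r. J r x) has_integral (\<psi> (x + 1 *\<^sub>R v) - \<psi> (x + 0 *\<^sub>R v))) UNIV"
      by (subst (asm) has_integral_restrict_UNIV[symmetric])
         (erule has_integral_eq[rotated], auto simp: J_def)
    then show ?case
      using has_integral_unique[OF has_integral_integral_lborel[OF elim(1)]] by simp
  qed
  then have "(\<integral>x. (\<integral>r. J r x \<partial>lborel) \<partial>lborel) = (\<integral>x. \<psi> (x + v) - \<psi> x \<partial>lborel)"
    by (intro integral_cong_AE) measurable
  also have "\<dots> = 0"
    using \<psi> by (simp add: Bochner_Integration.integral_diff lborel_integrable_translate
        lborel_integral_translate)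
  finally have "(\<integral>r. (\<integral>x. J r x \<partial>lborel) \<partial>lborel) = 0"
    using lborel_pair.Fubini_integral[OF J] by simp
  then show ?thesis by (simp add: int_J)
qed

section \<open>Test functions and Sobolev norms\<close>

lemma smooth_on_UNIV_iff: "smooth_on UNIV f \<longleftrightarrow> (\<forall>k. Ck_on k f UNIV)"
  by (auto simp: smooth_on_def top.extremum_unique)

lemma test_function_differentiable:
  assumes "test_function U \<eta>"
  shows "\<eta> differentiable at x"
proof -
  have "Ck_on (Suc 0) \<eta> UNIV" using assms by (simp only: test_function_def smooth_on_UNIV_iff)
  then show ?thesis by (simp add: differentiable_on_eq_differentiable_at)
qed

lemma test_function_has_derivative:
  assumes "test_function U \<eta>"
  shows "(\<eta> has_derivative frechet_derivative \<eta> (at x)) (at x)"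
  using test_function_differentiable[OF assms] frechet_derivative_works by blast

lemma test_function_continuous:
  assumes "test_function U \<eta>"
  shows "continuous_on A \<eta>"
  by (intro continuous_at_imp_continuous_on ballI
      has_derivative_continuous[OF test_function_has_derivative[OF assms]])

lemma test_function_line_derivative:
  assumes "test_function U \<eta>"
  shows "((\<lambda>r. \<eta> (x + r *\<^sub>R axis i 1)) has_real_derivative partial i \<eta> (x + r *\<^sub>R axis i 1)) (at r)"
proof -
  let ?v = "axis i 1 :: real^3"
  have "((\<lambda>r. x + r *\<^sub>R ?v) has_derivative (\<lambda>r. r *\<^sub>R ?v)) (at r)"
    by (auto intro!: derivative_eq_intros)
  from has_derivative_compose[OF this test_function_has_derivative[OF assms]]
  have "((\<lambda>r. \<eta> (x + r *\<^sub>R ?v)) has_derivative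
      (\<lambda>h. frechet_derivative \<eta> (at (x + r *\<^sub>R ?v)) (h *\<^sub>R ?v))) (at r)" .
  moreover have "frechet_derivative \<eta> (at (x + r *\<^sub>R ?v)) (h *\<^sub>R ?v) = partial i \<eta> (x + r *\<^sub>R ?v) * h" for h
    using linear_scale[OF has_derivative_linear[OF test_function_has_derivative[OF assms]], of _ h ?v]
    by (simp add: partial_def)
  ultimately show ?thesis by (simp add: has_field_derivative_def)
qed

lemma partial_eq_0_outside:
  assumes "closed K" "\<And>x. x \<notin> K \<Longrightarrow> \<eta> x = 0" "x \<notin> K"
  shows "partial i \<eta> x = 0"
proof -
  have "frechet_derivative \<eta> (at x) = frechet_derivative (\<lambda>x. 0::real) (at x)"
    by (rule frechet_derivative_cong_open[of "- K"]) (use assms in auto)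
  then show ?thesis by (simp add: partial_def frechet_derivative_const)
qed

lemma test_function_partial:
  assumes "test_function U \<eta>"
  shows "test_function U (partial i \<eta>)"
proof -
  have "Ck_on (Suc k) \<eta> UNIV" for k
    using assms by (simp only: test_function_def smooth_on_UNIV_iff)
  then have "Ck_on k (\<lambda>x. frechet_derivative \<eta> (at x) (axis i 1)) UNIV" for k
    by (auto simp: axis_in_Basis_iff)
  then have "smooth_on UNIV (partial i \<eta>)"
    unfolding smooth_on_UNIV_iff partial_def[abs_def] by blast
  then show ?thesis
    using assms unfolding test_function_def
    by (meson compact_imp_closed partial_eq_0_outside)
qed

lemma test_function_funpow_partial:
  "test_function U \<eta> \<Longrightarrow> test_function U ((partial i ^^ n) \<eta>)"
  by (induction n) (auto intro: test_function_partial)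

lemma test_function_multi_partial:
  "test_function U \<eta> \<Longrightarrow> test_function U (multi_partial \<alpha> \<eta>)"
  by (simp add: multi_partial_def test_function_funpow_partial)

lemma test_function_eq_0: "test_function U \<eta> \<Longrightarrow> x \<notin> U \<Longrightarrow> \<eta> x = 0"
  unfolding test_function_def by blast

lemma test_function_mono: "test_function U \<eta> \<Longrightarrow> U \<subseteq> V \<Longrightarrow> test_function V \<eta>"
  unfolding test_function_def by (meson order_trans)

lemma test_function_bounded:
  assumes "test_function U \<eta>"
  obtains B where "\<And>x. \<bar>\<eta> x\<bar> \<le> B" "B > 0"
proof -
  obtain K where K: "compact K" "\<And>x. x \<notin> K \<Longrightarrow> \<eta> x = 0"
    using assms unfolding test_function_def by blast
  have "bounded (\<eta> ` K)"
    by (intro compact_imp_bounded compact_continuous_image test_function_continuous[OF assms] K)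
  then obtain B where "B > 0" "\<And>x. x \<in> K \<Longrightarrow> \<bar>\<eta> x\<bar> \<le> B"
    by (force simp: bounded_pos)
  then show thesis using that[of B] K(2) by (metis abs_zero less_imp_le)
qed

lemma integral_lebesgue_on_open:
  fixes f :: "real^3 \<Rightarrow> 'b::euclidean_space"
  assumes "open U" "\<And>x. x \<notin> U \<Longrightarrow> f x = 0"
  shows "(\<integral>x. f x \<partial>lebesgue_on U) = (\<integral>x. f x \<partial>lebesgue)"
proof -
  have "(\<integral>x. f x \<partial>lebesgue_on U) = (\<integral>x. indicator U x *\<^sub>R f x \<partial>lebesgue)"
    using assms(1) by (intro integral_restrict_space) auto
  also have "\<dots> = (\<integral>x. f x \<partial>lebesgue)"
    using assms(2) by (intro Bochner_Integration.integral_cong) (auto simp: indicator_def)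
  finally show ?thesis .
qed

text \<open>A test function on \<open>U\<close> is also one on the whole space and vanishes off
  \<open>U\<close>, so both integrals in the defining identity may be taken over either set.\<close>

lemma has_weak_partial_restrict:
  assumes "has_weak_partial \<alpha> UNIV f g" "open U" "\<And>x. x \<in> U \<Longrightarrow> f x = f' x"
  shows "has_weak_partial \<alpha> U f' g"
  unfolding has_weak_partial_def
proof (intro conjI allI impI)
  show "locally_integrable_on g U"
    using assms(1) by (auto simp: has_weak_partial_def locally_integrable_on_def)
  show "locally_integrable_on f' U"
    unfolding locally_integrable_on_def
  proof (intro allI impI)
    fix K assume K: "compact K \<and> K \<subseteq> U"
    then have "integrable (lebesgue_on K) f"
      using assms(1) by (auto simp: has_weak_partial_def locally_integrable_on_def)
    then show "integrable (lebesgue_on K) f'"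
      by (subst Bochner_Integration.integrable_cong[OF refl, of _ _ f]) (use K assms(3) in auto)
  qed
  fix \<eta> assume \<eta>: "test_function U \<eta>"
  then have m: "test_function U (multi_partial \<alpha> \<eta>)" by (rule test_function_multi_partial)
  have "(\<integral>x. multi_partial \<alpha> \<eta> x *\<^sub>R f' x \<partial>lebesgue_on U) = (\<integral>x. multi_partial \<alpha> \<eta> x *\<^sub>R f x \<partial>lebesgue_on U)"
    using assms(3) by (intro Bochner_Integration.integral_cong) auto
  also have "\<dots> = (\<integral>x. multi_partial \<alpha> \<eta> x *\<^sub>R f x \<partial>lebesgue_on UNIV)"
    unfolding lebesgue_on_UNIV_eq
    by (intro integral_lebesgue_on_open assms(2)) (simp add: test_function_eq_0[OF m])
  also have "\<dots> = (- 1) ^ (\<Sum>i\<in>UNIV. \<alpha> i) *\<^sub>R (\<integral>x. \<eta> x *\<^sub>R g x \<partial>lebesgue_on UNIV)"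
    using assms(1) test_function_mono[OF \<eta>] by (simp add: has_weak_partial_def)
  also have "(\<integral>x. \<eta> x *\<^sub>R g x \<partial>lebesgue_on UNIV) = (\<integral>x. \<eta> x *\<^sub>R g x \<partial>lebesgue_on U)"
    unfolding lebesgue_on_UNIV_eq
    by (intro integral_lebesgue_on_open[symmetric] assms(2)) (simp add: test_function_eq_0[OF \<eta>])
  finally show "(\<integral>x. multi_partial \<alpha> \<eta> x *\<^sub>R f' x \<partial>lebesgue_on U) =
    (- 1) ^ (\<Sum>i\<in>UNIV. \<alpha> i) *\<^sub>R (\<integral>x. \<eta> x *\<^sub>R g x \<partial>lebesgue_on U)" .
qed

lemma ennsqrt_mono: "a \<le> b \<Longrightarrow> ennsqrt a \<le> ennsqrt b"
  by (auto simp: ennsqrt_def top.extremum_unique less_top intro!: ennreal_leI enn2real_mono)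

lemma nn_integral_lebesgue_on_le:
  assumes "open U"
  shows "(\<integral>\<^sup>+x. f x \<partial>lebesgue_on U) \<le> (\<integral>\<^sup>+x. f x \<partial>lebesgue_on UNIV)"
  using assms
  by (subst nn_integral_restrict_space)
     (auto simp: lebesgue_on_UNIV_eq indicator_def intro!: nn_integral_mono)

text \<open>Through this the initial norm on the ball is controlled by the norm of the extended
  data, so only the latter has to be estimated.\<close>

lemma sobolev_norm_restrict_le:
  assumes "open U" "\<And>x. x \<in> U \<Longrightarrow> f x = f' x"
  shows "sobolev_norm k U f' \<le> sobolev_norm k UNIV f"
  unfolding sobolev_norm_def
proof (rule Inf_mono, clarify)
  fix g assume g: "\<forall>\<alpha>. sum \<alpha> UNIV \<le> k \<longrightarrow> has_weak_partial \<alpha> UNIV f (g \<alpha>)"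
  have "\<forall>\<alpha>. sum \<alpha> UNIV \<le> k \<longrightarrow> has_weak_partial \<alpha> U f' (g \<alpha>)"
    using g has_weak_partial_restrict[of _ f _ U f'] assms by blast
  moreover have "ennsqrt (\<Sum>\<alpha> | (\<Sum>i\<in>UNIV. \<alpha> i) \<le> k. \<integral>\<^sup>+x. ennreal ((norm (g \<alpha> x))\<^sup>2) \<partial>lebesgue_on U)
    \<le> ennsqrt (\<Sum>\<alpha> | (\<Sum>i\<in>UNIV. \<alpha> i) \<le> k. \<integral>\<^sup>+x. ennreal ((norm (g \<alpha> x))\<^sup>2) \<partial>lebesgue_on UNIV)"
    by (intro ennsqrt_mono sum_mono nn_integral_lebesgue_on_le assms(1))
  ultimately show "\<exists>a\<in>{ennsqrt (\<Sum>\<alpha> | sum \<alpha> UNIV \<le> k. \<integral>\<^sup>+x. ennreal ((norm (g \<alpha> x))\<^sup>2) \<partial>lebesgue_on U) | g.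
      \<forall>\<alpha>. sum \<alpha> UNIV \<le> k \<longrightarrow> has_weak_partial \<alpha> U f' (g \<alpha>)}.
    a \<le> ennsqrt (\<Sum>\<alpha> | sum \<alpha> UNIV \<le> k. \<integral>\<^sup>+x. ennreal ((norm (g \<alpha> x))\<^sup>2) \<partial>lebesgue_on UNIV)"
    by blast
qed

text \<open>Measurability of \<open>g\<close> is recorded because the squared integrals of two
  components are later added, and additivity of the nonnegative integral requires it.\<close>

definition in_sobolev :: "nat \<Rightarrow> (real^3 \<Rightarrow> real) \<Rightarrow> bool" where
  "in_sobolev k f \<longleftrightarrow> (\<forall>\<alpha>. (\<Sum>i\<in>UNIV. \<alpha> i) \<le> k \<longrightarrow> (\<exists>g. has_weak_partial \<alpha> UNIV f g \<and>
     g \<in> borel_measurable lebesgue \<and> (\<integral>\<^sup>+x. ennreal ((g x)\<^sup>2) \<partial>lebesgue) < \<infinity>))"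

lemma integrable_test_function_scaleR:
  fixes f :: "real^3 \<Rightarrow> 'b::euclidean_space"
  assumes "test_function U \<eta>" "locally_integrable_on f U"
  shows "integrable lebesgue (\<lambda>x. \<eta> x *\<^sub>R f x)"
proof -
  obtain K where K: "compact K" "K \<subseteq> U" "\<And>x. x \<notin> K \<Longrightarrow> \<eta> x = 0"
    using assms(1) unfolding test_function_def by blast
  obtain B where B: "\<And>x. \<bar>\<eta> x\<bar> \<le> B" using test_function_bounded[OF assms(1)] by blast
  have "integrable (lebesgue_on K) f" using assms(2) K by (auto simp: locally_integrable_on_def)
  then have i: "integrable lebesgue (\<lambda>x. indicator K x *\<^sub>R f x)"
    using K(1) by (simp add: integrable_restrict_space lmeasurable_compact fmeasurableD)
  have "\<eta> \<in> borel_measurable borel"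
    by (intro borel_measurable_continuous_onI test_function_continuous[OF assms(1)])
  then have "\<eta> \<in> borel_measurable lebesgue" by (auto intro: measurable_completion)
  then have "(\<lambda>x. \<eta> x *\<^sub>R (indicator K x *\<^sub>R f x)) \<in> borel_measurable lebesgue"
    by (rule borel_measurable_scaleR[OF _ borel_measurable_integrable[OF i]])
  moreover have eq: "\<eta> x *\<^sub>R (indicator K x *\<^sub>R f x) = \<eta> x *\<^sub>R f x" for x
    using K(3)[of x] by (cases "x \<in> K") auto
  ultimately have m: "(\<lambda>x. \<eta> x *\<^sub>R f x) \<in> borel_measurable lebesgue" by (simp only:)
  show ?thesis
  proof (rule Bochner_Integration.integrable_bound[OF integrable_scaleR_right[OF i, of B] m], rule AE_I2)
    fix x
    have "norm (\<eta> x *\<^sub>R f x) = \<bar>\<eta> x\<bar> * norm (indicator K x *\<^sub>R f x)"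
      unfolding eq[symmetric] by (rule norm_scaleR)
    also have "\<dots> \<le> \<bar>B\<bar> * norm (indicator K x *\<^sub>R f x)"
      using B[of x] by (intro mult_right_mono) auto
    finally show "norm (\<eta> x *\<^sub>R f x) \<le> norm (B *\<^sub>R (indicator K x *\<^sub>R f x))"
      by (simp only: norm_scaleR)
  qed
qed

lemma integrable_test_function_mult:
  fixes f :: "real^3 \<Rightarrow> real"
  assumes "test_function U \<eta>" "locally_integrable_on f U"
  shows "integrable lebesgue (\<lambda>x. \<eta> x * f x)"
  using integrable_test_function_scaleR[OF assms] by simp

lemma continuous_on_locally_integrable:
  fixes f :: "real^3 \<Rightarrow> real"
  assumes "continuous_on U f"
  shows "locally_integrable_on f U"
  unfolding locally_integrable_on_def
proof (intro allI impI)
  fix K assume K: "compact K \<and> K \<subseteq> U"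
  then have "integrable lborel (\<lambda>x. indicator K x *\<^sub>R f x)"
    by (intro borel_integrable_compact continuous_on_subset[OF assms]) auto
  then have "integrable lebesgue (\<lambda>x. indicator K x *\<^sub>R f x)"
    by (subst integrable_completion) (auto dest: borel_measurable_integrable)
  then show "integrable (lebesgue_on K) f"
    using K by (simp add: integrable_restrict_space lmeasurable_compact fmeasurableD)
qed

lemma integral_Pair:
  fixes f :: "'a \<Rightarrow> real" and g :: "'a \<Rightarrow> real"
  assumes "integrable M f" "integrable M g"
  shows "(\<integral>x. (f x, g x) \<partial>M) = (\<integral>x. f x \<partial>M, \<integral>x. g x \<partial>M)" "integrable M (\<lambda>x. (f x, g x))"
proof -
  have 1: "bounded_linear (\<lambda>a::real. (a, 0::real))" "bounded_linear (\<lambda>a::real. (0::real, a))"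
    by (auto intro: bounded_linear_Pair bounded_linear_ident bounded_linear_zero)
  have eq: "(\<lambda>x. (f x, g x)) = (\<lambda>x. (f x, 0) + (0, g x))" by auto
  have i: "integrable M (\<lambda>x. (f x, 0::real))" "integrable M (\<lambda>x. (0::real, g x))"
    using integrable_bounded_linear[OF 1(1) assms(1)] integrable_bounded_linear[OF 1(2) assms(2)] .
  then show "integrable M (\<lambda>x. (f x, g x))"
    unfolding eq by (rule Bochner_Integration.integrable_add)
  show "(\<integral>x. (f x, g x) \<partial>M) = (\<integral>x. f x \<partial>M, \<integral>x. g x \<partial>M)"
    unfolding eq Bochner_Integration.integral_add[OF i]
    using integral_bounded_linear[OF 1(1) assms(1)] integral_bounded_linear[OF 1(2) assms(2)]
    by simp
qed

lemma has_weak_partial_Pair: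
  fixes f1 f2 g1 g2 :: "real^3 \<Rightarrow> real"
  assumes "has_weak_partial \<alpha> UNIV f1 g1" "has_weak_partial \<alpha> UNIV f2 g2"
  shows "has_weak_partial \<alpha> UNIV (\<lambda>x. (a * f1 x, b * f2 x)) (\<lambda>x. (a * g1 x, b * g2 x))"
proof -
  have loc: "locally_integrable_on f1 UNIV" "locally_integrable_on f2 UNIV"
    "locally_integrable_on g1 UNIV" "locally_integrable_on g2 UNIV"
    using assms by (auto simp: has_weak_partial_def)
  have pair: "(\<integral>x. \<eta> x *\<^sub>R (a * u x, b * v x) \<partial>lebesgue) =
      (a * (\<integral>x. \<eta> x * u x \<partial>lebesgue), b * (\<integral>x. \<eta> x * v x \<partial>lebesgue))"
    if "test_function UNIV \<eta>" "locally_integrable_on u UNIV" "locally_integrable_on v UNIV" for \<eta> u v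
  proof -
    have "(\<integral>x. \<eta> x *\<^sub>R (a * u x, b * v x) \<partial>lebesgue) = (\<integral>x. (a * (\<eta> x * u x), b * (\<eta> x * v x)) \<partial>lebesgue)"
      by (simp add: mult.left_commute)
    also have "\<dots> = (\<integral>x. a * (\<eta> x * u x) \<partial>lebesgue, \<integral>x. b * (\<eta> x * v x) \<partial>lebesgue)"
      by (intro integral_Pair integrable_mult_right integrable_test_function_mult[where U = UNIV] that)
    finally show ?thesis by simp
  qed
  show ?thesis
    unfolding has_weak_partial_def
  proof (intro conjI allI impI)
    show "locally_integrable_on (\<lambda>x. (a * f1 x, b * f2 x)) UNIV"
      "locally_integrable_on (\<lambda>x. (a * g1 x, b * g2 x)) UNIV"
      using loc by (auto simp: locally_integrable_on_def intro!: integral_Pair integrable_mult_right)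
    fix \<eta> assume \<eta>: "test_function UNIV \<eta>"
    note m = test_function_multi_partial[OF \<eta>, of \<alpha>]
    show "(\<integral>x. multi_partial \<alpha> \<eta> x *\<^sub>R (a * f1 x, b * f2 x) \<partial>lebesgue_on UNIV) =
      (- 1) ^ (\<Sum>i\<in>UNIV. \<alpha> i) *\<^sub>R (\<integral>x. \<eta> x *\<^sub>R (a * g1 x, b * g2 x) \<partial>lebesgue_on UNIV)"
      using assms \<eta> unfolding lebesgue_on_UNIV_eq pair[OF m loc(1,2)] pair[OF \<eta> loc(3,4)]
      by (simp add: lebesgue_on_UNIV_eq has_weak_partial_def)
  qed
qed

lemma finite_multi_indices: "finite {\<alpha> :: 3 \<Rightarrow> nat. sum \<alpha> UNIV \<le> k}"
proof (rule finite_subset)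
  show "{\<alpha> :: 3 \<Rightarrow> nat. sum \<alpha> UNIV \<le> k} \<subseteq> (UNIV :: 3 set) \<rightarrow>\<^sub>E {..k}"
    by (auto simp: PiE_def) (metis UNIV_I finite member_le_sum order_trans zero_le)
qed (auto intro: finite_PiE)

text \<open>The squared integrals scale by \<open>a^2\<close> and \<open>b^2\<close>, both at most
  \<open>\<delta>^2\<close>, so the norm is at most linear in \<open>\<delta>\<close>. It matters
  that \<open>M\<close> is chosen before \<open>a\<close>, \<open>b\<close> and
  \<open>\<delta>\<close>: the data can then be made small by scaling alone.\<close>

lemma sobolev_norm_Pair_le:
  assumes "in_sobolev k f1" "in_sobolev k f2"
  shows "\<exists>M\<ge>0. \<forall>a b \<delta>. \<bar>a\<bar> \<le> \<delta> \<and> \<bar>b\<bar> \<le> \<delta> \<longrightarrow>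
    sobolev_norm k UNIV (\<lambda>x. (a * f1 x, b * f2 x)) \<le> ennreal (\<delta> * M)"
proof -
  let ?A = "{\<alpha> :: 3 \<Rightarrow> nat. sum \<alpha> UNIV \<le> k}"
  define I where "I = (\<lambda>g :: real^3 \<Rightarrow> real. \<integral>\<^sup>+x. ennreal ((g x)\<^sup>2) \<partial>lebesgue)"
  obtain g1 where g1: "\<And>\<alpha>. \<alpha> \<in> ?A \<Longrightarrow> has_weak_partial \<alpha> UNIV f1 (g1 \<alpha>)"
      "\<And>\<alpha>. \<alpha> \<in> ?A \<Longrightarrow> g1 \<alpha> \<in> borel_measurable lebesgue" "\<And>\<alpha>. \<alpha> \<in> ?A \<Longrightarrow> I (g1 \<alpha>) < \<infinity>"
    using assms(1) unfolding in_sobolev_def I_def mem_Collect_eq by metis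
  obtain g2 where g2: "\<And>\<alpha>. \<alpha> \<in> ?A \<Longrightarrow> has_weak_partial \<alpha> UNIV f2 (g2 \<alpha>)"
      "\<And>\<alpha>. \<alpha> \<in> ?A \<Longrightarrow> g2 \<alpha> \<in> borel_measurable lebesgue" "\<And>\<alpha>. \<alpha> \<in> ?A \<Longrightarrow> I (g2 \<alpha>) < \<infinity>"
    using assms(2) unfolding in_sobolev_def I_def mem_Collect_eq by metis
  define S where "S = (\<Sum>\<alpha>\<in>?A. I (g1 \<alpha>) + I (g2 \<alpha>))"
  have "S < \<infinity>" using g1(3) g2(3) by (auto simp: S_def less_top[symmetric] ennreal_add_eq_top finite_multi_indices)
  then obtain M where M: "M \<ge> 0" "S = ennreal M" by (metis ennreal_cases infinity_ennreal_def less_irrefl)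
  have "sobolev_norm k UNIV (\<lambda>x. (a * f1 x, b * f2 x)) \<le> ennreal (\<delta> * sqrt M)"
    if "\<bar>a\<bar> \<le> \<delta>" "\<bar>b\<bar> \<le> \<delta>" for a b \<delta>
  proof -
    have d: "a\<^sup>2 \<le> \<delta>\<^sup>2" "b\<^sup>2 \<le> \<delta>\<^sup>2" "\<delta> \<ge> 0"
      using that abs_le_square_iff[of a \<delta>] abs_le_square_iff[of b \<delta>] by auto
    have term_le: "(\<integral>\<^sup>+x. ennreal ((norm (a * g1 \<alpha> x, b * g2 \<alpha> x))\<^sup>2) \<partial>lebesgue_on UNIV)
        \<le> ennreal (\<delta>\<^sup>2) * (I (g1 \<alpha>) + I (g2 \<alpha>))" if "\<alpha> \<in> ?A" for \<alpha>
    proof -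
      note [measurable] = g1(2)[OF that] g2(2)[OF that]
      have "(\<integral>\<^sup>+x. ennreal ((norm (a * g1 \<alpha> x, b * g2 \<alpha> x))\<^sup>2) \<partial>lebesgue) \<le>
        (\<integral>\<^sup>+x. ennreal (\<delta>\<^sup>2) * (ennreal ((g1 \<alpha> x)\<^sup>2) + ennreal ((g2 \<alpha> x)\<^sup>2)) \<partial>lebesgue)"
        using d
        by (intro nn_integral_mono)
           (auto simp: norm_Pair power_mult_distrib ennreal_plus[symmetric] ennreal_mult[symmetric]
              distrib_left simp del: ennreal_plus intro!: ennreal_leI add_mono mult_right_mono)
      also have "\<dots> = ennreal (\<delta>\<^sup>2) * (I (g1 \<alpha>) + I (g2 \<alpha>))"
        by (simp add: I_def nn_integral_cmult nn_integral_add)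
      finally show ?thesis by (simp add: lebesgue_on_UNIV_eq)
    qed
    have "sobolev_norm k UNIV (\<lambda>x. (a * f1 x, b * f2 x)) \<le>
      ennsqrt (\<Sum>\<alpha>\<in>?A. \<integral>\<^sup>+x. ennreal ((norm (a * g1 \<alpha> x, b * g2 \<alpha> x))\<^sup>2) \<partial>lebesgue_on UNIV)"
      unfolding sobolev_norm_def
      by (rule Inf_lower, rule CollectI, rule exI[of _ "\<lambda>\<alpha> x. (a * g1 \<alpha> x, b * g2 \<alpha> x)"])
         (use g1(1) g2(1) in \<open>auto intro: has_weak_partial_Pair\<close>)
    also have "\<dots> \<le> ennsqrt (ennreal (\<delta>\<^sup>2 * M))"
    proof (rule ennsqrt_mono)
      have "(\<Sum>\<alpha>\<in>?A. \<integral>\<^sup>+x. ennreal ((norm (a * g1 \<alpha> x, b * g2 \<alpha> x))\<^sup>2) \<partial>lebesgue_on UNIV)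
        \<le> (\<Sum>\<alpha>\<in>?A. ennreal (\<delta>\<^sup>2) * (I (g1 \<alpha>) + I (g2 \<alpha>)))"
        by (intro sum_mono term_le)
      also have "\<dots> = ennreal (\<delta>\<^sup>2 * M)"
        using M by (simp add: sum_distrib_left[symmetric] S_def[symmetric] ennreal_mult)
      finally show "(\<Sum>\<alpha>\<in>?A. \<integral>\<^sup>+x. ennreal ((norm (a * g1 \<alpha> x, b * g2 \<alpha> x))\<^sup>2) \<partial>lebesgue_on UNIV)
        \<le> ennreal (\<delta>\<^sup>2 * M)" .
    qed
    also have "\<dots> = ennreal (\<delta> * sqrt M)"
      using M(1) d by (simp add: ennsqrt_def real_sqrt_mult)
    finally show ?thesis .
  qed
  moreover have "sqrt M \<ge> 0" using M by simp
  ultimately show ?thesis by blast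
qed

section \<open>Weak derivatives from derivatives along lines\<close>

text \<open>One integrable \<open>M\<close> will serve all data and all their derivatives; only the
  constant varies. The bound is almost everywhere because at the singular point division by zero
  returns 0 and the majorant used below vanishes there.\<close>

definition sq_dominated :: "(real^3 \<Rightarrow> real) \<Rightarrow> (real^3 \<Rightarrow> real) \<Rightarrow> bool" where
  "sq_dominated M V \<longleftrightarrow> V \<in> borel_measurable borel \<and> (\<exists>C. AE x in lborel. (V x)\<^sup>2 \<le> C * M x)"

text \<open>On a set of finite measure, \<open>2 * \<bar>v\<bar> <= 1 + v^2\<close> turns the bound
  on the square into a bound on the function.\<close>

lemma sq_dominated_locally_integrable:
  assumes "integrable lborel M" "sq_dominated M V"
  shows "locally_integrable_on V UNIV"
  unfolding locally_integrable_on_def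
proof (intro allI impI)
  fix K :: "(real^3) set" assume "compact K \<and> K \<subseteq> UNIV"
  then have K: "K \<in> lmeasurable" by (simp add: lmeasurable_compact)
  obtain C where V: "V \<in> borel_measurable borel" "AE x in lborel. (V x)\<^sup>2 \<le> C * M x"
    using assms(2) unfolding sq_dominated_def by blast
  have M: "integrable lebesgue (\<lambda>x. C * M x)"
    using assms(1) by (simp add: integrable_completion borel_measurable_integrable)
  have "integrable lebesgue (\<lambda>x. indicator K x * V x)"
  proof (rule Bochner_Integration.integrable_bound)
    show "integrable lebesgue (\<lambda>x. indicator K x + C * M x)"
      using K M by (intro Bochner_Integration.integrable_add) (auto simp: fmeasurable_def)
    show "(\<lambda>x. indicator K x * V x) \<in> borel_measurable lebesgue"
      using K V(1) by (intro borel_measurable_times borel_measurable_indicator) (auto intro: measurable_completion)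
    have "AE x in lebesgue. (V x)\<^sup>2 \<le> C * M x" using V(2) by (rule AE_completion)
    then show "AE x in lebesgue. norm (indicator K x * V x) \<le> norm (indicator K x + C * M x)"
    proof eventually_elim
      case (elim x)
      have "0 \<le> (\<bar>V x\<bar> - 1)\<^sup>2" by simp
      then have "2 * \<bar>V x\<bar> \<le> 1 + (V x)\<^sup>2" by (simp add: power2_diff)
      moreover have "0 \<le> (V x)\<^sup>2" by simp
      ultimately show ?case using elim by (auto simp: indicator_def abs_mult)
    qed
  qed
  then show "integrable (lebesgue_on K) V"
    using K by (simp add: integrable_restrict_space fmeasurableD)
qed

lemma sq_dominated_square_integral:
  assumes "integrable lborel M" "sq_dominated M V"
  shows "(\<integral>\<^sup>+x. ennreal ((V x)\<^sup>2) \<partial>lebesgue) < \<infinity>"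
proof -
  obtain C where V: "V \<in> borel_measurable borel" "AE x in lborel. (V x)\<^sup>2 \<le> C * M x"
    using assms(2) unfolding sq_dominated_def by blast
  have "integrable lborel (\<lambda>x. (V x)\<^sup>2)"
  proof (rule Bochner_Integration.integrable_bound)
    show "integrable lborel (\<lambda>x. C * M x)" using assms(1) by simp
    show "AE x in lborel. norm ((V x)\<^sup>2) \<le> norm (C * M x)" using V(2) by eventually_elim auto
  qed (use V(1) in simp)
  then show ?thesis using V(1)
    by (simp add: nn_integral_completion integrable_iff_bounded)
qed

text \<open>The derivative of \<open>\<eta> * V\<close> along the axis has integral zero.
  Differentiability of \<open>V\<close> may fail at finitely many points of a line, but continuity
  may not: a jump would contribute a surface term.\<close>

lemma integral_by_parts_lines:
  assumes M: "integrable lborel M" and V: "sq_dominated M V" and W: "sq_dominated M W"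
    and lines: "AE x in lborel. \<exists>S. finite S \<and> continuous_on UNIV (\<lambda>r. V (x + r *\<^sub>R axis i 1)) \<and>
      (\<forall>r. r \<notin> S \<longrightarrow> ((\<lambda>r. V (x + r *\<^sub>R axis i 1)) has_real_derivative W (x + r *\<^sub>R axis i 1)) (at r))"
    and \<eta>: "test_function UNIV \<eta>"
  shows "(\<integral>x. partial i \<eta> x * V x \<partial>lebesgue) = - (\<integral>x. \<eta> x * W x \<partial>lebesgue)"
proof -
  let ?v = "axis i 1 :: real^3"
  note \<eta>' = test_function_partial[OF \<eta>, of i]
  note loc = sq_dominated_locally_integrable[OF M]
  have [measurable]: "V \<in> borel_measurable borel" "W \<in> borel_measurable borel"
    using V W by (auto simp: sq_dominated_def)
  have [measurable]: "\<eta> \<in> borel_measurable borel" "partial i \<eta> \<in> borel_measurable borel"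
    by (intro borel_measurable_continuous_onI test_function_continuous[OF \<eta>] test_function_continuous[OF \<eta>'])+
  have i: "integrable lebesgue (\<lambda>x. \<eta> x * V x)" "integrable lebesgue (\<lambda>x. partial i \<eta> x * V x)"
    "integrable lebesgue (\<lambda>x. \<eta> x * W x)"
    by (intro integrable_test_function_mult[where U = UNIV] \<eta> \<eta>' loc V W)+
  then have ib: "integrable lborel (\<lambda>x. \<eta> x * V x)" "integrable lborel (\<lambda>x. partial i \<eta> x * V x)"
    "integrable lborel (\<lambda>x. \<eta> x * W x)"
    by (simp_all add: integrable_completion)
  have der: "((\<lambda>r. \<eta> (x + r *\<^sub>R ?v)) has_real_derivative partial i \<eta> (x + r *\<^sub>R ?v)) (at r)" for x r
    by (rule test_function_line_derivative[OF \<eta>])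
  have "(\<integral>x. partial i \<eta> x * V x + \<eta> x * W x \<partial>lborel) = 0"
  proof (rule integral_directional_derivative_eq_0[where v = ?v])
    show "integrable lborel (\<lambda>x. \<eta> x * V x)" by (rule ib)
    show "integrable lborel (\<lambda>x. partial i \<eta> x * V x + \<eta> x * W x)" using ib by simp
    show "AE x in lborel. \<exists>S. finite S \<and> continuous_on {0..1} (\<lambda>r. \<eta> (x + r *\<^sub>R ?v) * V (x + r *\<^sub>R ?v)) \<and>
      (\<forall>r\<in>{0<..<1} - S. ((\<lambda>r. \<eta> (x + r *\<^sub>R ?v) * V (x + r *\<^sub>R ?v)) has_real_derivative
         partial i \<eta> (x + r *\<^sub>R ?v) * V (x + r *\<^sub>R ?v) + \<eta> (x + r *\<^sub>R ?v) * W (x + r *\<^sub>R ?v)) (at r))"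
      using lines
    proof eventually_elim
      case (elim x)
      then obtain S where S: "finite S" "continuous_on UNIV (\<lambda>r. V (x + r *\<^sub>R ?v))"
        "\<And>r. r \<notin> S \<Longrightarrow> ((\<lambda>r. V (x + r *\<^sub>R ?v)) has_real_derivative W (x + r *\<^sub>R ?v)) (at r)"
        by blast
      have "continuous_on {0..1} (\<lambda>r. \<eta> (x + r *\<^sub>R ?v) * V (x + r *\<^sub>R ?v))"
        by (intro continuous_on_mult continuous_on_subset[OF S(2)] subset_UNIV
            continuous_at_imp_continuous_on ballI DERIV_isCont[OF der])
      moreover have "((\<lambda>r. \<eta> (x + r *\<^sub>R ?v) * V (x + r *\<^sub>R ?v)) has_real_derivative
         partial i \<eta> (x + r *\<^sub>R ?v) * V (x + r *\<^sub>R ?v) + \<eta> (x + r *\<^sub>R ?v) * W (x + r *\<^sub>R ?v)) (at r)"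
        if "r \<notin> S" for r
        using DERIV_mult[OF der S(3)[OF that], of x] by (simp add: algebra_simps)
      ultimately show ?case using S(1) by blast
    qed
  qed
  then have "(\<integral>x. partial i \<eta> x * V x \<partial>lborel) = - (\<integral>x. \<eta> x * W x \<partial>lborel)"
    using ib by simp
  then show ?thesis by (simp add: integral_completion)
qed

lemma multi_index_cases:
  assumes "(\<Sum>i\<in>UNIV. \<alpha> i) \<le> 2"
  shows "(\<Sum>i\<in>UNIV. \<alpha> i) = 0 \<and> multi_partial \<alpha> = (\<lambda>\<eta>. \<eta>) \<or>
    (\<Sum>i\<in>UNIV. \<alpha> i) = 1 \<and> (\<exists>i. multi_partial \<alpha> = partial i) \<or>
    (\<Sum>i\<in>UNIV. \<alpha> i) = 2 \<and> (\<exists>i j. multi_partial \<alpha> = (\<lambda>\<eta>. partial i (partial j \<eta>)))"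
proof -
  have "\<alpha> 1 + \<alpha> 2 + \<alpha> 3 \<le> 2" using assms by (simp add: sum_3)
  then consider "\<alpha> 1 = 0" "\<alpha> 2 = 0" "\<alpha> 3 = 0" | "\<alpha> 1 = 1" "\<alpha> 2 = 0" "\<alpha> 3 = 0"
    | "\<alpha> 1 = 0" "\<alpha> 2 = 1" "\<alpha> 3 = 0" | "\<alpha> 1 = 0" "\<alpha> 2 = 0" "\<alpha> 3 = 1"
    | "\<alpha> 1 = 2" "\<alpha> 2 = 0" "\<alpha> 3 = 0" | "\<alpha> 1 = 0" "\<alpha> 2 = 2" "\<alpha> 3 = 0"
    | "\<alpha> 1 = 0" "\<alpha> 2 = 0" "\<alpha> 3 = 2" | "\<alpha> 1 = 1" "\<alpha> 2 = 1" "\<alpha> 3 = 0"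
    | "\<alpha> 1 = 1" "\<alpha> 2 = 0" "\<alpha> 3 = 1" | "\<alpha> 1 = 0" "\<alpha> 2 = 1" "\<alpha> 3 = 1"
    by atomize_elim arith
  then show ?thesis
    by cases (auto simp: sum_3 multi_partial_def[abs_def] numeral_2_eq_2)
qed

definition weakly_differentiable :: "(real^3 \<Rightarrow> real) \<Rightarrow> 3 \<Rightarrow> (real^3 \<Rightarrow> real) \<Rightarrow> bool" where
  "weakly_differentiable V i W \<longleftrightarrow> (\<forall>\<eta>. test_function UNIV \<eta> \<longrightarrow>
     (\<integral>x. partial i \<eta> x * V x \<partial>lebesgue) = - (\<integral>x. \<eta> x * W x \<partial>lebesgue))"

lemma sq_dominated_measurable_lebesgue: "sq_dominated M V \<Longrightarrow> V \<in> borel_measurable lebesgue"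
  by (auto simp: sq_dominated_def intro: measurable_completion)

lemma in_sobolev_1I:
  assumes M: "integrable lborel M" and V: "sq_dominated M V" "\<And>i. sq_dominated M (V' i)"
    and w: "\<And>i. weakly_differentiable V i (V' i)"
  shows "in_sobolev 1 V"
  unfolding in_sobolev_def
proof (intro allI impI)
  fix \<alpha> :: "3 \<Rightarrow> nat" assume \<alpha>: "sum \<alpha> UNIV \<le> 1"
  note loc = sq_dominated_locally_integrable[OF M]
  consider "sum \<alpha> UNIV = 0" "multi_partial \<alpha> = (\<lambda>\<eta>. \<eta>)"
    | i where "sum \<alpha> UNIV = 1" "multi_partial \<alpha> = partial i"
    using multi_index_cases[of \<alpha>] \<alpha> by force
  then show "\<exists>g. has_weak_partial \<alpha> UNIV V g \<and> g \<in> borel_measurable lebesgue \<and>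
      (\<integral>\<^sup>+x. ennreal ((g x)\<^sup>2) \<partial>lebesgue) < \<infinity>"
  proof cases
    case 1
    then have "has_weak_partial \<alpha> UNIV V V"
      using loc[OF V(1)] by (simp add: has_weak_partial_def lebesgue_on_UNIV_eq)
    then show ?thesis
      using sq_dominated_measurable_lebesgue[OF V(1)] sq_dominated_square_integral[OF M V(1)] by blast
  next
    case 2
    then have "has_weak_partial \<alpha> UNIV V (V' i)"
      using loc[OF V(1)] loc[OF V(2)] w[of i]
      by (simp add: has_weak_partial_def lebesgue_on_UNIV_eq weakly_differentiable_def)
    then show ?thesis
      using sq_dominated_measurable_lebesgue[OF V(2)] sq_dominated_square_integral[OF M V(2)] by blast
  qed
qed

text \<open>Two integrations by parts: the outer \<open>partial i\<close> moves to \<open>V\<close>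
  first, then \<open>partial j\<close> to \<open>V' i\<close>. The two signs cancel.\<close>

lemma in_sobolev_2I:
  assumes M: "integrable lborel M"
    and V: "sq_dominated M V" "\<And>i. sq_dominated M (V' i)" "\<And>i j. sq_dominated M (V'' i j)"
    and w: "\<And>i. weakly_differentiable V i (V' i)" "\<And>i j. weakly_differentiable (V' i) j (V'' i j)"
  shows "in_sobolev 2 V"
  unfolding in_sobolev_def
proof (intro allI impI)
  fix \<alpha> :: "3 \<Rightarrow> nat" assume \<alpha>: "sum \<alpha> UNIV \<le> 2"
  note loc = sq_dominated_locally_integrable[OF M]
  show "\<exists>g. has_weak_partial \<alpha> UNIV V g \<and> g \<in> borel_measurable lebesgue \<and>
      (\<integral>\<^sup>+x. ennreal ((g x)\<^sup>2) \<partial>lebesgue) < \<infinity>"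
  proof (cases "sum \<alpha> UNIV \<le> 1")
    case True
    then show ?thesis using in_sobolev_1I[OF M V(1,2) w(1)] by (simp add: in_sobolev_def)
  next
    case False
    then obtain i j where ij: "sum \<alpha> UNIV = 2" "multi_partial \<alpha> = (\<lambda>\<eta>. partial i (partial j \<eta>))"
      using multi_index_cases[of \<alpha>] \<alpha> by auto
    have "has_weak_partial \<alpha> UNIV V (V'' i j)"
      unfolding has_weak_partial_def
    proof (intro conjI allI impI loc V)
      fix \<eta> assume \<eta>: "test_function UNIV \<eta>"
      show "(\<integral>x. multi_partial \<alpha> \<eta> x *\<^sub>R V x \<partial>lebesgue_on UNIV) =
        (- 1) ^ sum \<alpha> UNIV *\<^sub>R (\<integral>x. \<eta> x *\<^sub>R V'' i j x \<partial>lebesgue_on UNIV)"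
        using w \<eta> test_function_partial[OF \<eta>]
        by (simp add: ij lebesgue_on_UNIV_eq weakly_differentiable_def)
    qed
    then show ?thesis
      using sq_dominated_measurable_lebesgue[OF V(3)] sq_dominated_square_integral[OF M V(3)] by blast
  qed
qed

section \<open>The profile\<close>

text \<open>The base point 4 is where the profile ends, so the antiderivative of a function
  vanishing from 4 on vanishes there too. The value 0 for \<open>u <= 0\<close> gives a Borel
  function on the whole line.\<close>

definition antideriv :: "(real \<Rightarrow> real) \<Rightarrow> real \<Rightarrow> real" where
  "antideriv k u = (if u > 0 then LBINT y=4..u. k y else 0)"

lemma has_derivative_antideriv:
  assumes "continuous_on {0<..} k" "u > 0"
  shows "(antideriv k has_real_derivative k u) (at u)"
proof -
  \<comment> \<open>A compact interval in the positive axis that contains the base point 4 and has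
    \<open>u\<close> in its interior.\<close>
  define a b where "a = min u 4 / 2" and "b = max u 4 + 1"
  have ab: "a > 0" "a < u" "u < b" "a \<le> 4" "4 \<le> b" using assms(2) by (auto simp: a_def b_def)
  have cont: "continuous_on {a..b} k" by (rule continuous_on_subset[OF assms(1)]) (use ab in auto)
  have "((\<lambda>u. LBINT y=4..u. k y) has_vector_derivative k u) (at u within {a..b})"
    using interval_integral_FTC2[of a 4 b k u] ab cont by simp
  then have "((\<lambda>u. LBINT y=4..u. k y) has_real_derivative k u) (at u)"
    using ab at_within_Icc_at[of a u b] by (simp add: has_real_derivative_iff_has_vector_derivative)
  then show ?thesis
    by (rule has_field_derivative_transform_within_open[where S = "{0<..}"])
       (use assms(2) in \<open>auto simp: antideriv_def\<close>)
qed

lemma antideriv_4: "antideriv k 4 = 0"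
  by (simp add: antideriv_def)

lemma antideriv_measurable:
  assumes "continuous_on {0<..} k"
  shows "antideriv k \<in> borel_measurable borel"
proof -
  have "continuous_on {0<..} (antideriv k)"
    using has_derivative_antideriv[OF assms]
    by (intro continuous_at_imp_continuous_on ballI) (auto intro: DERIV_isCont)
  then have "(\<lambda>u. if u \<in> {0<..} then antideriv k u else 0) \<in> borel_measurable borel"
    by (intro borel_measurable_continuous_on_if) auto
  moreover have "(\<lambda>u. if u \<in> {0<..} then antideriv k u else 0) = antideriv k"
    by (auto simp: antideriv_def)
  ultimately show ?thesis by simp
qed

lemma antideriv_eq_0:
  assumes "continuous_on {0<..} k" "\<And>u. u \<ge> 4 \<Longrightarrow> k u = 0" "u \<ge> 4"
  shows "antideriv k u = 0"
proof (cases "u = 4")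
  case False
  then have "4 < u" using assms(3) by simp
  then obtain z where "4 < z" "z < u" "antideriv k u - antideriv k 4 = (u - 4) * k z"
    using MVT2[of 4 u "antideriv k" k] has_derivative_antideriv[OF assms(1)] by auto
  then show ?thesis using assms(2)[of z] by (simp add: antideriv_4)
qed (simp add: antideriv_4)

text \<open>A mean value estimate between \<open>u\<close> and 4: the length is at most 4 and
  \<open>1 / sqrt\<close> decreases. The bound is crude but keeps the shape
  \<open>C / sqrt u\<close>, whose square is of order \<open>1 / u\<close>.\<close>

lemma antideriv_bound:
  assumes "continuous_on {0<..} k" "\<And>u. u \<ge> 4 \<Longrightarrow> k u = 0"
    and k: "\<And>u. u > 0 \<Longrightarrow> \<bar>k u\<bar> \<le> C / sqrt u" and "u > 0"
  shows "\<bar>antideriv k u\<bar> \<le> 4 * C / sqrt u"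
proof -
  have C: "C \<ge> 0" using k[of 1] by simp
  show ?thesis
  proof (cases "u < 4")
    case True
    then obtain z where z: "u < z" "z < 4" "antideriv k 4 - antideriv k u = (4 - u) * k z"
      using MVT2[of u 4 "antideriv k" k] has_derivative_antideriv[OF assms(1)] \<open>u > 0\<close> by auto
    have "\<bar>antideriv k u\<bar> = (4 - u) * \<bar>k z\<bar>"
      using arg_cong[OF z(3), of abs] True by (simp add: antideriv_4 abs_mult)
    also have "\<dots> \<le> 4 * (C / sqrt z)" using z \<open>u > 0\<close> True k[of z] by (intro mult_mono) auto
    also have "\<dots> \<le> 4 * (C / sqrt u)"
      using z \<open>u > 0\<close> C by (intro mult_left_mono divide_left_mono) auto
    finally show ?thesis by simp
  next
    case False
    then show ?thesis using antideriv_eq_0[OF assms(1,2)] C \<open>u > 0\<close> by simp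
  qed
qed

lemma Ck_on_antideriv:
  assumes "\<And>k. Ck_on k p {0<..}"
  shows "Ck_on k (antideriv p) {0<..}"
proof -
  have "continuous_on {0<..} p" using assms[of 0] by simp
  then have "Ck_on (Suc k) (antideriv p) {0<..}"
    by (intro Ck_on_real_SucI[OF _ _ assms] has_derivative_antideriv) auto
  then show ?thesis by (rule Ck_on_Suc_imp)
qed

text \<open>This is the f' of the overview, not f itself; the argument of \<open>flat_powr\<close>
  is ln (4 / u), positive exactly for \<open>u < 4\<close> when \<open>u > 0\<close>.\<close>

definition profile :: "real \<Rightarrow> real" where
  "profile u = flat_powr (1/4) (ln 4 - ln u)"

definition flat1 :: "real \<Rightarrow> real" where
  "flat1 y = 1/4 * flat_powr (-3/4) y + flat_powr (-7/4) y"

definition flat2 :: "real \<Rightarrow> real" where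
  "flat2 y = -3/16 * flat_powr (-7/4) y - 3/2 * flat_powr (-11/4) y + flat_powr (-15/4) y"

definition profile1 :: "real \<Rightarrow> real" where
  "profile1 u = - flat1 (ln 4 - ln u) / u"

definition profile2 :: "real \<Rightarrow> real" where
  "profile2 u = (flat2 (ln 4 - ln u) + flat1 (ln 4 - ln u)) / u\<^sup>2"

lemma flat_derivs:
  "(flat_powr (1/4) has_real_derivative flat1 y) (at y)"
  "(flat1 has_real_derivative flat2 y) (at y)"
  unfolding flat1_def[abs_def] flat2_def
  by (auto intro!: derivative_eq_intros has_derivative_flat_powr[THEN DERIV_cong] simp: field_simps)

lemma profile_derivs:
  assumes "u > 0"
  shows "(profile has_real_derivative profile1 u) (at u)"
    and "(profile1 has_real_derivative profile2 u) (at u)"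
proof -
  have l: "((\<lambda>u. ln 4 - ln u) has_real_derivative - 1 / u) (at u)"
    using assms by (auto intro!: derivative_eq_intros)
  show "(profile has_real_derivative profile1 u) (at u)"
    unfolding profile_def[abs_def] profile1_def
    using DERIV_chain2[OF flat_derivs(1) l] by simp
  show "(profile1 has_real_derivative profile2 u) (at u)"
    unfolding profile1_def[abs_def] profile2_def
    using assms
    by (auto intro!: derivative_eq_intros DERIV_chain2[OF flat_derivs(2)] simp: field_simps power2_eq_square)
qed

lemma profile_eq_0:
  assumes "u \<ge> 4"
  shows "profile u = 0" "profile1 u = 0" "profile2 u = 0"
proof -
  have "ln 4 - ln u \<le> 0" using assms by simp
  then show "profile u = 0" "profile1 u = 0" "profile2 u = 0"
    by (auto simp: profile_def profile1_def profile2_def flat1_def flat2_def flat_powr_def)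
qed

lemma profile_measurable [measurable]:
  "profile \<in> borel_measurable borel" "profile1 \<in> borel_measurable borel" "profile2 \<in> borel_measurable borel"
  unfolding profile_def[abs_def] profile1_def[abs_def] profile2_def[abs_def] flat1_def[abs_def] flat2_def[abs_def]
  by measurable

lemma Ck_on_profile: "Ck_on k profile {0<..}"
proof -
  have "Ck_on k (\<lambda>u. ln 4 + (- 1) * ln u) {0<..}"
    by (intro Ck_on_add Ck_on_mult Ck_on_const Ck_on_ln) auto
  then have "Ck_on k (\<lambda>u. flat_powr (1/4) (ln 4 + (- 1) * ln u)) {0<..}"
    by (intro Ck_on_compose[OF _ _ _ _ Ck_on_flat_powr]) auto
  then show ?thesis by (simp add: profile_def[abs_def])
qed

lemma continuous_on_profile: "continuous_on {0<..} profile"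
  using Ck_on_profile[of 0] by simp

lemma powr_square: "(z powr a)\<^sup>2 = z powr (2 * a)" for z a :: real
  using powr_add[of z a a] unfolding power2_eq_square mult_2 by (rule sym)

lemma one_plus_ln_le: "0 < u \<Longrightarrow> 1 + (ln 4 - ln u) \<le> 4 / u" for u :: real
  using ln_le_minus_one[of "4 / u"] by (simp add: ln_div)

text \<open>The first four bounds give the logarithms away and suffice where the argument is
  \<open>half_sq x\<close>. Only the last one, for use inside the ball, keeps the decay y^(-3/2),
  without which \<open>1 / u^2\<close> would not be integrable there.\<close>

lemma profile_bounds:
  obtains C where "C \<ge> 1" "\<And>u. u > 0 \<Longrightarrow> (profile u)\<^sup>2 \<le> C / sqrt u" "\<And>u. u > 0 \<Longrightarrow> \<bar>profile u\<bar> \<le> C / sqrt u"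
    "\<And>u. u > 0 \<Longrightarrow> \<bar>profile1 u\<bar> \<le> C / u" "\<And>u. u > 0 \<Longrightarrow> \<bar>profile2 u\<bar> \<le> C / u\<^sup>2"
    "\<And>u. 0 < u \<Longrightarrow> u < 4 \<Longrightarrow> (profile1 u)\<^sup>2 \<le> C * ((1 + (ln 4 - ln u)) powr (-3/2) / u\<^sup>2)"
proof -
  have "\<forall>a. \<exists>C>0. \<forall>y>0. flat_powr a y \<le> C * (1 + y) powr a"
    using flat_powr_bound by blast
  then obtain c where c: "\<And>a. c a > 0" "\<And>a y. y > 0 \<Longrightarrow> flat_powr a y \<le> c a * (1 + y) powr a"
    by metis
  define D where "D = 1 + c (1/4) + c (-3/4) + c (-7/4) + c (-11/4) + c (-15/4)"
  have D: "D \<ge> 1" "c (1/4) \<le> D" "c (-3/4) \<le> D" "c (-7/4) \<le> D" "c (-11/4) \<le> D" "c (-15/4) \<le> D"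
    using c(1)[of "1/4"] c(1)[of "-3/4"] c(1)[of "-7/4"] c(1)[of "-11/4"] c(1)[of "-15/4"]
    by (auto simp: D_def)
  \<comment> \<open>These five exponents are all that occur in \<open>profile\<close>,
    \<open>flat1\<close> and \<open>flat2\<close>. Raising the exponent to \<open>b\<close> is
    harmless since \<open>1 + y >= 1\<close>.\<close>
  have fl: "flat_powr a y \<le> D * (1 + y) powr b"
    if "a \<in> {1/4, -3/4, -7/4, -11/4, -15/4}" "a \<le> b" "y > 0" for a b y
  proof -
    have "c a \<le> D" using that(1) D by (auto simp only: insert_iff empty_iff)
    have "flat_powr a y \<le> c a * (1 + y) powr a" using c(2) that by blast
    also have "\<dots> \<le> D * (1 + y) powr b"
      using that(2,3) D(1) c(1)[of a] \<open>c a \<le> D\<close> by (intro mult_mono powr_mono) auto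
    finally show ?thesis .
  qed
  have f1: "0 \<le> flat1 y" "flat1 y \<le> 2 * D * (1 + y) powr (-3/4)" if "y > 0" for y
    using fl[of "-3/4" "-3/4" y] fl[of "-7/4" "-3/4" y] that flat_powr_nonneg[of "-3/4" y] flat_powr_nonneg[of "-7/4" y]
    by (simp_all add: flat1_def)
  have f1': "flat1 y \<le> 2 * D" if "y > 0" for y
  proof -
    have "(1 + y) powr (-3/4) \<le> (1 + y) powr 0" using that by (intro powr_mono) auto
    then have "2 * D * (1 + y) powr (-3/4) \<le> 2 * D * 1" using D that by (intro mult_left_mono) auto
    then show ?thesis using f1(2)[OF that] by linarith
  qed
  have f2: "\<bar>flat2 y\<bar> \<le> 3 * D" if "y > 0" for y
    using fl[of "-7/4" 0 y] fl[of "-11/4" 0 y] fl[of "-15/4" 0 y] that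
      flat_powr_nonneg[of "-7/4" y] flat_powr_nonneg[of "-11/4" y] flat_powr_nonneg[of "-15/4" y]
    by (simp add: flat2_def)
  \<comment> \<open>As \<open>D >= 1\<close>, this covers 2 + 2 D^2 for \<open>profile\<close>, 3 D
    + 2 D for \<open>profile2\<close> and 4 D^2 for the square of \<open>profile1\<close>.\<close>
  define C where "C = 6 * D\<^sup>2"
  have "D \<le> D\<^sup>2" using D(1) by (simp add: power2_eq_square)
  then have C: "C \<ge> 6" "6 * D \<le> C" using D(1) by (auto simp: C_def)
  have y: "ln 4 - ln u > 0" if "0 < u" "u < 4" for u :: real using that by simp
  have sq: "(profile u)\<^sup>2 \<le> 2 * D\<^sup>2 / sqrt u" if "u > 0" for u
  proof (cases "u < 4")
    case True
    have "(profile u)\<^sup>2 \<le> (D * (1 + (ln 4 - ln u)) powr (1/4))\<^sup>2"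
      unfolding profile_def
      using fl[of "1/4" "1/4"] y[OF that True] by (intro power_mono flat_powr_nonneg) auto
    also have "\<dots> = D\<^sup>2 * sqrt (1 + (ln 4 - ln u))"
      using y[OF that True]
      by (simp add: power_mult_distrib powr_square powr_half_sqrt)
    also have "\<dots> \<le> D\<^sup>2 * sqrt (4 / u)"
      using one_plus_ln_le[OF that] by (intro mult_left_mono) auto
    finally show ?thesis by (simp add: real_sqrt_divide mult.commute)
  next
    case False
    then show ?thesis using D that by (simp add: profile_eq_0)
  qed
  show thesis
  proof
    show "C \<ge> 1" using C by simp
    fix u :: real assume u: "u > 0"
    show "(profile u)\<^sup>2 \<le> C / sqrt u"
      by (rule order_trans[OF sq[OF u]]) (use u in \<open>auto simp: C_def intro!: divide_right_mono\<close>)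
    show "\<bar>profile u\<bar> \<le> C / sqrt u"
    proof (cases "u < 4")
      case True
      have "0 \<le> (\<bar>profile u\<bar> - 1)\<^sup>2" by simp
      then have "\<bar>profile u\<bar> \<le> 1 + (profile u)\<^sup>2" by (simp add: power2_diff)
      also have "\<dots> \<le> 2 / sqrt u + 2 * D\<^sup>2 / sqrt u"
        using sq[OF u] True u real_sqrt_le_mono[of u 4] by (intro add_mono) auto
      also have "\<dots> = (2 + 2 * D\<^sup>2) / sqrt u" by (simp add: add_divide_distrib)
      also have "\<dots> \<le> C / sqrt u"
        using D \<open>D \<le> D\<^sup>2\<close> u by (intro divide_right_mono) (auto simp: C_def)
      finally show ?thesis .
    qed (use C u in \<open>simp add: profile_eq_0\<close>)
    show "\<bar>profile1 u\<bar> \<le> C / u"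
    proof (cases "u < 4")
      case True
      then show ?thesis
        using f1(1)[OF y[OF u True]] f1'[OF y[OF u True]] C D u
        by (auto simp: profile1_def intro!: divide_right_mono)
    qed (use C u in \<open>simp add: profile_eq_0\<close>)
    show "\<bar>profile2 u\<bar> \<le> C / u\<^sup>2"
    proof (cases "u < 4")
      case True
      then show ?thesis
        using f1(1)[OF y[OF u True]] f1'[OF y[OF u True]] f2[OF y[OF u True]] C D u
        by (auto simp: profile2_def abs_divide intro!: divide_right_mono)
    qed (use C u in \<open>simp add: profile_eq_0\<close>)
    assume "u < 4"
    note y = y[OF u this]
    have "(profile1 u)\<^sup>2 = (flat1 (ln 4 - ln u))\<^sup>2 / u\<^sup>2" by (simp add: profile1_def power_divide)
    also have "\<dots> \<le> (2 * D * (1 + (ln 4 - ln u)) powr (-3/4))\<^sup>2 / u\<^sup>2"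
      by (intro divide_right_mono power_mono f1 y) auto
    also have "\<dots> = 4 * D\<^sup>2 * ((1 + (ln 4 - ln u)) powr (-3/2) / u\<^sup>2)"
      by (simp add: power_mult_distrib powr_square)
    also have "\<dots> \<le> C * ((1 + (ln 4 - ln u)) powr (-3/2) / u\<^sup>2)"
      by (intro mult_right_mono) (auto simp: C_def)
    finally show "(profile1 u)\<^sup>2 \<le> C * ((1 + (ln 4 - ln u)) powr (-3/2) / u\<^sup>2)" .
  qed
qed

section \<open>An integrable majorant\<close>

lemma emeasure_box3:
  assumes "a1 \<le> b1" "a2 \<le> b2" "a3 \<le> b3"
  shows "emeasure lborel {x :: real^3. a1 \<le> x$1 \<and> x$1 \<le> b1 \<and> a2 \<le> x$2 \<and> x$2 \<le> b2 \<and> a3 \<le> x$3 \<and> x$3 \<le> b3} =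
      ennreal ((b1 - a1) * (b2 - a2) * (b3 - a3))"
    and "{x :: real^3. a1 \<le> x$1 \<and> x$1 \<le> b1 \<and> a2 \<le> x$2 \<and> x$2 \<le> b2 \<and> a3 \<le> x$3 \<and> x$3 \<le> b3} \<in> sets borel"
proof -
  let ?a = "vector [a1, a2, a3] :: real^3" and ?b = "vector [b1, b2, b3] :: real^3"
  have eq: "{x :: real^3. a1 \<le> x$1 \<and> x$1 \<le> b1 \<and> a2 \<le> x$2 \<and> x$2 \<le> b2 \<and> a3 \<le> x$3 \<and> x$3 \<le> b3} = cbox ?a ?b"
    by (auto simp: mem_box_cart forall_3)
  have "?a \<in> cbox ?a ?b" using assms by (auto simp: mem_box_cart forall_3)
  then have "measure lborel (cbox ?a ?b) = (\<Prod>i\<in>UNIV. ?b $ i - ?a $ i)"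
    by (intro content_cbox_cart) auto
  also have "\<dots> = (b1 - a1) * (b2 - a2) * (b3 - a3)"
    unfolding UNIV_3 by (simp add: mult.assoc)
  finally have "measure lborel (cbox ?a ?b) = (b1 - a1) * (b2 - a2) * (b3 - a3)" .
  then show "emeasure lborel {x :: real^3. a1 \<le> x$1 \<and> x$1 \<le> b1 \<and> a2 \<le> x$2 \<and> x$2 \<le> b2 \<and> a3 \<le> x$3 \<and> x$3 \<le> b3} =
      ennreal ((b1 - a1) * (b2 - a2) * (b3 - a3))"
    unfolding eq using emeasure_eq_ennreal_measure[of lborel "cbox ?a ?b"] emeasure_lborel_cbox_finite[of ?a ?b]
    by simp
  show "{x :: real^3. a1 \<le> x$1 \<and> x$1 \<le> b1 \<and> a2 \<le> x$2 \<and> x$2 \<le> b2 \<and> a3 \<le> x$3 \<and> x$3 \<le> b3} \<in> sets borel"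
    unfolding eq by simp
qed

text \<open>The function is dominated by the sum of \<open>c k\<close> times the indicators of the
  \<open>A k\<close>, which may overlap. Singular integrals thereby reduce to volumes of boxes on
  dyadic scales, without polar coordinates.\<close>

lemma nn_integral_cover_finite:
  fixes w :: "'a \<Rightarrow> real"
  assumes cover: "\<And>x. w x > 0 \<Longrightarrow> \<exists>k. x \<in> A k \<and> w x \<le> c k"
    and A: "\<And>k. A k \<in> sets M" "\<And>k. emeasure M (A k) \<le> ennreal (m k)"
    and nonneg: "\<And>k. c k \<ge> 0" "\<And>k. m k \<ge> 0" and summ: "summable (\<lambda>k. c k * m k)"
  shows "(\<integral>\<^sup>+x. ennreal (w x) \<partial>M) < \<infinity>"
proof -
  have "(\<integral>\<^sup>+x. ennreal (w x) \<partial>M) \<le> (\<integral>\<^sup>+x. (\<Sum>k. ennreal (c k) * indicator (A k) x) \<partial>M)"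
  proof (intro nn_integral_mono)
    fix x
    show "ennreal (w x) \<le> (\<Sum>k. ennreal (c k) * indicator (A k) x)"
    proof (cases "w x > 0")
      case True
      then obtain k where k: "x \<in> A k" "w x \<le> c k" using cover by blast
      have "ennreal (w x) \<le> (\<Sum>j\<in>{k}. ennreal (c j) * indicator (A j) x)"
        using k by (simp add: ennreal_leI)
      also have "\<dots> \<le> (\<Sum>k. ennreal (c k) * indicator (A k) x)"
        by (intro sum_le_suminf) auto
      finally show ?thesis .
    qed (simp add: ennreal_neg)
  qed
  also have "\<dots> = (\<Sum>k. \<integral>\<^sup>+x. ennreal (c k) * indicator (A k) x \<partial>M)"
    by (intro nn_integral_suminf borel_measurable_times_ennreal borel_measurable_const
        borel_measurable_indicator A(1))
  also have "\<dots> = (\<Sum>k. ennreal (c k) * emeasure M (A k))"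
    by (simp only: nn_integral_cmult_indicator[OF A(1)])
  also have "\<dots> \<le> (\<Sum>k. ennreal (c k * m k))"
    by (intro suminf_le summableI) (simp add: ennreal_mult nonneg mult_left_mono A(2))
  also have "\<dots> < \<infinity>"
    using ennreal_suminf_neq_top[OF summ mult_nonneg_nonneg[OF nonneg]] unfolding infinity_ennreal_def less_top .
  finally show ?thesis .
qed

lemma dyadic_scale:
  fixes z :: real
  assumes "0 < z" "z \<le> 1"
  obtains k where "(1/2) ^ Suc k < z" "z \<le> (1/2) ^ k"
proof -
  obtain n where "(1/2) ^ n < z" using real_arch_pow_inv[OF assms(1), of "1/2"] by auto
  then have ex: "\<exists>n. (1/2) ^ n < z" by blast
  define N where "N = (LEAST n. (1/2) ^ n < z)"
  have N: "(1/2) ^ N < z" unfolding N_def using ex by (rule LeastI_ex)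
  then have "N \<noteq> 0" using assms by (cases N) auto
  then obtain k where k: "N = Suc k" by (cases N) auto
  have "\<not> (1/2) ^ k < z" using not_less_Least[of k "\<lambda>n. (1/2) ^ n < z"] k by (simp add: N_def)
  then show thesis using that[of k] N k by simp
qed

text \<open>The normalization makes \<open>half_sq x = x $ 1\<close> the unit sphere about (1, 0,
  0), the boundary of the initial ball, which passes through 0.\<close>

definition half_sq :: "real^3 \<Rightarrow> real" where
  "half_sq x = ((x$1)\<^sup>2 + (x$2)\<^sup>2 + (x$3)\<^sup>2) / 2"

definition log_weight :: "real \<Rightarrow> real" where
  "log_weight u = (1 + (ln 4 - ln u)) powr (-3/2) / u\<^sup>2"

text \<open>Up to constants this dominates the squares of all derivatives of the extended data; the second term is
  needed only for \<open>profile1\<close> inside the ball, where \<open>1 / x $ 1\<close> is of order \<open>1 / half_sq x\<close> near the boundary.\<close>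

definition majorant :: "real^3 \<Rightarrow> real" where
  "majorant x = (if half_sq x \<le> 9/2 then 1 / half_sq x else 0) +
     (if half_sq x < x$1 then log_weight (x$1) else 0)"

lemma half_sq_nonneg: "half_sq x \<ge> 0" by (simp add: half_sq_def)

lemma half_sq_pos: "x \<noteq> 0 \<Longrightarrow> half_sq x > 0"
  by (auto simp: half_sq_def vec_eq_iff forall_3 add_nonneg_pos add_pos_nonneg)

lemma component_sq_le: "(x$i)\<^sup>2 \<le> 2 * half_sq x"
  using exhaust_3[of i] by (auto simp: half_sq_def)

lemma borel_measurable_half_sq [measurable]: "half_sq \<in> borel_measurable borel"
  unfolding half_sq_def[abs_def] by measurable

lemma log_weight_measurable [measurable]: "log_weight \<in> borel_measurable borel"
  unfolding log_weight_def[abs_def] by measurable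

lemma inner_ball_bounds:
  assumes "half_sq x < x$1"
  shows "0 < x$1" "x$1 < 2" "half_sq x < 2"
proof -
  show p: "0 < x$1" using assms half_sq_nonneg[of x] by linarith
  have "(x$1)\<^sup>2 < 2 * x$1" using assms component_sq_le[of x 1] by linarith
  then show "x$1 < 2" using p by (simp add: power2_eq_square)
  then show "half_sq x < 2" using assms by linarith
qed

text \<open>Where \<open>half_sq x\<close> is of order 2^-k, the integrand is of order 2^k and a
  surrounding cube has volume of order 2^(-3k/2). The products form a geometric series with ratio
  2^(-1/2); this is where dimension three enters.\<close>

lemma nn_integral_inverse_square: "(\<integral>\<^sup>+x. ennreal (if half_sq x \<le> 9/2 then 1 / half_sq x else 0) \<partial>lborel) < \<infinity>"
proof (rule nn_integral_cover_finite)
  \<comment> \<open>From \<open>half_sq x <= 9/2 * (1/2)^k\<close> follows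
    \<open>(x $ i)^2 <= 9 * (1/2)^k\<close>. The cut at 9/2 lies beyond 4, where the extended data
    have already vanished, and gives the round radius 3.\<close>
  define r where "r = (\<lambda>k::nat. 3 * sqrt ((1/2)^k))"
  define A where "A = (\<lambda>k::nat. {x :: real^3. - r k \<le> x$1 \<and> x$1 \<le> r k \<and> - r k \<le> x$2 \<and> x$2 \<le> r k \<and> - r k \<le> x$3 \<and> x$3 \<le> r k})"
  have r: "- r k \<le> r k" "r k \<ge> 0" for k by (auto simp: r_def)
  show "A k \<in> sets lborel" for k using emeasure_box3(2)[OF r(1) r(1) r(1)] by (simp add: A_def)
  show "emeasure lborel (A k) \<le> ennreal ((2 * r k)^3)" for k
    using emeasure_box3(1)[OF r(1) r(1) r(1)] by (simp add: A_def power3_eq_cube)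
  show "\<exists>k. x \<in> A k \<and> (if half_sq x \<le> 9/2 then 1 / half_sq x else 0) \<le> 2 ^ k"
    if "(if half_sq x \<le> 9/2 then 1 / half_sq x else 0) > 0" for x
  proof -
    have s: "0 < half_sq x" "half_sq x \<le> 9/2" using that by (auto split: if_splits)
    obtain k where k: "(1/2) ^ Suc k < 2/9 * half_sq x" "2/9 * half_sq x \<le> (1/2)^k"
      by (rule dyadic_scale[of "2/9 * half_sq x"]) (use s in auto)
    have "\<bar>x$i\<bar> \<le> r k" for i
    proof -
      have "(x$i)\<^sup>2 \<le> 9 * (1/2)^k" using component_sq_le[of x i] k(2) by linarith
      then have "sqrt ((x$i)\<^sup>2) \<le> sqrt (9 * (1/2)^k)" by (rule real_sqrt_le_mono)
      then show ?thesis by (simp add: r_def real_sqrt_mult)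
    qed
    then have "x \<in> A k" by (simp add: A_def abs_le_iff minus_le_iff)
    moreover have "1 / half_sq x \<le> 2 ^ k"
    proof -
      have "1 \<le> 2 ^ k * half_sq x" using k(1) by (simp add: field_simps)
      then show ?thesis using s by (simp add: field_simps)
    qed
    ultimately show ?thesis using s by auto
  qed
  show "0 \<le> (2 * r k)^3" for k using r by simp
  have "2 ^ k * (2 * r k)^3 = 216 * (sqrt (1/2)) ^ k" for k
  proof -
    have q: "sqrt ((1/2)^k) = (sqrt (1/2))^k" by (simp add: real_sqrt_power)
    have "(2::real) ^ k * ((sqrt (1/2))^k)\<^sup>2 = 1"
      by (simp add: power_mult_distrib[symmetric] power_mult[symmetric] mult.commute[of k] power_mult)
    then show ?thesis unfolding r_def q by (simp add: power3_eq_cube power2_eq_square algebra_simps)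
  qed
  moreover have "summable (\<lambda>k. 216 * (sqrt (1/2)) ^ k)"
    by (intro summable_mult summable_geometric) (auto simp: real_sqrt_divide)
  ultimately show "summable (\<lambda>k. 2 ^ k * (2 * r k)^3)" by (simp only:)
qed auto

text \<open>At height of order 2^-k above the tangent plane, the ball lies in a box of thickness of
  order 2^-k and width of order 2^(-k/2), hence of volume of order 4^-k. The weight there is of
  order 4^k (1 + k)^(-3/2), and the sum of (1 + k)^(-3/2) converges.\<close>

lemma nn_integral_log_weight: "(\<integral>\<^sup>+x. ennreal (if half_sq x < x$1 then log_weight (x$1) else 0) \<partial>lborel) < \<infinity>"
proof (rule nn_integral_cover_finite)
  \<comment> \<open>Inside the ball \<open>(x $ i)^2 <= 2 * half_sq x < 2 * x $ 1\<close>, and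
    \<open>x $ 1 <= 4 * (1/2)^k\<close>.\<close>
  define r where "r = (\<lambda>k::nat. sqrt (8 * (1/2)^k))"
  define A where "A = (\<lambda>k::nat. {x :: real^3. 0 \<le> x$1 \<and> x$1 \<le> 4 * (1/2)^k \<and> - r k \<le> x$2 \<and> x$2 \<le> r k \<and> - r k \<le> x$3 \<and> x$3 \<le> r k})"
  define c where "c = (\<lambda>k::nat. ((1 + real k) / 2) powr (-3/2) * 4 ^ k)"
  have r: "- r k \<le> r k" "r k \<ge> 0" "(0::real) \<le> 4 * (1/2)^k" for k by (auto simp: r_def)
  show "A k \<in> sets lborel" for k using emeasure_box3(2)[OF r(3) r(1) r(1)] by (simp add: A_def)
  have rr: "r k * r k = 8 * (1/2)^k" for k by (simp add: r_def)
  show "emeasure lborel (A k) \<le> ennreal (128 * (1/4)^k)" for k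
  proof -
    have "(4 * (1/2)^k - 0) * (r k - - r k) * (r k - - r k) = (4 * (1/2)^k) * 4 * (r k * r k)" by simp
    also have "\<dots> = 128 * ((1/2)^k * (1/2)^k)" unfolding rr by simp
    also have "\<dots> = 128 * (1/4)^k" by (simp add: power_mult_distrib[symmetric])
    finally show ?thesis
      using emeasure_box3(1)[OF r(3) r(1) r(1), of k k k] by (simp add: A_def)
  qed
  show "\<exists>k. x \<in> A k \<and> (if half_sq x < x$1 then log_weight (x$1) else 0) \<le> c k"
    if "(if half_sq x < x$1 then log_weight (x$1) else 0) > 0" for x
  proof -
    have s: "half_sq x < x$1" using that by (auto split: if_splits)
    note b = inner_ball_bounds[OF s]
    obtain k where k: "(1/2) ^ Suc k < x$1 / 4" "x$1 / 4 \<le> (1/2)^k"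
      by (rule dyadic_scale[of "x$1 / 4"]) (use b in auto)
    have "\<bar>x$i\<bar> \<le> r k" for i
    proof -
      have "(x$i)\<^sup>2 \<le> 8 * (1/2)^k" using component_sq_le[of x i] s k(2) by linarith
      then have "sqrt ((x$i)\<^sup>2) \<le> r k" unfolding r_def by (rule real_sqrt_le_mono)
      then show ?thesis by simp
    qed
    then have "x \<in> A k" using b k(2) by (simp add: A_def abs_le_iff minus_le_iff)
    moreover have "log_weight (x$1) \<le> c k"
    proof -
      have "ln (2 ^ k) \<le> ln (4 / x$1)" using b k(2) by (intro ln_mono) (auto simp: field_simps power_divide)
      then have "real k * ln 2 \<le> ln 4 - ln (x$1)" using b by (simp add: ln_realpow ln_div)
      moreover have "real k * (1/2) \<le> real k * ln 2" using ln2_ge_two_thirds by (intro mult_left_mono) auto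
      ultimately have y: "(1 + real k) / 2 \<le> 1 + (ln 4 - ln (x$1))" by (simp add: field_simps)
      have "(1 + (ln 4 - ln (x$1))) powr (-3/2) \<le> ((1 + real k) / 2) powr (-3/2)"
        using y by (intro powr_mono2') auto
      moreover have "1 / (x$1)\<^sup>2 \<le> 4 ^ k"
      proof -
        have "1 \<le> 2 ^ k * x$1" using k(1) by (simp add: field_simps power_divide)
        then have "1\<^sup>2 \<le> (2 ^ k * x$1)\<^sup>2" by (intro power_mono) auto
        also have "\<dots> = 4 ^ k * (x$1)\<^sup>2" by (simp add: power_mult_distrib power2_eq_square flip: power_mult_distrib)
        finally show ?thesis using b by (simp add: field_simps)
      qed
      ultimately have "(1 + (ln 4 - ln (x$1))) powr (-3/2) * (1 / (x$1)\<^sup>2) \<le> c k"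
        unfolding c_def by (intro mult_mono) auto
      then show ?thesis by (simp add: log_weight_def)
    qed
    ultimately show ?thesis using s by auto
  qed
  show "0 \<le> c k" for k by (simp add: c_def)
  have "c k * (128 * (1/4)^k) = 128 * (1/2) powr (-3/2) * (real (Suc k) powr (-3/2))" for k
  proof -
    have "(4::real)^k * (1/4)^k = 1" by (simp flip: power_mult_distrib)
    then show ?thesis
      by (simp add: c_def powr_divide powr_mult add.commute divide_simps)
  qed
  moreover have "summable (\<lambda>k. 128 * (1/2) powr (-3/2) * (real (Suc k) powr (-3/2)))"
    using summable_real_powr_iff[of "-3/2"] summable_Suc_iff[of "\<lambda>n. real n powr (-3/2)"]
    by (intro summable_mult) auto
  ultimately show "summable (\<lambda>k. c k * (128 * (1/4)^k))" by (simp only:)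
qed auto

lemma majorant_measurable [measurable]: "majorant \<in> borel_measurable borel"
  unfolding majorant_def[abs_def] by measurable

lemma integrable_majorant: "integrable lborel majorant"
proof (rule integrableI_nonneg)
  have nn: "0 \<le> (if half_sq x \<le> 9/2 then 1 / half_sq x else 0)" "0 \<le> (if half_sq x < x$1 then log_weight (x$1) else 0)" for x
    by (auto simp: half_sq_nonneg log_weight_def)
  show "AE x in lborel. 0 \<le> majorant x" using nn by (auto simp: majorant_def add_nonneg_nonneg)
  have "(\<integral>\<^sup>+x. ennreal (majorant x) \<partial>lborel) =
     (\<integral>\<^sup>+x. ennreal (if half_sq x \<le> 9/2 then 1 / half_sq x else 0) + ennreal (if half_sq x < x$1 then log_weight (x$1) else 0) \<partial>lborel)"
    unfolding majorant_def using nn by (simp only: ennreal_plus)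
  also have "\<dots> = (\<integral>\<^sup>+x. ennreal (if half_sq x \<le> 9/2 then 1 / half_sq x else 0) \<partial>lborel) +
      (\<integral>\<^sup>+x. ennreal (if half_sq x < x$1 then log_weight (x$1) else 0) \<partial>lborel)"
    by (rule nn_integral_add) measurable
  also have "\<dots> < \<infinity>" using nn_integral_inverse_square nn_integral_log_weight by simp
  finally show "(\<integral>\<^sup>+x. ennreal (majorant x) \<partial>lborel) < \<infinity>" .
qed simp

section \<open>Extension of the data\<close>

lemma component_line:
  "((\<lambda>r. (x + r *\<^sub>R axis i 1) $ j) has_real_derivative (if j = i then 1 else 0)) (at r)" for x :: "real^3"
  by (auto intro!: derivative_eq_intros simp: axis_def)

lemma half_sq_add_axis: "half_sq (x + r *\<^sub>R axis i 1) = half_sq x + r * x $ i + r\<^sup>2 / 2"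
  using exhaust_3[of i] by (auto simp: half_sq_def axis_def power2_eq_square algebra_simps add_divide_distrib)

lemma half_sq_line:
  "((\<lambda>r. half_sq (x + r *\<^sub>R axis i 1)) has_real_derivative (x + r *\<^sub>R axis i 1) $ i) (at r)"
  unfolding half_sq_add_axis by (auto intro!: derivative_eq_intros simp: axis_def)

lemma finite_sphere_line: "finite {r. half_sq (x + r *\<^sub>R axis i 1) = (x + r *\<^sub>R axis i 1) $ 1}"
proof -
  let ?d = "if i = 1 then 1 else 0 :: real"
  let ?p = "[: half_sq x - x $ 1, x $ i - ?d, 1/2 :]"
  have "{r. half_sq (x + r *\<^sub>R axis i 1) = (x + r *\<^sub>R axis i 1) $ 1} \<subseteq> {r. poly ?p r = 0}"
    unfolding half_sq_add_axis by (auto simp: axis_def power2_eq_square algebra_simps)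
  moreover have "finite {r. poly ?p r = 0}" by (rule poly_roots_finite) simp
  ultimately show ?thesis by (rule finite_subset)
qed

text \<open>Any coordinate \<open>j\<close> other than \<open>i\<close> is constant along the line,
  so a line through 0 starts in the null set where that coordinate vanishes.\<close>

lemma AE_line_avoids_0: "AE x in lborel. \<forall>r. x + r *\<^sub>R axis i 1 \<noteq> (0 :: real^3)"
proof -
  obtain j :: 3 where j: "j \<noteq> i" using exhaust_3[of i] by (metis one_neq_zero zero_neq_one UNIV_3 card_1_singleton_iff)
  have "axis j 1 \<in> (Basis :: (real^3) set)" by (simp add: axis_in_Basis_iff)
  then have "{x :: real^3. x \<bullet> axis j 1 = 0} \<in> null_sets lebesgue"
    by (simp add: negligible_standard_hyperplane flip: negligible_iff_null_sets)
  moreover have "{x :: real^3. x \<bullet> axis j 1 = 0} \<in> sets lborel" by simp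
  ultimately have "{x :: real^3. x \<bullet> axis j 1 = 0} \<in> null_sets lborel"
    using null_sets_completion_iff by blast
  then have "AE x in lborel. x \<notin> {x :: real^3. x \<bullet> axis j 1 = 0}" by (rule AE_not_in)
  then show ?thesis
  proof eventually_elim
    case (elim x)
    show ?case
    proof (intro allI notI)
      fix r assume "x + r *\<^sub>R axis i 1 = 0"
      then have "(x + r *\<^sub>R axis i 1) $ j = 0" by simp
      moreover have "axis i 1 $ j = (0::real)" using j by (simp add: axis_def)
      ultimately show False using elim by (simp add: inner_axis)
    qed
  qed
qed

lemma isCont_piecewise:
  fixes a b :: "real \<Rightarrow> real"
  assumes "isCont a r" "isCont b r" "a r = b r"
  shows "isCont (\<lambda>r. if P r then a r else b r) r"
proof -
  have "((\<lambda>r. if P r then a r else b r) \<longlongrightarrow> a r) (at r)"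
    using assms unfolding isCont_def
    by (intro filterlim_If) (auto intro: filterlim_mono[OF _ order_refl inf_le1])
  then show ?thesis using assms(3) by (simp add: isCont_def)
qed

text \<open>The sphere \<open>half_sq x = x $ 1\<close> meets every line in at most two points, and almost no line parallel
  to an axis passes through the singularity \<open>0\<close>.\<close>

lemma weakly_differentiable_piecewise:
  assumes V: "sq_dominated majorant (\<lambda>x. if half_sq x < x$1 then A x else B x)"
    and W: "sq_dominated majorant (\<lambda>x. if half_sq x < x$1 then A' x else B' x)"
    and A: "\<And>x r. 0 < (x + r *\<^sub>R axis i 1)$1 \<Longrightarrow>
      ((\<lambda>r. A (x + r *\<^sub>R axis i 1)) has_real_derivative A' (x + r *\<^sub>R axis i 1)) (at r)"
    and B: "\<And>x r. 0 < half_sq (x + r *\<^sub>R axis i 1) \<Longrightarrow>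
      ((\<lambda>r. B (x + r *\<^sub>R axis i 1)) has_real_derivative B' (x + r *\<^sub>R axis i 1)) (at r)"
    and eq: "\<And>x. 0 < x$1 \<Longrightarrow> half_sq x = x$1 \<Longrightarrow> A x = B x"
  shows "weakly_differentiable (\<lambda>x. if half_sq x < x$1 then A x else B x) i (\<lambda>x. if half_sq x < x$1 then A' x else B' x)"
  unfolding weakly_differentiable_def
proof (intro allI impI integral_by_parts_lines[OF integrable_majorant V W])
  show "AE x in lborel. \<exists>S. finite S \<and> continuous_on UNIV (\<lambda>r. if half_sq (x + r *\<^sub>R axis i 1) < (x + r *\<^sub>R axis i 1)$1
          then A (x + r *\<^sub>R axis i 1) else B (x + r *\<^sub>R axis i 1)) \<and>
      (\<forall>r. r \<notin> S \<longrightarrow> ((\<lambda>r. if half_sq (x + r *\<^sub>R axis i 1) < (x + r *\<^sub>R axis i 1)$1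
          then A (x + r *\<^sub>R axis i 1) else B (x + r *\<^sub>R axis i 1)) has_real_derivative
        (if half_sq (x + r *\<^sub>R axis i 1) < (x + r *\<^sub>R axis i 1)$1
          then A' (x + r *\<^sub>R axis i 1) else B' (x + r *\<^sub>R axis i 1))) (at r))"
    using AE_line_avoids_0[of i]
  proof eventually_elim
    case (elim x)
    define l where "l = (\<lambda>r. x + r *\<^sub>R axis i 1)"
    define d where "d = (\<lambda>r. half_sq (l r) - l r $ 1)"
    define S where "S = {r. half_sq (l r) = l r $ 1}"
    have "isCont (\<lambda>r. half_sq (l r)) r" "isCont (\<lambda>r. l r $ 1) r" for r
      using DERIV_isCont[OF half_sq_line] DERIV_isCont[OF component_line] unfolding l_def by blast+
    then have contd: "continuous_on UNIV d"
      unfolding d_def by (intro continuous_on_diff continuous_at_imp_continuous_on) auto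
    have op: "open {r. d r < 0}" "open {r. d r > 0}"
      using contd by (auto intro!: open_Collect_less continuous_intros)
    \<comment> \<open>Because the line misses 0, the outer branch is differentiable everywhere on
      it, and the inner one wherever \<open>l r $ 1 >= half_sq (l r)\<close>, that is, inside the
      ball and on the sphere.\<close>
    have pos: "half_sq (l r) > 0" for r using elim half_sq_pos by (auto simp: l_def)
    let ?V = "\<lambda>r. if half_sq (l r) < l r $ 1 then A (l r) else B (l r)"
    have D: "(?V has_real_derivative (if half_sq (l r) < l r $ 1 then A' (l r) else B' (l r))) (at r)"
      if "r \<notin> S" for r
    proof (cases "half_sq (l r) < l r $ 1")
      case True
      have "((\<lambda>r. A (l r)) has_real_derivative A' (l r)) (at r)"
        using A[of x r] True pos[of r] unfolding l_def by linarith
      then have "(?V has_real_derivative A' (l r)) (at r)"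
        by (rule has_field_derivative_transform_within_open[OF _ op(1)]) (use True in \<open>auto simp: d_def\<close>)
      then show ?thesis using True by simp
    next
      case False
      have "((\<lambda>r. B (l r)) has_real_derivative B' (l r)) (at r)"
        using B[of x r] pos[of r] unfolding l_def by blast
      then have "(?V has_real_derivative B' (l r)) (at r)"
        by (rule has_field_derivative_transform_within_open[OF _ op(2)])
           (use False that in \<open>auto simp: d_def S_def\<close>)
      then show ?thesis using False by simp
    qed
    have "isCont ?V r" for r
    proof (cases "r \<in> S")
      case True
      then have 1: "half_sq (l r) = l r $ 1" "l r $ 1 > 0" using pos[of r] by (auto simp: S_def)
      have "isCont (\<lambda>r. A (l r)) r" using A[of x r] 1 unfolding l_def by (auto intro: DERIV_isCont)
      moreover have "isCont (\<lambda>r. B (l r)) r" using B[of x r] pos[of r] unfolding l_def by (auto intro: DERIV_isCont)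
      ultimately show ?thesis by (rule isCont_piecewise) (rule eq[OF 1(2,1)])
    qed (use D DERIV_isCont in blast)
    then have "continuous_on UNIV ?V" by (intro continuous_at_imp_continuous_on) auto
    moreover have "finite S" unfolding S_def l_def by (rule finite_sphere_line)
    ultimately show ?case using D unfolding l_def by blast
  qed
qed

lemma log_weight_nonneg: "log_weight u \<ge> 0"
  by (simp add: log_weight_def)

text \<open>Inside the ball \<open>half_sq x < x $ 1\<close>, so \<open>1 / x $ 1\<close> may be
  replaced by the larger isotropic \<open>1 / half_sq x\<close>. The square of the outer bound has
  that form as well, so only the logarithmic term is special to the ball.\<close>

lemma sq_dominated_piecewise:
  assumes [measurable]: "A \<in> borel_measurable borel" "B \<in> borel_measurable borel"
    and A: "\<And>x. half_sq x < x$1 \<Longrightarrow> (A x)\<^sup>2 \<le> C * (1 / x$1 + log_weight (x$1))"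
    and B: "\<And>x. 0 < half_sq x \<Longrightarrow> half_sq x < 4 \<Longrightarrow> \<bar>B x\<bar> \<le> D / sqrt (half_sq x)"
    and B0: "\<And>x. half_sq x \<ge> 4 \<Longrightarrow> B x = 0" and C: "C \<ge> 0"
  shows "sq_dominated majorant (\<lambda>x. if half_sq x < x$1 then A x else B x)"
  unfolding sq_dominated_def
proof (intro conjI exI)
  show "AE x in lborel. (if half_sq x < x$1 then A x else B x)\<^sup>2 \<le> (C + D\<^sup>2) * majorant x"
    using AE_lborel_singleton[of 0]
  proof eventually_elim
    case (elim x)
    then have s: "half_sq x > 0" by (rule half_sq_pos)
    show ?case
    proof (cases "half_sq x < x$1")
      case True
      note b = inner_ball_bounds[OF True]
      have "(A x)\<^sup>2 \<le> C * (1 / x$1 + log_weight (x$1))" using A True by blast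
      also have "\<dots> \<le> (C + D\<^sup>2) * (1 / half_sq x + log_weight (x$1))"
        using C s b True by (intro mult_mono add_mono divide_left_mono) (auto simp: log_weight_nonneg)
      also have "\<dots> = (C + D\<^sup>2) * majorant x" using b True by (simp add: majorant_def)
      finally show ?thesis using True by simp
    next
      case False
      show ?thesis
      proof (cases "half_sq x < 4")
        case True
        have "(B x)\<^sup>2 \<le> (D / sqrt (half_sq x))\<^sup>2" using B[OF s True] by (intro abs_le_square_iff[THEN iffD1]) linarith
        also have "\<dots> = D\<^sup>2 * (1 / half_sq x)" using s by (simp add: power_divide)
        also have "\<dots> \<le> (C + D\<^sup>2) * (1 / half_sq x)" using C s by (intro mult_right_mono) auto
        also have "\<dots> = (C + D\<^sup>2) * majorant x" using False True by (simp add: majorant_def)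
        finally show ?thesis using False by simp
      next
        case F: False
        have "0 \<le> (C + D\<^sup>2) * majorant x"
          using C s by (auto simp: majorant_def log_weight_nonneg)
        then show ?thesis using False F B0[of x] by simp
      qed
    qed
  qed
qed measurable

text \<open>Continuous across the sphere but in general not differentiable there, which is enough
  for one weak derivative.\<close>

definition extend :: "(real \<Rightarrow> real) \<Rightarrow> real^3 \<Rightarrow> real" where
  "extend k x = (if half_sq x < x$1 then k (x$1) else k (half_sq x))"

text \<open>With \<open>q = sqrt (half_sq x)\<close>, both \<open>x $ i\<close> and
  \<open>x $ 1 - half_sq x\<close> are O(q). These factors pay for the powers of 1/q lost when
  functions of \<open>half_sq x\<close> are differentiated.\<close>

lemma component_bounds:
  assumes "0 < half_sq x" "half_sq x < 4"
  shows "\<bar>x$i\<bar> \<le> 2 * sqrt (half_sq x)" "\<bar>x$1 - half_sq x\<bar> \<le> 4 * sqrt (half_sq x)"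
    "sqrt (half_sq x) \<le> 2" "half_sq x = (sqrt (half_sq x))\<^sup>2"
proof -
  show 1: "\<bar>x$i\<bar> \<le> 2 * sqrt (half_sq x)" for i
  proof -
    have "sqrt ((x$i)\<^sup>2) \<le> sqrt (4 * half_sq x)"
      using component_sq_le[of x i] assms by (intro real_sqrt_le_mono) auto
    then show ?thesis by (simp add: real_sqrt_mult)
  qed
  show 2: "sqrt (half_sq x) \<le> 2" using assms real_sqrt_le_mono[of "half_sq x" 4] by simp
  show 3: "half_sq x = (sqrt (half_sq x))\<^sup>2" using assms by simp
  have "sqrt (half_sq x) * sqrt (half_sq x) \<le> 2 * sqrt (half_sq x)" using 2 assms by (intro mult_right_mono) auto
  then have "half_sq x \<le> 2 * sqrt (half_sq x)" using assms by simp
  then show "\<bar>x$1 - half_sq x\<bar> \<le> 4 * sqrt (half_sq x)" using 1[of 1] assms by linarith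
qed

lemma abs_mult_le: "\<bar>a\<bar> \<le> A \<Longrightarrow> \<bar>b\<bar> \<le> B \<Longrightarrow> \<bar>a * b\<bar> \<le> A * B" for a b :: real
  unfolding abs_mult by (intro mult_mono) auto

lemma in_sobolev_extend:
  assumes [measurable]: "k \<in> borel_measurable borel" "k' \<in> borel_measurable borel"
    and k: "\<And>u. u > 0 \<Longrightarrow> (k has_real_derivative k' u) (at u)"
    and k0: "\<And>u. u \<ge> 4 \<Longrightarrow> k u = 0" "\<And>u. u \<ge> 4 \<Longrightarrow> k' u = 0"
    and bd: "\<And>u. u > 0 \<Longrightarrow> \<bar>k u\<bar> \<le> C / sqrt u" "\<And>u. u > 0 \<Longrightarrow> \<bar>k' u\<bar> \<le> C / u"
    and bd': "\<And>u. 0 < u \<Longrightarrow> u < 2 \<Longrightarrow> (k' u)\<^sup>2 \<le> C * (1 / u + log_weight u)"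
  shows "in_sobolev 1 (extend k)"
proof -
  define A' where "A' = (\<lambda>(i::3) (x :: real^3). if i = 1 then k' (x$1) else 0)"
  define B' where "B' = (\<lambda>(i::3) x. k' (half_sq x) * x$i)"
  have [measurable]: "A' i \<in> borel_measurable borel" "B' i \<in> borel_measurable borel" for i
    unfolding A'_def B'_def by measurable
  have C: "C \<ge> 0" using bd(1)[of 1] by simp
  have V: "sq_dominated majorant (\<lambda>x. if half_sq x < x$1 then k (x$1) else k (half_sq x))"
  proof (rule sq_dominated_piecewise)
    show "(k (x$1))\<^sup>2 \<le> C\<^sup>2 * (1 / x$1 + log_weight (x$1))" if "half_sq x < x$1" for x
    proof -
      note b = inner_ball_bounds[OF that]
      have "(k (x$1))\<^sup>2 \<le> (C / sqrt (x$1))\<^sup>2" using bd(1)[OF b(1)] by (intro abs_le_square_iff[THEN iffD1]) linarith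
      also have "\<dots> = C\<^sup>2 * (1 / x$1)" using b by (simp add: power_divide)
      also have "\<dots> \<le> C\<^sup>2 * (1 / x$1 + log_weight (x$1))" by (intro mult_left_mono) (auto simp: log_weight_nonneg)
      finally show ?thesis .
    qed
  qed (use bd k0 in auto)
  have W: "sq_dominated majorant (\<lambda>x. if half_sq x < x$1 then A' i x else B' i x)" for i
  proof (rule sq_dominated_piecewise)
    show "(A' i x)\<^sup>2 \<le> C * (1 / x$1 + log_weight (x$1))" if "half_sq x < x$1" for x
      using inner_ball_bounds[OF that] bd'[of "x$1"] C
      by (auto simp: A'_def intro!: mult_nonneg_nonneg add_nonneg_nonneg log_weight_nonneg)
    show "\<bar>B' i x\<bar> \<le> 2 * C / sqrt (half_sq x)" if "0 < half_sq x" "half_sq x < 4" for x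
    proof -
      define q where "q = sqrt (half_sq x)"
      have q: "q > 0" "half_sq x = q\<^sup>2" "\<bar>x$i\<bar> \<le> 2 * q"
        using component_bounds[OF that] that by (auto simp: q_def)
      have "\<bar>B' i x\<bar> \<le> (C / q\<^sup>2) * (2 * q)"
        unfolding B'_def using bd(2)[OF that(1)] q by (intro abs_mult_le) auto
      then show ?thesis unfolding q_def[symmetric] using q(1) by (simp add: power2_eq_square field_simps)
    qed
  qed (use k0 C in \<open>auto simp: B'_def\<close>)
  show ?thesis
    unfolding extend_def[abs_def]
  proof (rule in_sobolev_1I[OF integrable_majorant V W])
    show "weakly_differentiable (\<lambda>x. if half_sq x < x$1 then k (x$1) else k (half_sq x)) i
        (\<lambda>x. if half_sq x < x$1 then A' i x else B' i x)" for i
    proof (rule weakly_differentiable_piecewise[OF V W])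
      show "((\<lambda>r. k ((x + r *\<^sub>R axis i 1) $ 1)) has_real_derivative A' i (x + r *\<^sub>R axis i 1)) (at r)"
        if "0 < (x + r *\<^sub>R axis i 1) $ 1" for x r
        using DERIV_chain2[OF k[OF that] component_line] by (auto simp: A'_def)
      show "((\<lambda>r. k (half_sq (x + r *\<^sub>R axis i 1))) has_real_derivative B' i (x + r *\<^sub>R axis i 1)) (at r)"
        if "0 < half_sq (x + r *\<^sub>R axis i 1)" for x r
        using DERIV_chain2[OF k[OF that] half_sq_line] by (simp add: B'_def)
    qed simp
  qed
qed

text \<open>Outside the ball \<open>half_sq x < x $ 1\<close> the extension is the first-order Taylor polynomial of \<open>f\<close> at
  \<open>half_sq x\<close>, evaluated at \<open>x $ 1\<close>; it matches \<open>f (x $ 1)\<close> to first order on the sphere.\<close>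

definition extend_C1 :: "(real \<Rightarrow> real) \<Rightarrow> (real \<Rightarrow> real) \<Rightarrow> real^3 \<Rightarrow> real" where
  "extend_C1 f g x = (if half_sq x < x$1 then f (x$1) else f (half_sq x) + g (half_sq x) * (x$1 - half_sq x))"

text \<open>Away from the sphere this is the chain rule; on it, values and first derivatives agree.
  In the worst outer term \<open>g''\<close> costs q^-4 and its three factors of order q restore
  1/q, whose square is a multiple of the isotropic part of the majorant.\<close>

lemma in_sobolev_extend_C1:
  assumes [measurable]: "f \<in> borel_measurable borel" "g \<in> borel_measurable borel"
      "g' \<in> borel_measurable borel" "g'' \<in> borel_measurable borel"
    and der: "\<And>u. u > 0 \<Longrightarrow> (f has_real_derivative g u) (at u)" "\<And>u. u > 0 \<Longrightarrow> (g has_real_derivative g' u) (at u)"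
      "\<And>u. u > 0 \<Longrightarrow> (g' has_real_derivative g'' u) (at u)"
    and zero: "\<And>u. u \<ge> 4 \<Longrightarrow> f u = 0" "\<And>u. u \<ge> 4 \<Longrightarrow> g u = 0" "\<And>u. u \<ge> 4 \<Longrightarrow> g' u = 0" "\<And>u. u \<ge> 4 \<Longrightarrow> g'' u = 0"
    and bd: "\<And>u. u > 0 \<Longrightarrow> \<bar>f u\<bar> \<le> C / sqrt u" "\<And>u. u > 0 \<Longrightarrow> \<bar>g u\<bar> \<le> C / sqrt u"
      "\<And>u. u > 0 \<Longrightarrow> \<bar>g' u\<bar> \<le> C / u" "\<And>u. u > 0 \<Longrightarrow> \<bar>g'' u\<bar> \<le> C / u\<^sup>2"
    and bd': "\<And>u. 0 < u \<Longrightarrow> u < 2 \<Longrightarrow> (g' u)\<^sup>2 \<le> C * (1 / u + log_weight u)"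
  shows "in_sobolev 2 (extend_C1 f g)"
proof -
  define d where "d = (\<lambda>i j :: 3. if i = j then 1 else 0 :: real)"
  have d: "\<bar>d i j\<bar> \<le> 1" for i j by (simp add: d_def)
  define B where "B = (\<lambda>x :: real^3. f (half_sq x) + g (half_sq x) * (x$1 - half_sq x))"
  define A' where "A' = (\<lambda>i (x :: real^3). d i 1 * g (x$1))"
  \<comment> \<open>The terms \<open>g (half_sq x) * x $ i\<close> coming from \<open>f\<close> and
    from the linear Taylor term cancel since \<open>f' = g\<close>. What remains beyond
    \<open>d i 1 * g\<close> has the factor \<open>x $ 1 - half_sq x\<close>, so it agrees with
    \<open>A'\<close> on the sphere.\<close>
  define B' where "B' = (\<lambda>i (x :: real^3). d i 1 * g (half_sq x) + g' (half_sq x) * x$i * (x$1 - half_sq x))"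
  define A'' where "A'' = (\<lambda>i j (x :: real^3). d i 1 * d j 1 * g' (x$1))"
  define B'' where "B'' = (\<lambda>i j (x :: real^3). d i 1 * (g' (half_sq x) * x$j) + g'' (half_sq x) * x$j * x$i * (x$1 - half_sq x) +
     d i j * (g' (half_sq x) * (x$1 - half_sq x)) + g' (half_sq x) * x$i * (d j 1 - x$j))"
  have [measurable]: "B \<in> borel_measurable borel" "A' i \<in> borel_measurable borel" "B' i \<in> borel_measurable borel"
    "A'' i j \<in> borel_measurable borel" "B'' i j \<in> borel_measurable borel" for i j
    unfolding B_def A'_def B'_def A''_def B''_def by measurable
  have C: "C \<ge> 0" using bd(1)[of 1] by simp
  have sq: "(k (x$1))\<^sup>2 \<le> C\<^sup>2 * (1 / x$1 + log_weight (x$1))"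
    if "half_sq x < x$1" "\<And>u. u > 0 \<Longrightarrow> \<bar>k u\<bar> \<le> C / sqrt u" for x k
  proof -
    note b = inner_ball_bounds[OF that(1)]
    have "(k (x$1))\<^sup>2 \<le> (C / sqrt (x$1))\<^sup>2" using that(2)[OF b(1)] by (intro abs_le_square_iff[THEN iffD1]) linarith
    also have "\<dots> = C\<^sup>2 * (1 / x$1)" using b by (simp add: power_divide)
    also have "\<dots> \<le> C\<^sup>2 * (1 / x$1 + log_weight (x$1))" by (intro mult_left_mono) (auto simp: log_weight_nonneg)
    finally show ?thesis .
  qed
  have q: "q > 0" "q \<le> 2" "\<bar>f (half_sq x)\<bar> \<le> C / q" "\<bar>g (half_sq x)\<bar> \<le> C / q" "\<bar>g' (half_sq x)\<bar> \<le> C / q\<^sup>2" "\<bar>g'' (half_sq x)\<bar> \<le> C / q^4"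
      "\<bar>x$i\<bar> \<le> 2 * q" "\<bar>x$1 - half_sq x\<bar> \<le> 4 * q"
    if "0 < half_sq x" "half_sq x < 4" "q = sqrt (half_sq x)" for x q i
    using component_bounds[OF that(1,2)] that bd[OF that(1)] by (auto simp: power4_eq_xxxx power2_eq_square mult.assoc)
  have V: "sq_dominated majorant (\<lambda>x. if half_sq x < x$1 then f (x$1) else B x)"
  proof (rule sq_dominated_piecewise)
    show "\<bar>B x\<bar> \<le> 9 * C / sqrt (half_sq x)" if x: "0 < half_sq x" "half_sq x < 4" for x
    proof -
      define q where "q = sqrt (half_sq x)"
      note q = q[OF x q_def]
      have "\<bar>B x\<bar> \<le> C / q + (C / q) * (4 * q)"
        unfolding B_def by (intro order_trans[OF abs_triangle_ineq] add_mono abs_mult_le q)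
      also have "\<dots> = C / q + (4 * C * q) / q" using q(1) by simp
      also have "\<dots> \<le> C / q + (8 * C) / q" using q(1) mult_left_mono[OF q(2) C]
        by (intro add_left_mono divide_right_mono) auto
      also have "\<dots> = 9 * C / q" by (simp add: add_divide_distrib[symmetric])
      finally show ?thesis by (simp add: q_def)
    qed
  qed (use sq[of _ f] bd(1) zero in \<open>auto simp: B_def\<close>)
  have V': "sq_dominated majorant (\<lambda>x. if half_sq x < x$1 then A' i x else B' i x)" for i
  proof (rule sq_dominated_piecewise)
    show "(A' i x)\<^sup>2 \<le> C\<^sup>2 * (1 / x$1 + log_weight (x$1))" if "half_sq x < x$1" for x
      using sq[OF that bd(2)] inner_ball_bounds[OF that]
      by (auto simp: A'_def d_def intro!: mult_nonneg_nonneg add_nonneg_nonneg log_weight_nonneg)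
    show "\<bar>B' i x\<bar> \<le> 17 * C / sqrt (half_sq x)" if x: "0 < half_sq x" "half_sq x < 4" for x
    proof -
      define q where "q = sqrt (half_sq x)"
      note q = q[OF x q_def]
      have "\<bar>B' i x\<bar> \<le> 1 * (C / q) + (C / q\<^sup>2) * (2 * q) * (4 * q)"
        unfolding B'_def by (intro order_trans[OF abs_triangle_ineq] add_mono abs_mult_le q d)
      also have "\<dots> = C / q + (8 * C * q) / q" using q(1) by (simp add: power2_eq_square)
      also have "\<dots> \<le> C / q + (16 * C) / q" using q(1) mult_left_mono[OF q(2) C]
        by (intro add_left_mono divide_right_mono) auto
      also have "\<dots> = 17 * C / q" by (simp add: add_divide_distrib[symmetric])
      finally show ?thesis by (simp add: q_def)
    qed
  qed (use zero in \<open>auto simp: B'_def\<close>)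
  have V'': "sq_dominated majorant (\<lambda>x. if half_sq x < x$1 then A'' i j x else B'' i j x)" for i j
  proof (rule sq_dominated_piecewise)
    show "(A'' i j x)\<^sup>2 \<le> C * (1 / x$1 + log_weight (x$1))" if "half_sq x < x$1" for x
      using inner_ball_bounds[OF that] bd'[of "x$1"] C
      by (auto simp: A''_def d_def intro!: mult_nonneg_nonneg add_nonneg_nonneg log_weight_nonneg)
    show "\<bar>B'' i j x\<bar> \<le> 32 * C / sqrt (half_sq x)" if x: "0 < half_sq x" "half_sq x < 4" for x
    proof -
      define q where "q = sqrt (half_sq x)"
      note q = q[OF x q_def]
      have "\<bar>d j 1 - x$j\<bar> \<le> 5" using d[of j 1] q(2) q(7)[of j] by linarith
      \<comment> \<open>The four terms contribute 2, 16, 4 and 10 times \<open>C / q\<close>; the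
        last factor 5 is 1 + 2 q with \<open>q <= 2\<close>.\<close>
      then have "\<bar>B'' i j x\<bar> \<le> 1 * ((C / q\<^sup>2) * (2 * q)) + (C / q^4) * (2 * q) * (2 * q) * (4 * q) +
          1 * ((C / q\<^sup>2) * (4 * q)) + (C / q\<^sup>2) * (2 * q) * 5"
        unfolding B''_def by (intro order_trans[OF abs_triangle_ineq] add_mono abs_mult_le q d)
      also have "\<dots> = 32 * C / q" using q(1) by (simp add: power2_eq_square power4_eq_xxxx field_simps)
      finally show ?thesis by (simp add: q_def)
    qed
  qed (use zero C in \<open>auto simp: B''_def\<close>)
  show ?thesis
    unfolding extend_C1_def[abs_def]
  proof (rule in_sobolev_2I[OF integrable_majorant V[unfolded B_def] V' V''])
    show "weakly_differentiable (\<lambda>x. if half_sq x < x$1 then f (x$1) else f (half_sq x) + g (half_sq x) * (x$1 - half_sq x)) i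
        (\<lambda>x. if half_sq x < x$1 then A' i x else B' i x)" for i
    proof (rule weakly_differentiable_piecewise[OF V[unfolded B_def] V'])
      fix x :: "real^3" and r
      show "((\<lambda>r. f ((x + r *\<^sub>R axis i 1) $ 1)) has_real_derivative A' i (x + r *\<^sub>R axis i 1)) (at r)"
        if "0 < (x + r *\<^sub>R axis i 1) $ 1"
        using DERIV_chain2[OF der(1)[OF that] component_line] by (auto simp: A'_def d_def)
      let ?l = "x + r *\<^sub>R axis i 1"
      assume s: "0 < half_sq ?l"
      show "((\<lambda>r. f (half_sq (x + r *\<^sub>R axis i 1)) + g (half_sq (x + r *\<^sub>R axis i 1)) * ((x + r *\<^sub>R axis i 1)$1 - half_sq (x + r *\<^sub>R axis i 1)))
          has_real_derivative B' i ?l) (at r)"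
        by (rule DERIV_cong[OF DERIV_add[OF DERIV_chain2[OF der(1)[OF s] half_sq_line]
              DERIV_mult[OF DERIV_chain2[OF der(2)[OF s] half_sq_line] DERIV_diff[OF component_line half_sq_line]]]])
           (simp add: B'_def d_def algebra_simps)
    qed simp
    show "weakly_differentiable (\<lambda>x. if half_sq x < x$1 then A' i x else B' i x) j
        (\<lambda>x. if half_sq x < x$1 then A'' i j x else B'' i j x)" for i j
    proof (rule weakly_differentiable_piecewise[OF V' V''])
      fix x :: "real^3" and r
      let ?l = "x + r *\<^sub>R axis j 1"
      show "((\<lambda>r. A' i (x + r *\<^sub>R axis j 1)) has_real_derivative A'' i j ?l) (at r)"
        if "0 < (x + r *\<^sub>R axis j 1) $ 1"
        unfolding A'_def
        by (rule DERIV_cong[OF DERIV_cmult[OF DERIV_chain2[OF der(2)[OF that] component_line]]])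
           (simp add: A''_def d_def)
      assume s: "0 < half_sq ?l"
      show "((\<lambda>r. B' i (x + r *\<^sub>R axis j 1)) has_real_derivative B'' i j ?l) (at r)"
        unfolding B'_def
        by (rule DERIV_cong[OF DERIV_add[OF DERIV_cmult[OF DERIV_chain2[OF der(2)[OF s] half_sq_line]]
              DERIV_mult[OF DERIV_mult[OF DERIV_chain2[OF der(3)[OF s] half_sq_line] component_line]
                DERIV_diff[OF component_line half_sq_line]]]])
           (simp add: B''_def d_def algebra_simps)
    qed (simp add: A'_def B'_def)
  qed
qed

section \<open>Lower bounds for weak second derivatives\<close>

lemma ennreal_integral_le_nn_integral:
  fixes f :: "'a \<Rightarrow> real"
  assumes "integrable M f"
  shows "ennreal (\<integral>x. f x \<partial>M) \<le> (\<integral>\<^sup>+x. ennreal (f x) \<partial>M)"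
proof -
  have "(\<integral>x. f x \<partial>M) \<le> (\<integral>x. max 0 (f x) \<partial>M)"
    using assms by (intro integral_mono) auto
  then have "ennreal (\<integral>x. f x \<partial>M) \<le> ennreal (\<integral>x. max 0 (f x) \<partial>M)" by (rule ennreal_leI)
  also have "\<dots> = (\<integral>\<^sup>+x. ennreal (max 0 (f x)) \<partial>M)"
    using assms by (intro nn_integral_eq_integral[symmetric]) auto
  also have "\<dots> = (\<integral>\<^sup>+x. ennreal (f x) \<partial>M)"
    by (intro nn_integral_cong) (auto simp: max_def ennreal_neg)
  finally show ?thesis .
qed

text \<open>Both integrations by parts are done at once: \<open>?\<psi>\<close> below has derivative
  \<open>?\<Psi>\<close>, since the products of first derivatives cancel. The singularity of
  \<open>p\<close> at 0 is never met because everything vanishes off a compact subset of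
  \<open>U\<close>.\<close>

lemma integral_second_derivative_by_parts:
  fixes p p' p'' :: "real \<Rightarrow> real"
  assumes U: "open U" "\<And>x. x \<in> U \<Longrightarrow> t < x$1" and \<eta>: "test_function U \<eta>"
    and [measurable]: "p \<in> borel_measurable borel" "p' \<in> borel_measurable borel" "p'' \<in> borel_measurable borel"
    and der: "\<And>u. u > 0 \<Longrightarrow> (p has_real_derivative p' u) (at u)" "\<And>u. u > 0 \<Longrightarrow> (p' has_real_derivative p'' u) (at u)"
    and cont: "continuous_on {0<..} p''"
  shows "(\<integral>x. partial 1 (partial 1 \<eta>) x * p (x$1 - t) \<partial>lebesgue) = (\<integral>x. \<eta> x * p'' (x$1 - t) \<partial>lebesgue)"
    and "integrable lebesgue (\<lambda>x. \<eta> x * p'' (x$1 - t))"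
proof -
  let ?\<eta>1 = "partial 1 \<eta>" and ?\<eta>2 = "partial 1 (partial 1 \<eta>)"
  have t1: "test_function U ?\<eta>1" by (rule test_function_partial[OF \<eta>])
  have t2: "test_function U ?\<eta>2" by (rule test_function_partial[OF t1])
  obtain K where K: "compact K" "K \<subseteq> U" "\<And>x. x \<notin> K \<Longrightarrow> \<eta> x = 0"
    using \<eta> unfolding test_function_def by blast
  have K1: "?\<eta>1 x = 0" if "x \<notin> K" for x
    by (rule partial_eq_0_outside[OF compact_imp_closed[OF K(1)] K(3) that])
  have K2: "?\<eta>2 x = 0" if "x \<notin> K" for x
    by (rule partial_eq_0_outside[OF compact_imp_closed[OF K(1)] K1 that])
  have [measurable]: "\<eta> \<in> borel_measurable borel" "?\<eta>1 \<in> borel_measurable borel" "?\<eta>2 \<in> borel_measurable borel"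
    by (intro borel_measurable_continuous_onI test_function_continuous[OF \<eta>] test_function_continuous[OF t1]
        test_function_continuous[OF t2])+
  have c: "continuous_on {0<..} p" "continuous_on {0<..} p'"
    using der by (auto intro!: continuous_at_imp_continuous_on DERIV_isCont)
  have loc: "locally_integrable_on (\<lambda>x. k (x$1 - t)) U" if "continuous_on {0<..} k" for k :: "real \<Rightarrow> real"
    by (rule continuous_on_locally_integrable, rule continuous_on_compose2[OF that])
       (use U(2) in \<open>auto intro!: continuous_intros\<close>)
  have i: "integrable lebesgue (\<lambda>x. \<eta> x * p' (x$1 - t))" "integrable lebesgue (\<lambda>x. ?\<eta>1 x * p (x$1 - t))"
    "integrable lebesgue (\<lambda>x. ?\<eta>2 x * p (x$1 - t))"
    by (intro integrable_test_function_mult[where U = U] \<eta> t1 t2 loc c cont)+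
  show i': "integrable lebesgue (\<lambda>x. \<eta> x * p'' (x$1 - t))"
    by (intro integrable_test_function_mult[where U = U] \<eta> loc cont)
  have ib: "integrable lborel (\<lambda>x. \<eta> x * p' (x$1 - t))" "integrable lborel (\<lambda>x. ?\<eta>1 x * p (x$1 - t))"
    "integrable lborel (\<lambda>x. ?\<eta>2 x * p (x$1 - t))" "integrable lborel (\<lambda>x. \<eta> x * p'' (x$1 - t))"
    using i i' by (simp_all add: integrable_completion)
  let ?v = "axis 1 1 :: real^3"
  let ?\<psi> = "\<lambda>x. ?\<eta>1 x * p (x$1 - t) - \<eta> x * p' (x$1 - t)"
  let ?\<Psi> = "\<lambda>x. ?\<eta>2 x * p (x$1 - t) - \<eta> x * p'' (x$1 - t)"
  have D: "((\<lambda>r. ?\<psi> (x + r *\<^sub>R ?v)) has_real_derivative ?\<Psi> (x + r *\<^sub>R ?v)) (at r)" for x r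
  proof (cases "x + r *\<^sub>R ?v \<in> K")
    case True
    then have u: "(x + r *\<^sub>R ?v)$1 - t > 0" using K(2) U(2)[of "x + r *\<^sub>R ?v"] by auto
    have l: "((\<lambda>r. (x + r *\<^sub>R ?v)$1 - t) has_real_derivative 1) (at r)"
      by (rule DERIV_cong[OF DERIV_diff[OF component_line DERIV_const]]) simp
    show ?thesis
      by (rule DERIV_cong[OF DERIV_diff[OF
            DERIV_mult[OF test_function_line_derivative[OF t1] DERIV_chain2[OF der(1)[OF u] l]]
            DERIV_mult[OF test_function_line_derivative[OF \<eta>] DERIV_chain2[OF der(2)[OF u] l]]]])
         (simp add: algebra_simps)
  next
    case False
    have "open ((\<lambda>r. x + r *\<^sub>R ?v) -` (- K))"
      by (intro open_vimage open_Compl compact_imp_closed K continuous_intros)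
    then have "((\<lambda>r. ?\<psi> (x + r *\<^sub>R ?v)) has_real_derivative 0) (at r)"
      using False K(3) K1
      by (intro has_field_derivative_transform_within_open[OF DERIV_const, of _ r 0]) auto
    then show ?thesis using K(3)[OF False] K2[OF False] by simp
  qed
  have "(\<integral>x. ?\<Psi> x \<partial>lborel) = 0"
  proof (rule integral_directional_derivative_eq_0[where v = ?v])
    show "integrable lborel ?\<psi>" "integrable lborel ?\<Psi>" using ib by auto
    show "AE x in lborel. \<exists>S. finite S \<and> continuous_on {0..1} (\<lambda>r. ?\<psi> (x + r *\<^sub>R ?v)) \<and>
      (\<forall>r\<in>{0<..<1} - S. ((\<lambda>r. ?\<psi> (x + r *\<^sub>R ?v)) has_real_derivative ?\<Psi> (x + r *\<^sub>R ?v)) (at r))"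
      by (intro AE_I2 exI[of _ "{}"] conjI ballI D finite.emptyI continuous_at_imp_continuous_on DERIV_isCont[OF D])
  qed
  then have "(\<integral>x. ?\<eta>2 x * p (x$1 - t) \<partial>lborel) = (\<integral>x. \<eta> x * p'' (x$1 - t) \<partial>lborel)"
    using ib by simp
  then show "(\<integral>x. ?\<eta>2 x * p (x$1 - t) \<partial>lebesgue) = (\<integral>x. \<eta> x * p'' (x$1 - t) \<partial>lebesgue)"
    by (simp add: integral_completion)
qed

section \<open>Slices of the cone and cut-off functions exhausting them\<close>

definition cone_defect :: "real \<Rightarrow> real^3 \<Rightarrow> real" where
  "cone_defect t x = (1 - t)\<^sup>2 - ((x$1 - 1)\<^sup>2 + (x$2)\<^sup>2 + (x$3)\<^sup>2)"

lemma coneD_slice_eq: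
  assumes "0 \<le> t" "t < 1"
  shows "coneD_slice t = {x. cone_defect t x > 0}"
  using assms by (auto simp: coneD_slice_def coneD_def cone_defect_def)

lemma Ck_on_component: "Ck_on k (\<lambda>x :: real^3. x $ i) U"
  by (rule Ck_on_linear) (rule bounded_linear_vec_nth)

lemma Ck_on_cone_defect: "Ck_on k (cone_defect t) UNIV"
proof -
  have eq: "cone_defect t = (\<lambda>x. (1 - t)\<^sup>2 + (-1) * (((x$1 + (-1)) * (x$1 + (-1)) + x$2 * x$2) + x$3 * x$3))"
    by (auto simp: cone_defect_def power2_eq_square algebra_simps)
  show ?thesis unfolding eq
    by (intro Ck_on_add Ck_on_mult Ck_on_const Ck_on_component open_UNIV)
qed

lemma continuous_on_cone_defect: "continuous_on A (cone_defect t)"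
  using Ck_on_cone_defect[of 0 t] continuous_on_subset by auto

lemma open_coneD_slice: "0 \<le> t \<Longrightarrow> t < 1 \<Longrightarrow> open (coneD_slice t)"
  by (simp add: coneD_slice_eq open_Collect_less continuous_on_cone_defect)

lemma coneD_slice_bounds:
  assumes "0 \<le> t" "t < 1" "x \<in> coneD_slice t"
  shows "t < x$1" "x$1 < 2"
proof -
  have "(x$1 - 1)\<^sup>2 < (1 - t)\<^sup>2"
    using assms(3) zero_le_power2[of "x$2"] zero_le_power2[of "x$3"]
    unfolding coneD_slice_eq[OF assms(1,2)] cone_defect_def mem_Collect_eq by linarith
  then have "\<bar>x$1 - 1\<bar> < \<bar>1 - t\<bar>" using power2_less_imp_less[of "\<bar>x$1 - 1\<bar>" "\<bar>1 - t\<bar>"] by simp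
  then show "t < x$1" "x$1 < 2" using assms(1,2) by auto
qed

lemma compact_cone_defect_superlevel: "compact {x. c \<le> cone_defect t x}"
proof -
  have "closed {x. c \<le> cone_defect t x}"
    by (intro closed_Collect_le continuous_on_const continuous_on_cone_defect)
  moreover have "bounded {x. c \<le> cone_defect t x}"
  proof (rule bounded_subset[OF bounded_cball])
    show "{x. c \<le> cone_defect t x} \<subseteq> cball (axis 1 1) (sqrt ((1 - t)\<^sup>2 - c))"
    proof
      fix x assume "x \<in> {x. c \<le> cone_defect t x}"
      then have "(norm (axis 1 1 - x))\<^sup>2 \<le> (1 - t)\<^sup>2 - c"
        unfolding cone_defect_def power2_norm_eq_inner inner_vec_def sum_3
        by (simp add: axis_def power2_eq_square algebra_simps)
      then show "x \<in> cball (axis 1 1) (sqrt ((1 - t)\<^sup>2 - c))"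
        by (simp add: dist_norm real_le_rsqrt)
    qed
  qed
  ultimately show ?thesis by (simp add: compact_eq_bounded_closed)
qed

text \<open>The classical exp (-1 / y) at \<open>y = n * cone_defect t x - 1\<close>. It vanishes
  unless \<open>cone_defect t x > 1 / n\<close>, a region with compact closure in the slice, and
  needs no normalization since it tends to 1 as y grows.\<close>

definition cone_cutoff :: "real \<Rightarrow> nat \<Rightarrow> real^3 \<Rightarrow> real" where
  "cone_cutoff t n x = flat_powr 0 (real n * cone_defect t x - 1)"

lemma cone_cutoff_bounds: "0 \<le> cone_cutoff t n x" "cone_cutoff t n x \<le> 1"
  by (auto simp: cone_cutoff_def flat_powr_def)

lemma cone_cutoff_tendsto:
  assumes "cone_defect t x > 0"
  shows "(\<lambda>n. cone_cutoff t n x) \<longlonglongrightarrow> 1"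
proof -
  let ?d = "cone_defect t x"
  have "(\<lambda>n. exp (- 1 / (real n * ?d - 1))) \<longlonglongrightarrow> 1" using assms by real_asymp
  moreover have "eventually (\<lambda>n. exp (- 1 / (real n * ?d - 1)) = cone_cutoff t n x) sequentially"
  proof -
    have "eventually (\<lambda>n. real n > 1 / ?d) sequentially" by real_asymp
    then show ?thesis
      by eventually_elim (use assms in \<open>auto simp: cone_cutoff_def flat_powr_def field_simps\<close>)
  qed
  ultimately show ?thesis by (rule Lim_transform_eventually)
qed

lemma Ck_on_cone_cutoff: "Ck_on k (cone_cutoff t n) UNIV"
proof -
  have "Ck_on k (\<lambda>x. flat_powr 0 (real n * cone_defect t x + (- 1))) UNIV"
    by (intro Ck_on_compose[OF _ _ _ _ Ck_on_flat_powr] Ck_on_add Ck_on_mult Ck_on_const Ck_on_cone_defect open_UNIV) auto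
  then show ?thesis by (simp add: cone_cutoff_def[abs_def])
qed

text \<open>Here \<open>q\<close> is smooth only for positive arguments. The product is smooth on
  the open slice and zero on the complement of the compact \<open>K\<close>, and these two open sets
  cover the space.\<close>

lemma test_function_cutoff_mult:
  assumes t: "0 \<le> t" "t < 1" and q: "\<And>k. Ck_on k q {0<..}"
  shows "test_function (coneD_slice t) (\<lambda>x. cone_cutoff t n x * q (x$1 - t))"
proof (cases "n = 0")
  case True
  then have "(\<lambda>x. cone_cutoff t n x * q (x$1 - t)) = (\<lambda>x. 0)"
    by (auto simp: cone_cutoff_def flat_powr_def)
  then show ?thesis by (auto simp: test_function_def smooth_on_UNIV_iff Ck_on_const intro!: exI[of _ "{}"])
next
  case False
  define K where "K = {x. 1 / real n \<le> cone_defect t x}"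
  let ?U = "coneD_slice t"
  have K: "compact K" unfolding K_def by (rule compact_cone_defect_superlevel)
  have KU: "K \<subseteq> ?U" using False by (auto simp: K_def coneD_slice_eq[OF t] intro: less_le_trans[of 0 "1 / real n"])
  have zero: "cone_cutoff t n x * q (x$1 - t) = 0" if "x \<notin> K" for x
    using that False by (auto simp: K_def cone_cutoff_def flat_powr_def field_simps)
  have "Ck_on k (\<lambda>x. cone_cutoff t n x * q (x$1 - t)) UNIV" for k
  proof -
    have o: "open ?U" by (rule open_coneD_slice[OF t])
    have lin: "Ck_on k (\<lambda>x. x$1 + (- t)) ?U"
      by (intro Ck_on_add Ck_on_const Ck_on_component o)
    have "Ck_on k (\<lambda>x. q (x$1 + (- t))) ?U"
      by (rule Ck_on_compose[OF o _ _ lin q]) (use coneD_slice_bounds[OF t] in auto)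
    then have "Ck_on k (\<lambda>x. cone_cutoff t n x * q (x$1 - t)) ?U"
      by (intro Ck_on_mult o Ck_on_mono[OF Ck_on_cone_cutoff]) auto
    moreover have "Ck_on k (\<lambda>x. cone_cutoff t n x * q (x$1 - t)) (- K)"
      by (rule Ck_on_cong[OF _ Ck_on_const[of _ 0]]) (use K zero in \<open>auto simp: compact_imp_closed open_Compl\<close>)
    ultimately have "Ck_on k (\<lambda>x. cone_cutoff t n x * q (x$1 - t)) (?U \<union> - K)"
      using K by (intro Ck_on_union o) (auto simp: compact_imp_closed open_Compl)
    moreover have "?U \<union> - K = UNIV" using KU by auto
    ultimately show ?thesis by simp
  qed
  then show ?thesis
    unfolding test_function_def smooth_on_UNIV_iff using K KU zero by blast
qed

text \<open>Testing the weak derivative \<open>g\<close> with a cut-off of the classical derivative \<open>p''\<close> itself bounds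
  the \<open>L\<^sup>2\<close> norm of the latter; this replaces uniqueness of weak derivatives.\<close>

lemma weak_second_derivative_lower_bound:
  fixes p p' p'' :: "real \<Rightarrow> real"
  assumes t: "0 \<le> t" "t < 1"
    and [measurable]: "p \<in> borel_measurable borel" "p' \<in> borel_measurable borel" "p'' \<in> borel_measurable borel"
    and der: "\<And>u. u > 0 \<Longrightarrow> (p has_real_derivative p' u) (at u)" "\<And>u. u > 0 \<Longrightarrow> (p' has_real_derivative p'' u) (at u)"
    and ck: "\<And>k. Ck_on k p'' {0<..}"
    and w: "has_weak_partial (\<lambda>i. if i = 1 then 2 else 0) (coneD_slice t) (\<lambda>x. (f1 x, p (x$1 - t))) g"
  shows "(\<integral>\<^sup>+x. ennreal ((p'' (x$1 - t))\<^sup>2) \<partial>lebesgue_on (coneD_slice t)) \<le>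
    (\<integral>\<^sup>+x. ennreal ((norm (g x))\<^sup>2) \<partial>lebesgue_on (coneD_slice t))"
proof -
  let ?U = "coneD_slice t"
  let ?\<alpha> = "\<lambda>i :: 3. if i = 1 then 2 else 0 :: nat"
  have o: "open ?U" by (rule open_coneD_slice[OF t])
  have cont: "continuous_on {0<..} p''" using ck[of 0] by simp
  define \<eta> where "\<eta> = (\<lambda>n x. cone_cutoff t n x * p'' (x$1 - t))"
  have \<eta>: "test_function ?U (\<eta> n)" for n
    unfolding \<eta>_def by (rule test_function_cutoff_mult[OF t ck])
  have [measurable]: "\<eta> n \<in> borel_measurable borel" for n
    by (intro borel_measurable_continuous_onI test_function_continuous[OF \<eta>])
  have mp: "multi_partial ?\<alpha> \<zeta> = partial 1 (partial 1 \<zeta>)" for \<zeta>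
    by (simp add: multi_partial_def numeral_2_eq_2)
  have le: "(\<integral>\<^sup>+x. ennreal (\<eta> n x * p'' (x$1 - t)) \<partial>lebesgue_on ?U) \<le> (\<integral>\<^sup>+x. ennreal ((norm (g x))\<^sup>2) \<partial>lebesgue_on ?U)" for n
  proof -
    have loc: "locally_integrable_on (\<lambda>x. (f1 x, p (x$1 - t))) ?U" "locally_integrable_on g ?U"
      using w by (auto simp: has_weak_partial_def)
    note t2 = test_function_partial[OF test_function_partial[OF \<eta>], of 1 1 n]
    have i1: "integrable lebesgue (\<lambda>x. partial 1 (partial 1 (\<eta> n)) x *\<^sub>R (f1 x, p (x$1 - t)))"
      by (rule integrable_test_function_scaleR[OF t2 loc(1)])
    have i2: "integrable lebesgue (\<lambda>x. \<eta> n x *\<^sub>R g x)"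
      by (rule integrable_test_function_scaleR[OF \<eta> loc(2)])
    have "(\<integral>x. partial 1 (partial 1 (\<eta> n)) x *\<^sub>R (f1 x, p (x$1 - t)) \<partial>lebesgue_on ?U) = (\<integral>x. \<eta> n x *\<^sub>R g x \<partial>lebesgue_on ?U)"
      using w \<eta>[of n] by (simp add: has_weak_partial_def mp sum_3)
    moreover have "(\<integral>x. partial 1 (partial 1 (\<eta> n)) x *\<^sub>R (f1 x, p (x$1 - t)) \<partial>lebesgue_on ?U) =
        (\<integral>x. partial 1 (partial 1 (\<eta> n)) x *\<^sub>R (f1 x, p (x$1 - t)) \<partial>lebesgue)"
      by (rule integral_lebesgue_on_open[OF o]) (simp add: test_function_eq_0[OF t2] zero_prod_def)
    moreover have "(\<integral>x. \<eta> n x *\<^sub>R g x \<partial>lebesgue_on ?U) = (\<integral>x. \<eta> n x *\<^sub>R g x \<partial>lebesgue)"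
      by (rule integral_lebesgue_on_open[OF o]) (simp add: test_function_eq_0[OF \<eta>])
    ultimately have "snd (\<integral>x. partial 1 (partial 1 (\<eta> n)) x *\<^sub>R (f1 x, p (x$1 - t)) \<partial>lebesgue) = snd (\<integral>x. \<eta> n x *\<^sub>R g x \<partial>lebesgue)"
      by simp
    then have "(\<integral>x. partial 1 (partial 1 (\<eta> n)) x * p (x$1 - t) \<partial>lebesgue) = (\<integral>x. \<eta> n x * snd (g x) \<partial>lebesgue)"
      using integral_bounded_linear[OF bounded_linear_snd i1] integral_bounded_linear[OF bounded_linear_snd i2] by simp
    moreover have parts: "(\<integral>x. partial 1 (partial 1 (\<eta> n)) x * p (x$1 - t) \<partial>lebesgue) = (\<integral>x. \<eta> n x * p'' (x$1 - t) \<partial>lebesgue)"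
      and i3: "integrable lebesgue (\<lambda>x. \<eta> n x * p'' (x$1 - t))"
      by (rule integral_second_derivative_by_parts[OF o coneD_slice_bounds(1)[OF t] \<eta> _ _ _ der cont]; simp)+
    moreover have i4: "integrable lebesgue (\<lambda>x. \<eta> n x * snd (g x))"
      using integrable_bounded_linear[OF bounded_linear_snd i2] by simp
    \<comment> \<open>Let P be the integral of \<open>\<eta> n x * p'' (x$1 - t)\<close>. The weak
      identity says that P is also the integral of \<open>\<eta> n x * snd (g x)\<close>, so P is
      twice the latter minus P. Pointwise \<open>2 * \<eta> * g2 <= \<eta>^2 + g2^2\<close> with
      \<open>g2 = snd (g x)\<close>, and \<open>\<eta>^2 <= \<eta> * p''\<close>; the terms with
      \<open>p''\<close> cancel and P is at most the integral of \<open>g2^2\<close>.\<close>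
    ultimately have eq: "(\<integral>x. 2 * (\<eta> n x * snd (g x)) - \<eta> n x * p'' (x$1 - t) \<partial>lebesgue) = (\<integral>x. \<eta> n x * p'' (x$1 - t) \<partial>lebesgue)"
      by simp
    have nn: "0 \<le> \<eta> n x * p'' (x$1 - t)" for x
      by (simp add: \<eta>_def cone_cutoff_bounds mult.assoc)
    have outside: "\<eta> n x = 0" if "x \<notin> ?U" for x using test_function_eq_0[OF \<eta> that] .
    have "(\<integral>\<^sup>+x. ennreal (\<eta> n x * p'' (x$1 - t)) \<partial>lebesgue_on ?U) = (\<integral>\<^sup>+x. ennreal (\<eta> n x * p'' (x$1 - t)) \<partial>lebesgue)"
      using o by (subst nn_integral_restrict_space) (auto intro!: nn_integral_cong simp: outside indicator_def)
    also have "\<dots> = ennreal (\<integral>x. \<eta> n x * p'' (x$1 - t) \<partial>lebesgue)"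
      using i3 nn by (intro nn_integral_eq_integral) auto
    also have "\<dots> = ennreal (\<integral>x. 2 * (\<eta> n x * snd (g x)) - \<eta> n x * p'' (x$1 - t) \<partial>lebesgue)"
      by (simp only: eq)
    also have "\<dots> \<le> (\<integral>\<^sup>+x. ennreal (2 * (\<eta> n x * snd (g x)) - \<eta> n x * p'' (x$1 - t)) \<partial>lebesgue)"
      using i3 i4 by (intro ennreal_integral_le_nn_integral) auto
    also have "\<dots> \<le> (\<integral>\<^sup>+x. ennreal ((norm (g x))\<^sup>2) * indicator ?U x \<partial>lebesgue)"
    proof (intro nn_integral_mono)
      fix x
      show "ennreal (2 * (\<eta> n x * snd (g x)) - \<eta> n x * p'' (x$1 - t)) \<le> ennreal ((norm (g x))\<^sup>2) * indicator ?U x"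
      proof (cases "x \<in> ?U")
        case True
        have "(\<eta> n x)\<^sup>2 = cone_cutoff t n x * (\<eta> n x * p'' (x$1 - t))"
          by (simp add: \<eta>_def power2_eq_square)
        also have "\<dots> \<le> \<eta> n x * p'' (x$1 - t)"
          using nn[of x] cone_cutoff_bounds[of t n x] by (intro mult_left_le_one_le)
        finally have "(\<eta> n x)\<^sup>2 \<le> \<eta> n x * p'' (x$1 - t)" .
        moreover have "2 * (\<eta> n x * snd (g x)) \<le> (\<eta> n x)\<^sup>2 + (snd (g x))\<^sup>2"
          using sum_squares_bound[of "\<eta> n x" "snd (g x)"] by simp
        moreover have "(snd (g x))\<^sup>2 \<le> (norm (g x))\<^sup>2" by (cases "g x") (simp add: norm_Pair)
        ultimately show ?thesis using True by (auto intro!: ennreal_leI)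
      qed (simp add: outside)
    qed
    also have "\<dots> = (\<integral>\<^sup>+x. ennreal ((norm (g x))\<^sup>2) \<partial>lebesgue_on ?U)"
      using o by (subst nn_integral_restrict_space) auto
    finally show ?thesis .
  qed
  have lim: "(\<lambda>n. ennreal (\<eta> n x * p'' (x$1 - t))) \<longlonglongrightarrow> ennreal ((p'' (x$1 - t))\<^sup>2)" if "x \<in> ?U" for x
  proof -
    have "(\<lambda>n. cone_cutoff t n x * p'' (x$1 - t) * p'' (x$1 - t)) \<longlonglongrightarrow> 1 * p'' (x$1 - t) * p'' (x$1 - t)"
      using that by (intro tendsto_mult tendsto_const cone_cutoff_tendsto) (simp add: coneD_slice_eq[OF t])
    then show ?thesis unfolding \<eta>_def by (intro tendsto_ennrealI) (simp add: power2_eq_square)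
  qed
  \<comment> \<open>Fatou's lemma removes the cut-off.\<close>
  have "(\<integral>\<^sup>+x. ennreal ((p'' (x$1 - t))\<^sup>2) \<partial>lebesgue_on ?U) = (\<integral>\<^sup>+x. liminf (\<lambda>n. ennreal (\<eta> n x * p'' (x$1 - t))) \<partial>lebesgue_on ?U)"
    using lim by (intro nn_integral_cong) (auto intro!: lim_imp_Liminf[symmetric])
  also have "\<dots> \<le> liminf (\<lambda>n. \<integral>\<^sup>+x. ennreal (\<eta> n x * p'' (x$1 - t)) \<partial>lebesgue_on ?U)"
  proof (rule nn_integral_liminf)
    fix n
    have "(\<lambda>x. ennreal (\<eta> n x * p'' (x$1 - t))) \<in> borel_measurable borel" by measurable
    then have "(\<lambda>x. ennreal (\<eta> n x * p'' (x$1 - t))) \<in> borel_measurable lebesgue" by (auto intro: measurable_completion)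
    then show "(\<lambda>x. ennreal (\<eta> n x * p'' (x$1 - t))) \<in> borel_measurable (lebesgue_on ?U)"
      by (rule measurable_restrict_space1)
  qed
  also have "\<dots> \<le> (\<integral>\<^sup>+x. ennreal ((norm (g x))\<^sup>2) \<partial>lebesgue_on ?U)"
    using le by (intro Liminf_le) auto
  finally show ?thesis .
qed

section \<open>Blow-up\<close>

lemma profile_product_lower_bound:
  assumes u: "u > 0" and y: "ln 4 - ln u \<ge> 1"
  shows "exp (-4) / (16 * (ln 4 - ln u) * u\<^sup>2) \<le> (profile u * profile1 u)\<^sup>2"
proof -
  define y where "y = ln 4 - ln u"
  have y: "y \<ge> 1" using assms(2) by (simp add: y_def)
  have e: "exp (- 1) \<le> exp (- 1 / y)" using y by (simp add: field_simps)
  have "1/4 * (y powr (-3/4) * exp (- 1)) \<le> flat1 y"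
  proof -
    have "y powr (-3/4) * exp (- 1) \<le> flat_powr (-3/4) y"
      using e y by (auto simp: flat_powr_def intro!: mult_left_mono)
    then show ?thesis using flat_powr_nonneg[of "-7/4" y] by (simp add: flat1_def)
  qed
  moreover have "y powr (1/4) * exp (- 1) \<le> profile u"
    using e y unfolding profile_def y_def[symmetric] by (auto simp: flat_powr_def intro!: mult_left_mono)
  ultimately have "(y powr (1/4) * exp (- 1)) * (1/4 * (y powr (-3/4) * exp (- 1))) \<le> profile u * flat1 y"
    by (intro mult_mono) (auto simp: profile_def flat_powr_nonneg)
  moreover have "(y powr (1/4) * exp (- 1)) * (1/4 * (y powr (-3/4) * exp (- 1))) = exp (- 2) * y powr (-1/2) / 4"
  proof -
    have "y powr (1/4) * y powr (-3/4) = y powr (-1/2)" by (simp flip: powr_add)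
    moreover have "exp (- 1) * exp (- 1) = exp (- 2 :: real)" by (simp flip: exp_add)
    ultimately show ?thesis by (simp add: ac_simps)
  qed
  ultimately have "(exp (- 2) * y powr (-1/2) / 4)\<^sup>2 \<le> (profile u * flat1 y)\<^sup>2"
    by (intro power_mono) auto
  moreover have "(exp (- 2) * y powr (-1/2) / 4)\<^sup>2 = exp (-4) / (16 * y)"
  proof -
    have "(exp (- 2 :: real))\<^sup>2 = exp (-4)" by (simp flip: exp_of_nat_mult)
    then show ?thesis using y by (simp add: power_divide power_mult_distrib powr_square powr_minus_divide)
  qed
  ultimately have "exp (-4) / (16 * y) / u\<^sup>2 \<le> (profile u * flat1 y)\<^sup>2 / u\<^sup>2"
    by (intro divide_right_mono) auto
  then show ?thesis
    unfolding profile1_def y_def[symmetric] by (simp add: power_divide power_mult_distrib)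
qed

text \<open>Disjoint boxes at height of order 2^-k above the tangent plane have volume of order
  4^-k, and there the integrand is at least of order 4^k / (k + 1). The lower bounds add up to a
  multiple of a tail of the harmonic series.\<close>

lemma nn_integral_profile_product_infinite:
  assumes t: "0 \<le> t" "t < 1" and c: "c \<noteq> 0"
  shows "(\<integral>\<^sup>+x. ennreal ((c * (profile (x$1 - t) * profile1 (x$1 - t)))\<^sup>2) \<partial>lebesgue_on (coneD_slice t)) = \<infinity>"
proof -
  define R where "R = 1 - t"
  have R: "R > 0" using t by (simp add: R_def)
  obtain m where "(1/2::real) ^ m < R / 4" using real_arch_pow_inv[of "R/4" "1/2"] R by auto
  \<comment> \<open>Beyond \<open>m\<close> the boxes are low enough to fit in the ball; the extra 2
    ensures \<open>4 * (1/2)^k <= 1\<close>, hence \<open>u <= 1\<close> and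
    \<open>ln 4 - ln u >= 1\<close>.\<close>
  define N where "N = m + 2"
  have N: "4 * (1/2::real) ^ k < R" if "k \<ge> N" for k
  proof -
    have "(1/2::real) ^ k \<le> (1/2) ^ m" using that by (intro power_decreasing) (auto simp: N_def)
    then show ?thesis using \<open>(1/2::real) ^ m < R / 4\<close> by linarith
  qed
  \<comment> \<open>Membership in the slice means
    \<open>u^2 + (x $ 2)^2 + (x $ 3)^2 < 2 * R * u\<close>. Here \<open>u < R\<close> bounds the
    first term by \<open>R * u\<close>, and the other two are at most \<open>R * u / 3\<close>
    each.\<close>
  define r where "r = (\<lambda>k::nat. sqrt (R * (1/2)^k))"
  \<comment> \<open>Heights between 3 and 4 times 2^-k keep the boxes apart: the next one ends at 2
    times 2^-k.\<close>
  define A where "A = (\<lambda>k::nat. {x :: real^3. t + 3 * (1/2)^k \<le> x$1 \<and> x$1 \<le> t + 4 * (1/2)^k \<and>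
     - r k \<le> x$2 \<and> x$2 \<le> r k \<and> - r k \<le> x$3 \<and> x$3 \<le> r k})"
  \<comment> \<open>The number 256 is 16 from the lower bound for the product times 4^2 from
    \<open>u <= 4 * (1/2)^k\<close>.\<close>
  define v where "v = (\<lambda>k::nat. c\<^sup>2 * exp (-4) * 4 ^ k / (256 * (real k + 1)))"
  have r: "- r k \<le> r k" "r k * r k = R * (1/2)^k" "t + 3 * (1/2)^k \<le> t + 4 * (1/2)^k" for k
    using R by (auto simp: r_def)
  have Am: "A k \<in> sets borel" for k
    unfolding A_def by (rule emeasure_box3(2)[OF r(3) r(1) r(1)])
  have Ae: "emeasure lborel (A k) = ennreal (4 * R * (1/4)^k)" for k
  proof -
    have "(t + 4 * (1/2)^k - (t + 3 * (1/2)^k)) * (r k - - r k) * (r k - - r k) = (1/2)^k * 4 * (r k * r k)" by (simp add: algebra_simps)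
    also have "\<dots> = 4 * R * ((1/2)^k * (1/2)^k)" unfolding r by simp
    also have "\<dots> = 4 * R * (1/4)^k" by (simp add: power_mult_distrib[symmetric])
    finally show ?thesis unfolding A_def emeasure_box3(1)[OF r(3) r(1) r(1)] by (rule arg_cong)
  qed
  have disj: "disjoint_family (\<lambda>n. A (N + n))"
  proof -
    have "A i \<inter> A j = {}" if "i < j" for i j
    proof -
      have "(1/2::real)^j \<le> (1/2)^(Suc i)" using that by (intro power_decreasing) auto
      moreover have "(1/2::real)^i > 0" by simp
      ultimately have "4 * (1/2::real)^j < 3 * (1/2)^i" unfolding power_Suc by linarith
      then show ?thesis by (auto simp: A_def)
    qed
    then show ?thesis unfolding disjoint_family_on_def
      by (metis Int_commute add_left_cancel linorder_neq_iff)
  qed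
  have inA: "x \<in> coneD_slice t \<and> v k \<le> (c * (profile (x$1 - t) * profile1 (x$1 - t)))\<^sup>2"
    if "x \<in> A k" "k \<ge> N" for x k
  proof
    define u where "u = x$1 - t"
    define h where "h = (1/2::real)^k"
    have h: "h > 0" "4 * h < R" using N[OF that(2)] by (auto simp: h_def)
    have u: "3 * h \<le> u" "u \<le> 4 * h" using that(1) by (auto simp: A_def u_def h_def)
    then have u0: "u > 0" using h by linarith
    have b: "(x$i)\<^sup>2 \<le> R * h" if "\<bar>x$i\<bar> \<le> r k" for i
    proof -
      have "\<bar>x$i\<bar> * \<bar>x$i\<bar> \<le> r k * r k" using that by (intro mult_mono) auto
      then show ?thesis by (simp add: r h_def power2_eq_square)
    qed
    have "(x$2)\<^sup>2 \<le> R * h" "(x$3)\<^sup>2 \<le> R * h" using that(1) by (auto intro!: b simp: A_def abs_le_iff)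
    moreover have "R * h \<le> R * (u / 3)" using u R by (intro mult_left_mono) auto
    moreover have "u * u < R * u" using u u0 h by (intro mult_strict_right_mono) auto
    moreover have "R * u > 0" using R u0 by simp
    ultimately have "u * u + (x$2)\<^sup>2 + (x$3)\<^sup>2 < 2 * (R * u)" by (simp add: field_simps)
    moreover have "cone_defect t x = 2 * (R * u) - (u * u + (x$2)\<^sup>2 + (x$3)\<^sup>2)"
      unfolding cone_defect_def u_def R_def by (simp add: power2_eq_square algebra_simps)
    ultimately show "x \<in> coneD_slice t" by (simp add: coneD_slice_eq[OF t])
    define y where "y = ln 4 - ln u"
    have y1: "y \<ge> 1"
    proof -
      have "(1/2::real)^k \<le> (1/2)^2" using that(2) by (intro power_decreasing) (auto simp: N_def)
      then have "4 * h \<le> 1" by (simp add: h_def power2_eq_square)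
      then have "ln u \<le> 0" using u u0 by simp
      moreover have "ln (4::real) = 2 * ln 2" using ln_realpow[of 2 2] by simp
      ultimately show ?thesis using ln2_ge_two_thirds by (simp add: y_def)
    qed
    have y2: "y \<le> real k + 1"
    proof -
      have "4 / u \<le> 4 / (3 * h)" using u h by (intro divide_left_mono) auto
      also have "\<dots> \<le> 2 * 2 ^ k" by (simp add: h_def power_divide)
      finally have "ln (4 / u) \<le> ln (2 ^ Suc k)" using u0 by (intro ln_mono) auto
      also have "\<dots> = real (Suc k) * ln 2" by (rule ln_realpow)
      also have "\<dots> \<le> real (Suc k) * 1" using ln_le_minus_one[of 2] by (intro mult_left_mono) auto
      finally show ?thesis using u0 by (simp add: y_def ln_div)
    qed
    have "16 * y * u\<^sup>2 \<le> 16 * (real k + 1) * (4 * h)\<^sup>2"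
      using y1 y2 u u0 by (intro mult_mono power_mono) auto
    also have "\<dots> = 256 * (real k + 1) / 4 ^ k"
    proof -
      have "h\<^sup>2 = 1 / 4 ^ k" by (simp add: h_def power_divide power2_eq_square flip: power_mult_distrib)
      then show ?thesis by (simp add: power_mult_distrib)
    qed
    finally have le: "16 * y * u\<^sup>2 \<le> 256 * (real k + 1) / 4 ^ k" .
    have "v k = c\<^sup>2 * (exp (-4) / (256 * (real k + 1) / 4 ^ k))" by (simp add: v_def)
    also have "\<dots> \<le> c\<^sup>2 * (exp (-4) / (16 * y * u\<^sup>2))"
      using le y1 u0 by (intro mult_left_mono divide_left_mono) auto
    also have "\<dots> \<le> c\<^sup>2 * (profile u * profile1 u)\<^sup>2"
      using profile_product_lower_bound[OF u0] y1 by (intro mult_left_mono) (auto simp: y_def)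
    finally show "v k \<le> (c * (profile (x$1 - t) * profile1 (x$1 - t)))\<^sup>2"
      by (simp add: power_mult_distrib u_def)
  qed
  have m: "(\<lambda>x :: real^3. ennreal ((c * (profile (x$1 - t) * profile1 (x$1 - t)))\<^sup>2) * indicator (coneD_slice t) x) \<in> borel_measurable borel"
  proof -
    have [measurable]: "coneD_slice t \<in> sets borel" using open_coneD_slice[OF t] by simp
    show ?thesis by measurable
  qed
  have inf: "(\<Sum>n. ennreal (v (N + n) * (4 * R * (1/4)^(N + n)))) = \<infinity>"
  proof (rule ccontr)
    define K where "K = c\<^sup>2 * exp (-4) * R / 64"
    have eq: "v k * (4 * R * (1/4)^k) = K * inverse (real (Suc k))" for k
    proof -
      have one: "(4::real)^k * (1/4)^k = 1" by (simp flip: power_mult_distrib)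
      have "v k * (4 * R * (1/4)^k) = K * inverse (real (Suc k)) * (4^k * (1/4)^k)"
        by (simp add: v_def K_def field_simps)
      then show ?thesis unfolding one by simp
    qed
    assume "(\<Sum>n. ennreal (v (N + n) * (4 * R * (1/4)^(N + n)))) \<noteq> \<infinity>"
    then have "summable (\<lambda>n. v (N + n) * (4 * R * (1/4)^(N + n)))"
      using R by (intro summable_suminf_not_top) (auto simp: v_def)
    then have "summable (\<lambda>n. K * inverse (real (Suc (n + N))))" unfolding eq by (simp only: add.commute)
    then have "summable (\<lambda>n. inverse (real (Suc (n + N))))"
      using c R by (simp add: K_def summable_cmult_iff)
    then have "summable (\<lambda>n. inverse (real (Suc n)))" by (rule summable_iff_shift[THEN iffD1])
    then have "summable (\<lambda>n. inverse (real n))" by (rule summable_Suc_iff[THEN iffD1])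
    then show False using not_summable_harmonic by blast
  qed
  have "(\<Sum>n. ennreal (v (N + n) * (4 * R * (1/4)^(N + n)))) = (\<Sum>n. \<integral>\<^sup>+x. ennreal (v (N + n)) * indicator (A (N + n)) x \<partial>lborel)"
  proof (rule suminf_cong)
    fix n
    have "ennreal (v (N + n) * (4 * R * (1/4)^(N + n))) = ennreal (v (N + n)) * ennreal (4 * R * (1/4)^(N + n))"
      using R by (intro ennreal_mult) (auto simp: v_def)
    also have "\<dots> = (\<integral>\<^sup>+x. ennreal (v (N + n)) * indicator (A (N + n)) x \<partial>lborel)"
      unfolding Ae[symmetric] by (rule nn_integral_cmult_indicator[symmetric]) (simp add: Am)
    finally show "ennreal (v (N + n) * (4 * R * (1/4)^(N + n))) = (\<integral>\<^sup>+x. ennreal (v (N + n)) * indicator (A (N + n)) x \<partial>lborel)" .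
  qed
  also have "\<dots> = (\<integral>\<^sup>+x. (\<Sum>n. ennreal (v (N + n)) * indicator (A (N + n)) x) \<partial>lborel)"
    using Am by (intro nn_integral_suminf[symmetric]) auto
  also have "\<dots> \<le> (\<integral>\<^sup>+x. ennreal ((c * (profile (x$1 - t) * profile1 (x$1 - t)))\<^sup>2) * indicator (coneD_slice t) x \<partial>lborel)"
  proof (intro nn_integral_mono)
    fix x
    show "(\<Sum>n. ennreal (v (N + n)) * indicator (A (N + n)) x) \<le> ennreal ((c * (profile (x$1 - t) * profile1 (x$1 - t)))\<^sup>2) * indicator (coneD_slice t) x"
    proof (cases "\<exists>n. x \<in> A (N + n)")
      case True
      then obtain n where n: "x \<in> A (N + n)" by blast
      have "(\<Sum>n. ennreal (v (N + n)) * indicator (A (N + n)) x) = ennreal (v (N + n))"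
        by (rule suminf_cmult_indicator[OF disj n])
      then show ?thesis using inA[OF n] by (auto intro: ennreal_leI)
    next
      case False
      then show ?thesis by simp
    qed
  qed
  also have "\<dots> = (\<integral>\<^sup>+x. ennreal ((c * (profile (x$1 - t) * profile1 (x$1 - t)))\<^sup>2) * indicator (coneD_slice t) x \<partial>lebesgue)"
    using m by (simp add: nn_integral_completion)
  also have "\<dots> = (\<integral>\<^sup>+x. ennreal ((c * (profile (x$1 - t) * profile1 (x$1 - t)))\<^sup>2) \<partial>lebesgue_on (coneD_slice t))"
    using open_coneD_slice[OF t] by (intro nn_integral_restrict_space[symmetric]) auto
  finally show ?thesis unfolding inf by (simp add: top.extremum_unique)
qed

section \<open>The functions f and h, the infinite norms and the regularity of the data\<close>

definition potential :: "real \<Rightarrow> real" where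
  "potential = antideriv profile"

definition source_potential :: "real \<Rightarrow> real" where
  "source_potential = antideriv (\<lambda>u. - 2 * (profile u)\<^sup>2)"

lemma Ck_on_source: "Ck_on k (\<lambda>u. - 2 * (profile u)\<^sup>2) {0<..}"
  unfolding power2_eq_square by (intro Ck_on_mult Ck_on_const Ck_on_profile open_greaterThan)

lemma continuous_on_source: "continuous_on {0<..} (\<lambda>u. - 2 * (profile u)\<^sup>2)"
  using Ck_on_source[of 0] by simp

lemma Ck_on_potentials: "Ck_on k potential {0<..}" "Ck_on k source_potential {0<..}"
  unfolding potential_def source_potential_def
  by (intro Ck_on_antideriv Ck_on_profile Ck_on_source)+

lemma potential_deriv: "u > 0 \<Longrightarrow> (potential has_real_derivative profile u) (at u)"
  unfolding potential_def by (rule has_derivative_antideriv[OF continuous_on_profile])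

lemma source_potential_deriv: "u > 0 \<Longrightarrow> (source_potential has_real_derivative - 2 * (profile u)\<^sup>2) (at u)"
  unfolding source_potential_def by (rule has_derivative_antideriv[OF continuous_on_source])

lemma source_deriv:
  "u > 0 \<Longrightarrow> ((\<lambda>u. - 2 * (profile u)\<^sup>2) has_real_derivative - 4 * (profile u * profile1 u)) (at u)"
  by (auto intro!: derivative_eq_intros profile_derivs)

lemma potential_measurable [measurable]:
  "potential \<in> borel_measurable borel" "source_potential \<in> borel_measurable borel"
  unfolding potential_def source_potential_def
  by (intro antideriv_measurable continuous_on_profile continuous_on_source)+

lemma Ck_on_profile1: "Ck_on k profile1 {0<..}"
proof (rule Ck_on_cong)
  show "Ck_on k (\<lambda>u. frechet_derivative profile (at u) 1) {0<..}"
    using Ck_on_profile[of "Suc k"] by simp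
  show "frechet_derivative profile (at u) 1 = profile1 u" if "u \<in> {0<..}" for u
    using frechet_derivative_at[OF profile_derivs(1)[of u, unfolded has_field_derivative_def]] that
    by (metis greaterThan_iff mult.right_neutral)
qed simp

text \<open>Every admissible family contains a second derivative in direction 1 whose second
  component has infinite square integral, so every member of the set under the infimum is infinite.
  The first component \<open>f1\<close> is arbitrary.\<close>

lemma sobolev_norm_infinite:
  assumes t: "0 \<le> t" "t < 1" and c: "c \<noteq> 0"
  shows "sobolev_norm 2 (coneD_slice t) (\<lambda>x. (f1 x, c * source_potential (x$1 - t))) = \<infinity>"
proof -
  let ?\<alpha> = "\<lambda>i :: 3. if i = 1 then 2 else 0 :: nat"
  have top: "ennsqrt (\<Sum>\<alpha> | sum \<alpha> UNIV \<le> 2. \<integral>\<^sup>+x. ennreal ((norm (g \<alpha> x))\<^sup>2) \<partial>lebesgue_on (coneD_slice t)) = \<infinity>"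
    if g: "\<forall>\<alpha>. sum \<alpha> UNIV \<le> 2 \<longrightarrow> has_weak_partial \<alpha> (coneD_slice t) (\<lambda>x. (f1 x, c * source_potential (x$1 - t))) (g \<alpha>)" for g
  proof -
    have \<alpha>: "sum ?\<alpha> UNIV \<le> 2" by (simp add: sum_3)
    have "(\<integral>\<^sup>+x. ennreal ((c * (- 4 * (profile (x$1 - t) * profile1 (x$1 - t))))\<^sup>2) \<partial>lebesgue_on (coneD_slice t)) \<le>
      (\<integral>\<^sup>+x. ennreal ((norm (g ?\<alpha> x))\<^sup>2) \<partial>lebesgue_on (coneD_slice t))"
    proof (rule weak_second_derivative_lower_bound[OF t])
      show "((\<lambda>u. c * source_potential u) has_real_derivative c * (- 2 * (profile u)\<^sup>2)) (at u)" if "u > 0" for u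
        by (rule DERIV_cmult[OF source_potential_deriv[OF that]])
      show "((\<lambda>u. c * (- 2 * (profile u)\<^sup>2)) has_real_derivative c * (- 4 * (profile u * profile1 u))) (at u)" if "u > 0" for u
        by (rule DERIV_cmult[OF source_deriv[OF that]])
      show "Ck_on k (\<lambda>u. c * (- 4 * (profile u * profile1 u))) {0<..}" for k
        by (intro Ck_on_mult Ck_on_const Ck_on_profile Ck_on_profile1 open_greaterThan)
      show "has_weak_partial ?\<alpha> (coneD_slice t) (\<lambda>x. (f1 x, c * source_potential (x$1 - t))) (g ?\<alpha>)"
        using g \<alpha> by blast
    qed measurable
    moreover have "(\<integral>\<^sup>+x. ennreal ((c * (- 4 * (profile (x$1 - t) * profile1 (x$1 - t))))\<^sup>2) \<partial>lebesgue_on (coneD_slice t)) = \<infinity>"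
      using nn_integral_profile_product_infinite[OF t, of "c * (- 4)"] c unfolding mult.assoc by simp
    ultimately have "(\<integral>\<^sup>+x. ennreal ((norm (g ?\<alpha> x))\<^sup>2) \<partial>lebesgue_on (coneD_slice t)) = \<infinity>"
      by (simp add: top.extremum_unique)
    then have "(\<Sum>\<alpha> | sum \<alpha> UNIV \<le> 2. \<integral>\<^sup>+x. ennreal ((norm (g \<alpha> x))\<^sup>2) \<partial>lebesgue_on (coneD_slice t)) = \<infinity>"
      unfolding infinity_ennreal_def ennreal_sum_eq_top[OF finite_multi_indices]
      by (intro bexI[of _ ?\<alpha>]) (use \<alpha> in \<open>auto simp: sum_3\<close>)
    then show ?thesis by (simp add: ennsqrt_def)
  qed
  have "\<infinity> \<le> sobolev_norm 2 (coneD_slice t) (\<lambda>x. (f1 x, c * source_potential (x$1 - t)))"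
    unfolding sobolev_norm_def
  proof (rule Inf_greatest, clarify)
    fix g assume "\<forall>\<alpha>. sum \<alpha> UNIV \<le> 2 \<longrightarrow> has_weak_partial \<alpha> (coneD_slice t) (\<lambda>x. (f1 x, c * source_potential (x$1 - t))) (g \<alpha>)"
    from top[OF this]
    show "\<infinity> \<le> ennsqrt (\<Sum>\<alpha> | sum \<alpha> UNIV \<le> 2. \<integral>\<^sup>+x. ennreal ((norm (g \<alpha> x))\<^sup>2) \<partial>lebesgue_on (coneD_slice t))"
      by simp
  qed
  then show ?thesis by (simp add: top.extremum_unique)
qed

text \<open>Up to constant factors these are extensions of the initial values of
  \<open>\<phi>1\<close>, of its time derivative and of the time derivative of
  \<open>\<phi>2\<close>. The logarithmic weight is needed in the first two, where
  \<open>profile1\<close> occurs; in the third the derivative is only of the size of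
  \<open>profile^2\<close>.\<close>

lemma in_sobolev_data:
  "in_sobolev 2 (extend_C1 potential profile)" "in_sobolev 1 (extend profile)" "in_sobolev 1 (extend source_potential)"
proof -
  obtain C where C: "C \<ge> 1" "\<And>u. u > 0 \<Longrightarrow> (profile u)\<^sup>2 \<le> C / sqrt u" "\<And>u. u > 0 \<Longrightarrow> \<bar>profile u\<bar> \<le> C / sqrt u"
    "\<And>u. u > 0 \<Longrightarrow> \<bar>profile1 u\<bar> \<le> C / u" "\<And>u. u > 0 \<Longrightarrow> \<bar>profile2 u\<bar> \<le> C / u\<^sup>2"
    "\<And>u. 0 < u \<Longrightarrow> u < 4 \<Longrightarrow> (profile1 u)\<^sup>2 \<le> C * ((1 + (ln 4 - ln u)) powr (-3/2) / u\<^sup>2)"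
    using profile_bounds by blast
  have weight: "(profile1 u)\<^sup>2 \<le> C * (1 / u + log_weight u)" if "0 < u" "u < 2" for u
  proof -
    have "(profile1 u)\<^sup>2 \<le> C * log_weight u" using C(6)[of u] that by (simp add: log_weight_def)
    also have "\<dots> \<le> C * (1 / u + log_weight u)" using C(1) that by (intro mult_left_mono) auto
    finally show ?thesis .
  qed
  have pot0: "potential u = 0" "source_potential u = 0" if "u \<ge> 4" for u
    unfolding potential_def source_potential_def
    by (rule antideriv_eq_0[OF continuous_on_profile] antideriv_eq_0[OF continuous_on_source];
        simp add: profile_eq_0 that)+
  have pot: "\<bar>potential u\<bar> \<le> 4 * C / sqrt u" if "u > 0" for u
    unfolding potential_def using that C(3)
    by (intro antideriv_bound continuous_on_profile) (auto simp: profile_eq_0)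
  have src: "\<bar>- 2 * (profile u)\<^sup>2\<bar> \<le> 2 * C / sqrt u" if "u > 0" for u
    using C(2)[OF that] by simp
  have spot: "\<bar>source_potential u\<bar> \<le> 4 * (2 * C) / sqrt u" if "u > 0" for u
    unfolding source_potential_def using that src
    by (intro antideriv_bound continuous_on_source) (auto simp: profile_eq_0)
  have le4: "C / a \<le> 4 * C / a" if "a > 0" for a using that C(1) by (intro divide_right_mono) auto
  show "in_sobolev 2 (extend_C1 potential profile)"
  proof (rule in_sobolev_extend_C1)
    show "(profile1 u)\<^sup>2 \<le> 4 * C * (1 / u + log_weight u)" if "0 < u" "u < 2" for u
    proof -
      have "C * (1 / u + log_weight u) \<le> 4 * C * (1 / u + log_weight u)"
        using C(1) that by (intro mult_right_mono) (auto intro!: add_nonneg_nonneg log_weight_nonneg)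
      then show ?thesis using weight[OF that] by linarith
    qed
    fix u :: real assume u: "u > 0"
    show "\<bar>profile u\<bar> \<le> 4 * C / sqrt u" using C(3)[OF u] le4[of "sqrt u"] u by auto
    show "\<bar>profile1 u\<bar> \<le> 4 * C / u" using C(4)[OF u] le4[of u] u by auto
    show "\<bar>profile2 u\<bar> \<le> 4 * C / u\<^sup>2" using C(5)[OF u] le4[of "u\<^sup>2"] u by auto
  qed (use pot pot0 in \<open>auto simp: profile_eq_0 potential_deriv profile_derivs\<close>)
  show "in_sobolev 1 (extend profile)"
    by (rule in_sobolev_extend[where k' = profile1 and C = C])
       (use C weight in \<open>auto simp: profile_eq_0 profile_derivs\<close>)
  have CC: "C \<le> C\<^sup>2" using C(1) by (simp add: power2_eq_square)
  show "in_sobolev 1 (extend source_potential)"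
  \<comment> \<open>The constant \<open>8 * C^2\<close> covers the 8 C of the antiderivative bound
    and the 4 C^2 from squaring \<open>2 * C / sqrt u\<close>.\<close>
  proof (rule in_sobolev_extend[where k' = "\<lambda>u. - 2 * (profile u)\<^sup>2" and C = "8 * C\<^sup>2"])
    fix u :: real
    show "(source_potential has_real_derivative - 2 * (profile u)\<^sup>2) (at u)" if "u > 0"
      by (rule source_potential_deriv[OF that])
    show "\<bar>source_potential u\<bar> \<le> 8 * C\<^sup>2 / sqrt u" if u: "u > 0"
    proof -
      have "4 * (2 * C) / sqrt u \<le> 8 * C\<^sup>2 / sqrt u" using CC u by (intro divide_right_mono) auto
      then show ?thesis using spot[OF u] by linarith
    qed
    show "\<bar>- 2 * (profile u)\<^sup>2\<bar> \<le> 8 * C\<^sup>2 / u" if u: "u > 0"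
    proof (cases "u < 4")
      case True
      have "sqrt u \<le> 2" using real_sqrt_le_mono[of u 4] True by simp
      have "2 * C / sqrt u = 2 * C * sqrt u / u" using u by (simp add: field_simps)
      also have "\<dots> \<le> 8 * C\<^sup>2 / u"
      proof (rule divide_right_mono)
        have "2 * C * sqrt u \<le> 2 * C * 2" using \<open>sqrt u \<le> 2\<close> C(1) by (intro mult_left_mono) auto
        then show "2 * C * sqrt u \<le> 8 * C\<^sup>2" using CC C(1) by linarith
      qed (use u in simp)
      finally show ?thesis using src[OF u] by linarith
    qed (use u in \<open>simp add: profile_eq_0\<close>)
    show "(- 2 * (profile u)\<^sup>2)\<^sup>2 \<le> 8 * C\<^sup>2 * (1 / u + log_weight u)" if "0 < u" "u < 2"
    proof -
      have "(- 2 * (profile u)\<^sup>2)\<^sup>2 \<le> (2 * C / sqrt u)\<^sup>2"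
        using src[OF that(1)] by (intro abs_le_square_iff[THEN iffD1]) linarith
      also have "\<dots> = 4 * C\<^sup>2 * (1 / u)" using that by (simp add: power_divide power_mult_distrib)
      also have "\<dots> \<le> 8 * C\<^sup>2 * (1 / u + log_weight u)"
        using that by (intro mult_mono) (auto intro!: log_weight_nonneg)
      finally show ?thesis .
    qed
  qed (use pot0 in \<open>auto simp: profile_eq_0\<close>)
qed

section \<open>Plane waves with linear amplitude\<close>

text \<open>The class is closed under all first partial derivatives, so second derivatives come from
  applying one rule twice.\<close>

definition wave_profile :: "(real \<Rightarrow> real) \<Rightarrow> (real \<Rightarrow> real) \<Rightarrow> real \<times> (real^3) \<Rightarrow> real" where
  "wave_profile a c p = a (snd p $ 1 - fst p) + fst p * c (snd p $ 1 - fst p)"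

text \<open>An open neighbourhood of the cone, which itself contains its initial slice and is not
  open; two-sided derivatives at time 0 are computed here.\<close>

definition half_space :: "(real \<times> (real^3)) set" where
  "half_space = {p. 0 < snd p $ 1 - fst p}"

lemma open_half_space: "open half_space"
  unfolding half_space_def by (intro open_Collect_less continuous_intros)

lemma coneD_subset_half_space: "coneD \<subseteq> half_space"
proof
  fix p assume p: "p \<in> coneD"
  then have "0 \<le> fst p" "fst p < 1" "snd p \<in> coneD_slice (fst p)"
    by (auto simp: coneD_slice_def) (auto simp: coneD_def)
  then show "p \<in> half_space" using coneD_slice_bounds(1)[of "fst p" "snd p"] by (simp add: half_space_def)
qed

lemma bounded_linear_retarded: "bounded_linear (\<lambda>p :: real \<times> (real^3). snd p $ 1 - fst p)"
  by (intro bounded_linear_sub bounded_linear_fst bounded_linear_compose[OF bounded_linear_vec_nth bounded_linear_snd])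

lemma Ck_on_wave_profile:
  assumes "\<And>k. Ck_on k a {0<..}" "\<And>k. Ck_on k c {0<..}"
  shows "Ck_on k (wave_profile a c) half_space"
proof -
  have "Ck_on k (\<lambda>p. f (snd p $ 1 - fst p)) half_space" if "Ck_on k f {0<..}" for f
    by (rule Ck_on_compose[OF open_half_space _ _ Ck_on_linear[OF bounded_linear_retarded] that]) (auto simp: half_space_def)
  then show ?thesis
    unfolding wave_profile_def[abs_def] using assms
    by (intro Ck_on_add Ck_on_mult open_half_space Ck_on_linear[OF bounded_linear_fst]) auto
qed

lemma smooth_on_wave_profile:
  assumes "\<And>k. Ck_on k a {0<..}" "\<And>k. Ck_on k c {0<..}"
  shows "smooth_on coneD (wave_profile a c)"
  unfolding smooth_on_def
  using open_half_space coneD_subset_half_space Ck_on_wave_profile[OF assms] by blast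

lemma wave_profile_derivs:
  assumes "p \<in> half_space" and a: "\<And>u. u > 0 \<Longrightarrow> (a has_real_derivative a' u) (at u)"
    and c: "\<And>u. u > 0 \<Longrightarrow> (c has_real_derivative c' u) (at u)"
  shows "dt (wave_profile a c) p = wave_profile (\<lambda>u. c u - a' u) (\<lambda>u. - c' u) p"
    and "dx i (wave_profile a c) p = (if i = 1 then wave_profile a' c' p else 0)"
proof -
  define u where "u = snd p $ 1 - fst p"
  have u: "u > 0" using assms(1) by (simp add: half_space_def u_def)
  have l: "((\<lambda>p :: real \<times> (real^3). snd p $ 1 - fst p) has_derivative (\<lambda>v. snd v $ 1 - fst v)) (at p)"
    by (rule bounded_linear_imp_has_derivative[OF bounded_linear_retarded])
  have chain: "((\<lambda>p. f (snd p $ 1 - fst p)) has_derivative (\<lambda>v. f' * (snd v $ 1 - fst v))) (at p)"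
    if "(f has_real_derivative f') (at u)" for f f'
    using has_derivative_compose[OF l that[unfolded has_field_derivative_def u_def]] by simp
  have "(wave_profile a c has_derivative
      (\<lambda>v. a' u * (snd v $ 1 - fst v) + (fst p * (c' u * (snd v $ 1 - fst v)) + fst v * c (snd p $ 1 - fst p)))) (at p)"
    unfolding wave_profile_def[abs_def]
    by (intro has_derivative_add has_derivative_mult chain a c u has_derivative_fst has_derivative_ident)
  then have "frechet_derivative (wave_profile a c) (at p) =
      (\<lambda>v. a' u * (snd v $ 1 - fst v) + (fst p * (c' u * (snd v $ 1 - fst v)) + fst v * c (snd p $ 1 - fst p)))"
    by (rule frechet_derivative_at[symmetric])
  then show "dt (wave_profile a c) p = wave_profile (\<lambda>u. c u - a' u) (\<lambda>u. - c' u) p"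
    and "dx i (wave_profile a c) p = (if i = 1 then wave_profile a' c' p else 0)"
    by (auto simp: dt_def dx_def wave_profile_def u_def axis_def)
qed

lemma dt_dx_cong:
  assumes "p \<in> half_space" "\<And>q. q \<in> half_space \<Longrightarrow> f q = g q"
  shows "dt f p = dt g p" "dx i f p = dx i g p"
  unfolding dt_def dx_def using frechet_derivative_cong_open[OF open_half_space assms] by simp_all

text \<open>Functions of \<open>x $ 1 - t\<close> alone solve the wave equation. For
  \<open>t * c\<close> the terms \<open>t * c''\<close> cancel, and only the mixed term - 2 c' of
  the second time derivative survives, with the sign reversed.\<close>

lemma wave_op_wave_profile:
  assumes p: "p \<in> half_space"
    and a: "\<And>u. u > 0 \<Longrightarrow> (a has_real_derivative a' u) (at u)" "\<And>u. u > 0 \<Longrightarrow> (a' has_real_derivative a'' u) (at u)"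
    and c: "\<And>u. u > 0 \<Longrightarrow> (c has_real_derivative c' u) (at u)" "\<And>u. u > 0 \<Longrightarrow> (c' has_real_derivative c'' u) (at u)"
  shows "wave_op (wave_profile a c) p = 2 * c' (snd p $ 1 - fst p)"
proof -
  have "dt (dt (wave_profile a c)) p = dt (wave_profile (\<lambda>u. c u - a' u) (\<lambda>u. - c' u)) p"
    by (rule dt_dx_cong[OF p]) (rule wave_profile_derivs(1)[OF _ a(1) c(1)])
  also have "\<dots> = wave_profile (\<lambda>u. - c' u - (c' u - a'' u)) (\<lambda>u. - (- c'' u)) p"
    by (rule wave_profile_derivs(1)[OF p]) (intro DERIV_diff DERIV_minus a c; assumption)+
  finally have tt: "dt (dt (wave_profile a c)) p = wave_profile (\<lambda>u. - c' u - (c' u - a'' u)) (\<lambda>u. - (- c'' u)) p" .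
  have "dx 1 (dx 1 (wave_profile a c)) p = dx 1 (wave_profile a' c') p"
    by (rule dt_dx_cong[OF p]) (simp add: wave_profile_derivs(2)[OF _ a(1) c(1)])
  also have "\<dots> = wave_profile a'' c'' p"
    using wave_profile_derivs(2)[OF p a(2) c(2), of 1] by simp
  finally have xx: "dx 1 (dx 1 (wave_profile a c)) p = wave_profile a'' c'' p" .
  have "dx i (dx i (wave_profile a c)) p = 0" if "i \<noteq> 1" for i
  proof -
    have "dx i (dx i (wave_profile a c)) p = dx i (\<lambda>q. 0) p"
      by (rule dt_dx_cong[OF p]) (simp add: wave_profile_derivs(2)[OF _ a(1) c(1)] that)
    then show ?thesis by (simp add: dx_def frechet_derivative_const)
  qed
  then show ?thesis
    by (simp add: wave_op_def tt xx) (simp add: wave_profile_def algebra_simps)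
qed

section \<open>The scaled solution and its data\<close>

lemma half_sq_less_iff: "x \<in> coneD_slice 0 \<longleftrightarrow> half_sq x < x$1"
  by (simp add: coneD_slice_eq cone_defect_def half_sq_def power2_eq_square algebra_simps)

theorem proposition1p2:
  shows "\<exists>C::real. C > 0 \<and> (\<forall>\<epsilon>::real. \<epsilon> > 0 \<longrightarrow>
    (\<exists>\<phi>1 \<phi>2 :: real \<times> (real^3) \<Rightarrow> real.
      smooth_on coneD \<phi>1 \<and> smooth_on coneD \<phi>2 \<and>
      (\<forall>p\<in>coneD. wave_op \<phi>2 p = - (Lbar \<phi>1 p)\<^sup>2 \<and> wave_op \<phi>1 p = 0) \<and>
      sobolev_norm 2 (coneD_slice 0) (\<lambda>x. (\<phi>1 (0, x), \<phi>2 (0, x))) +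
        sobolev_norm 1 (coneD_slice 0) (\<lambda>x. (dt \<phi>1 (0, x), dt \<phi>2 (0, x))) \<le> ennreal \<epsilon> \<and>
      (\<forall>t. 0 < t \<and> t < 1 \<longrightarrow>
        sobolev_norm 2 (coneD_slice t) (\<lambda>x. (\<phi>1 (t, x), \<phi>2 (t, x))) +
          sobolev_norm 1 (coneD_slice t) (\<lambda>x. (dt \<phi>1 (t, x), dt \<phi>2 (t, x))) = \<infinity>) \<and>
      (\<exists>F G :: real^3 \<Rightarrow> real \<times> real.
        (\<forall>x\<in>coneD_slice 0. F x = (\<phi>1 (0, x), \<phi>2 (0, x)) \<and>
                         G x = (dt \<phi>1 (0, x), dt \<phi>2 (0, x))) \<and>
        sobolev_norm 2 UNIV F + sobolev_norm 1 UNIV G \<le> ennreal (C * \<epsilon>))))"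
proof (intro exI[of _ 1] conjI allI impI)
  \<comment> \<open>\<open>C = 1\<close> works because the extended data are made smaller than
    \<open>\<epsilon>\<close> first; the bound on the ball follows by restriction.\<close>
  fix \<epsilon> :: real assume \<epsilon>: "\<epsilon> > 0"
  obtain M2 where M2: "M2 \<ge> 0" "\<And>a b \<delta>. \<bar>a\<bar> \<le> \<delta> \<Longrightarrow> \<bar>b\<bar> \<le> \<delta> \<Longrightarrow>
      sobolev_norm 2 UNIV (\<lambda>x. (a * extend_C1 potential profile x, b * extend_C1 potential profile x)) \<le> ennreal (\<delta> * M2)"
    using sobolev_norm_Pair_le[OF in_sobolev_data(1,1)] by blast
  obtain M1 where M1: "M1 \<ge> 0" "\<And>a b \<delta>. \<bar>a\<bar> \<le> \<delta> \<Longrightarrow> \<bar>b\<bar> \<le> \<delta> \<Longrightarrow>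
      sobolev_norm 1 UNIV (\<lambda>x. (a * extend profile x, b * extend source_potential x)) \<le> ennreal (\<delta> * M1)"
    using sobolev_norm_Pair_le[OF in_sobolev_data(2,3)] by blast
  \<comment> \<open>The minimum with 1 gives \<open>\<delta>^2 <= \<delta>\<close>, so that one
    scale controls both components; the summand 1 keeps the denominator positive.\<close>
  define \<delta> where "\<delta> = min 1 (\<epsilon> / (M1 + M2 + 1))"
  have \<delta>: "\<delta> > 0" "\<delta> \<le> 1" "\<delta> * M2 + \<delta> * M1 \<le> \<epsilon>"
  proof -
    show "\<delta> > 0" "\<delta> \<le> 1" using \<epsilon> M1(1) M2(1) by (auto simp: \<delta>_def)
    have "\<delta> * (M2 + M1) \<le> \<epsilon> / (M1 + M2 + 1) * (M1 + M2 + 1)"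
      using \<epsilon> M1(1) M2(1) by (intro mult_mono) (auto simp: \<delta>_def)
    also have "\<dots> = \<epsilon>" using M1(1) M2(1) by (intro nonzero_eq_divide_eq[THEN iffD1]) auto
    finally show "\<delta> * M2 + \<delta> * M1 \<le> \<epsilon>" by (simp add: distrib_left)
  qed
  define \<phi>1 where "\<phi>1 = wave_profile (\<lambda>u. \<delta> * potential u) (\<lambda>u. 0)"
  define \<phi>2 where "\<phi>2 = wave_profile (\<lambda>u. 0) (\<lambda>u. \<delta>\<^sup>2 * source_potential u)"
  \<comment> \<open>\<open>\<phi>2\<close> vanishes at time 0. Its zero is written as a multiple of
    the same function to match the estimate for pairs.\<close>
  define F where "F = (\<lambda>x. (\<delta> * extend_C1 potential profile x, 0 * extend_C1 potential profile x))"
  define G where "G = (\<lambda>x. ((- \<delta>) * extend profile x, \<delta>\<^sup>2 * extend source_potential x))"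
  have der1: "((\<lambda>u. \<delta> * potential u) has_real_derivative \<delta> * profile u) (at u)"
    "((\<lambda>u. \<delta> * profile u) has_real_derivative \<delta> * profile1 u) (at u)"
    "((\<lambda>u. \<delta>\<^sup>2 * source_potential u) has_real_derivative \<delta>\<^sup>2 * (- 2 * (profile u)\<^sup>2)) (at u)"
    "((\<lambda>u. \<delta>\<^sup>2 * (- 2 * (profile u)\<^sup>2)) has_real_derivative \<delta>\<^sup>2 * (- 4 * (profile u * profile1 u))) (at u)"
    if "u > 0" for u
    by (intro DERIV_cmult potential_deriv source_potential_deriv profile_derivs source_deriv that)+
  have zero: "((\<lambda>u. 0) has_real_derivative 0) (at u)" for u :: real by simp
  have dt1: "dt \<phi>1 p = - \<delta> * profile (snd p $ 1 - fst p)"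
    and dx1: "dx 1 \<phi>1 p = \<delta> * profile (snd p $ 1 - fst p)" if "p \<in> half_space" for p
    using wave_profile_derivs(1)[OF that der1(1) zero]
      wave_profile_derivs(2)[OF that der1(1) zero, of 1]
    unfolding \<phi>1_def by (simp_all add: wave_profile_def)
  have dt2: "dt \<phi>2 p = \<delta>\<^sup>2 * source_potential (snd p $ 1 - fst p) + 2 * fst p * \<delta>\<^sup>2 * (profile (snd p $ 1 - fst p))\<^sup>2"
    if "p \<in> half_space" for p
    using wave_profile_derivs(1)[OF that zero der1(3)]
    unfolding \<phi>2_def by (simp add: wave_profile_def)
  have FG: "F x = (\<phi>1 (0, x), \<phi>2 (0, x))" "G x = (dt \<phi>1 (0, x), dt \<phi>2 (0, x))" if "x \<in> coneD_slice 0" for x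
  proof -
    have x: "half_sq x < x$1" using that by (simp add: half_sq_less_iff)
    have "(0, x) \<in> half_space" using that coneD_subset_half_space by (auto simp: coneD_slice_def)
    then show "F x = (\<phi>1 (0, x), \<phi>2 (0, x))" "G x = (dt \<phi>1 (0, x), dt \<phi>2 (0, x))"
      using x by (auto simp: F_def G_def extend_C1_def extend_def \<phi>1_def \<phi>2_def wave_profile_def dt1[unfolded \<phi>1_def] dt2[unfolded \<phi>2_def])
  qed
  have norms: "sobolev_norm 2 UNIV F + sobolev_norm 1 UNIV G \<le> ennreal \<epsilon>"
  proof -
    have "\<delta>\<^sup>2 \<le> \<delta>" using \<delta> by (simp add: power2_eq_square mult_left_le_one_le)
    then have "sobolev_norm 2 UNIV F + sobolev_norm 1 UNIV G \<le> ennreal (\<delta> * M2) + ennreal (\<delta> * M1)"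
      unfolding F_def G_def using \<delta> by (intro add_mono M1(2) M2(2)) auto
    also have "\<dots> = ennreal (\<delta> * M2 + \<delta> * M1)" using \<delta> M1(1) M2(1) by (simp add: ennreal_plus)
    also have "\<dots> \<le> ennreal \<epsilon>" using \<delta> by (intro ennreal_leI)
    finally show ?thesis .
  qed
  show "\<exists>\<phi>1 \<phi>2 :: real \<times> (real^3) \<Rightarrow> real.
      smooth_on coneD \<phi>1 \<and> smooth_on coneD \<phi>2 \<and>
      (\<forall>p\<in>coneD. wave_op \<phi>2 p = - (Lbar \<phi>1 p)\<^sup>2 \<and> wave_op \<phi>1 p = 0) \<and>
      sobolev_norm 2 (coneD_slice 0) (\<lambda>x. (\<phi>1 (0, x), \<phi>2 (0, x))) +
        sobolev_norm 1 (coneD_slice 0) (\<lambda>x. (dt \<phi>1 (0, x), dt \<phi>2 (0, x))) \<le> ennreal \<epsilon> \<and>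
      (\<forall>t. 0 < t \<and> t < 1 \<longrightarrow>
        sobolev_norm 2 (coneD_slice t) (\<lambda>x. (\<phi>1 (t, x), \<phi>2 (t, x))) +
          sobolev_norm 1 (coneD_slice t) (\<lambda>x. (dt \<phi>1 (t, x), dt \<phi>2 (t, x))) = \<infinity>) \<and>
      (\<exists>F G :: real^3 \<Rightarrow> real \<times> real.
        (\<forall>x\<in>coneD_slice 0. F x = (\<phi>1 (0, x), \<phi>2 (0, x)) \<and>
                         G x = (dt \<phi>1 (0, x), dt \<phi>2 (0, x))) \<and>
        sobolev_norm 2 UNIV F + sobolev_norm 1 UNIV G \<le> ennreal (1 * \<epsilon>))"
  proof (rule exI[of _ \<phi>1], rule exI[of _ \<phi>2], intro conjI ballI allI impI)
    show "smooth_on coneD \<phi>1" "smooth_on coneD \<phi>2"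
      unfolding \<phi>1_def \<phi>2_def
      by (intro smooth_on_wave_profile Ck_on_mult Ck_on_const Ck_on_potentials open_greaterThan)+
    show "wave_op \<phi>2 p = - (Lbar \<phi>1 p)\<^sup>2" "wave_op \<phi>1 p = 0" if "p \<in> coneD" for p
    proof -
      have p: "p \<in> half_space" using that coneD_subset_half_space by blast
      show "wave_op \<phi>1 p = 0"
        unfolding \<phi>1_def
        by (subst wave_op_wave_profile[OF p der1(1,2) zero zero]) auto
      have "wave_op \<phi>2 p = 2 * (\<delta>\<^sup>2 * (- 2 * (profile (snd p $ 1 - fst p))\<^sup>2))"
        unfolding \<phi>2_def
        by (rule wave_op_wave_profile[OF p zero zero der1(3,4)])
      then show "wave_op \<phi>2 p = - (Lbar \<phi>1 p)\<^sup>2"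
        by (simp add: Lbar_def dt1[OF p] dx1[OF p] power2_eq_square algebra_simps)
    qed
    have "sobolev_norm 2 (coneD_slice 0) (\<lambda>x. (\<phi>1 (0, x), \<phi>2 (0, x))) \<le> sobolev_norm 2 UNIV F"
      using FG(1) by (intro sobolev_norm_restrict_le open_coneD_slice) auto
    moreover have "sobolev_norm 1 (coneD_slice 0) (\<lambda>x. (dt \<phi>1 (0, x), dt \<phi>2 (0, x))) \<le> sobolev_norm 1 UNIV G"
      using FG(2) by (intro sobolev_norm_restrict_le open_coneD_slice) auto
    ultimately show "sobolev_norm 2 (coneD_slice 0) (\<lambda>x. (\<phi>1 (0, x), \<phi>2 (0, x))) +
        sobolev_norm 1 (coneD_slice 0) (\<lambda>x. (dt \<phi>1 (0, x), dt \<phi>2 (0, x))) \<le> ennreal \<epsilon>"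
      using norms by (meson add_mono order_trans)
    show "sobolev_norm 2 (coneD_slice t) (\<lambda>x. (\<phi>1 (t, x), \<phi>2 (t, x))) +
          sobolev_norm 1 (coneD_slice t) (\<lambda>x. (dt \<phi>1 (t, x), dt \<phi>2 (t, x))) = \<infinity>" if "0 < t \<and> t < 1" for t
    proof -
      \<comment> \<open>The coefficient \<open>t * \<delta>^2\<close> is nonzero for
        \<open>t > 0\<close>, so the first norm alone is already infinite.\<close>
      have "\<phi>2 (t, x) = (t * \<delta>\<^sup>2) * source_potential (x$1 - t)" for x
        by (simp add: \<phi>2_def wave_profile_def)
      then show ?thesis using sobolev_norm_infinite[of t "t * \<delta>\<^sup>2" "\<lambda>x. \<phi>1 (t, x)"] that \<delta> by simp
    qed
    show "\<exists>F G :: real^3 \<Rightarrow> real \<times> real.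
        (\<forall>x\<in>coneD_slice 0. F x = (\<phi>1 (0, x), \<phi>2 (0, x)) \<and> G x = (dt \<phi>1 (0, x), dt \<phi>2 (0, x))) \<and>
        sobolev_norm 2 UNIV F + sobolev_norm 1 UNIV G \<le> ennreal (1 * \<epsilon>)"
      using FG norms by (intro exI[of _ F] exI[of _ G]) simp
  qed
qed simp

end
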